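(* Let $\boldsymbol u\in\boldsymbol H^1_{\rm qp}(\Omega)$ be the solution of the variational problem: $\boldsymbol u=-\boldsymbol u^{\rm inc}$ on $S$ and $a(\boldsymbol u,\boldsymbol v)=0$ for all $\boldsymbol v\in\boldsymbol H^1_{S,{\rm qp}}(\Omega)$. Then there is a constant $C>0$ independent of $N$ such that, for all sufficiently large $N$ (so that $\beta_2^{(n)}$ is purely imaginary for all $|n|>N$) and every $\boldsymbol v\in\boldsymbol H^1_{\rm qp}(\Omega)$, $$\left|\int_\Gamma(\mathscr T-\mathscr T_N)\boldsymbol u\cdot\overline{\boldsymbol v}\,{\rm d}s\right|\le C\max_{|n|>N}\left(|n|\,e^{{\rm i}\beta_2^{(n)}(b-b')}\right)\|\boldsymbol u^{\rm inc}\|_{\boldsymbol H^1(\Omega)}\|\boldsymbol v\|_{\boldsymbol H^1(\Omega)}.$$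
   Context: Geometry. $\boldsymbol x=(x,y)$, $\Lambda>0$, $f$ is a $\Lambda$-periodic Lipschitz function, $S=\{y=f(x),\,0<x<\Lambda\}$. $b>b'>\max_{x\in(0,\Lambda)}f(x)$ are constants, $\Gamma=\{y=b,\,0<x<\Lambda\}$, $\Omega=\{f(x)<y<b,\,0<x<\Lambda\}$. Parameters. $\omega>0$, $\mu>0$, $\lambda+\mu>0$, $\kappa_1=\omega/(\lambda+2\mu)^{1/2}$, $\kappa_2=\omega/\mu^{1/2}$, $\theta\in(-\pi/2,\pi/2)$, $\boldsymbol d=(\sin\theta,-\cos\theta)^\top$, incident wave $\boldsymbol u^{\rm inc}(\boldsymbol x)=\boldsymbol d\,e^{{\rm i}\kappa_1\boldsymbol x\cdot\boldsymbol d}$. $\alpha=\kappa_1\sin\theta$, $\alpha_n=\alpha+2\pi n/\Lambda$ for $n\in\mathbb Z$. $\beta_j^{(n)}=(\kappa_j^2-\alpha_n^2)^{1/2}$ if $|\alpha_n|<\kappa_j$ and $\beta_j^{(n)}={\rm i}(\alpha_n^2-\kappa_j^2)^{1/2}$ if $|\alpha_n|>\kappa_j$, $j=1,2$; it is assumed that $\kappa_j\ne|\alpha_n|$ for all $n\in\mathbb Z$. $\chi_n=\alpha_n^2+\beta_1^{(n)}\beta_2^{(n)}$. Spaces. $H^1_{\rm qp}(\Omega)=\{u\in H^1(\Omega):u(\Lambda,y)=u(0,y)e^{{\rm i}\alpha\Lambda}\}$, $H^1_{S,{\rm qp}}(\Omega)=\{u\in H^1_{\rm qp}(\Omega):u=0\text{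 on }S\}$, with the $H^1(\Omega)$ norm; bold letters denote Cartesian squares (vector-valued functions with the 2-norm). For $u\in H^1_{\rm qp}(\Omega)$, $u^{(n)}(b)=\frac1\Lambda\int_0^\Lambda u(x,b)e^{-{\rm i}\alpha_n x}\,{\rm d}x$. DtN operator and truncation. $\mathscr T\boldsymbol u=\sum_{n\in\mathbb Z}M^{(n)}(u_1^{(n)}(b),u_2^{(n)}(b))^\top e^{{\rm i}\alpha_n x}$ and $\mathscr T_N\boldsymbol u=\sum_{|n|\le N}M^{(n)}(u_1^{(n)}(b),u_2^{(n)}(b))^\top e^{{\rm i}\alpha_n x}$ on $\Gamma$, where $$M^{(n)}=\frac{\rm i}{\chi_n}\begin{bmatrix}\omega^2\beta_1^{(n)}&\mu\alpha_n\chi_n-\omega^2\alpha_n\\ \omega^2\alpha_n-\mu\alpha_n\chi_n&\omega^2\beta_2^{(n)}\end{bmatrix}.$$ Sesquilinear form. With $A:B={\rm tr}(AB^\top)$, $$a(\boldsymbol u,\boldsymbol v)=\mu\int_\Omega\nabla\boldsymbol u:\nabla\overline{\boldsymbol v}\,{\rm d}\boldsymbol x+(\lambda+\mu)\int_\Omega(\nabla\cdot\boldsymbol u)(\nabla\cdot\overline{\boldsymbol v})\,{\rm d}\boldsymbol x-\omega^2\int_\Omega\boldsymbol u\cdot\overline{\boldsymbol v}\,{\rm d}\boldsymbol x-\int_\Gamma\mathscr T\boldsymbol u\cdot\overline{\boldsymbol v}\,{\rm d}s.$$ Well-posedness (standing assumption). The variational problem for $\boldsymbol u$ is uniquely solvable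 with $\|\boldsymbol u\|_{\boldsymbol H^1(\Omega)}\le C\|\boldsymbol u^{\rm inc}\|_{\boldsymbol H^1(\Omega)}$. *)

theory Defs
  imports "HOL-Analysis.Analysis"
begin

section \<open>Sobolev space \<open>H\<^sup>1\<close> of a planar domain\<close>

definition axis_dir :: "2 \<Rightarrow> real \<times> real" where
  "axis_dir j = (if j = 1 then (1, 0) else (0, 1))"

definition pdiff :: "2 \<Rightarrow> (real \<times> real \<Rightarrow> complex) \<Rightarrow> real \<times> real \<Rightarrow> complex" where
  "pdiff j \<phi> z = frechet_derivative \<phi> (at z) (axis_dir j)"

primrec C_k :: "nat \<Rightarrow> (real \<times> real \<Rightarrow> complex) \<Rightarrow> bool" where
  "C_k 0 \<phi> \<longleftrightarrow> continuous_on UNIV \<phi>"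
| "C_k (Suc k) \<phi> \<longleftrightarrow> (\<forall>z. \<phi> differentiable (at z)) \<and> (\<forall>j. C_k k (pdiff j \<phi>))"

definition smooth :: "(real \<times> real \<Rightarrow> complex) \<Rightarrow> bool" where
  "smooth \<phi> \<longleftrightarrow> (\<forall>k. C_k k \<phi>)"

definition test_fun :: "(real \<times> real) set \<Rightarrow> (real \<times> real \<Rightarrow> complex) \<Rightarrow> bool" where
  "test_fun U \<phi> \<longleftrightarrow> smooth \<phi> \<and> compact (closure {z. \<phi> z \<noteq> 0}) \<and> closure {z. \<phi> z \<noteq> 0} \<subseteq> U"

text \<open>Elements of \<open>L\<^sup>2\<close> and \<open>H\<^sup>1\<close> are represented by functions that are Borel measurable on the
  domain; they are nowhere identified, so equality of classes is always written as an almost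
  everywhere statement.\<close>

definition L2 :: "'a::euclidean_space set \<Rightarrow> ('a \<Rightarrow> complex) \<Rightarrow> bool" where
  "L2 U u \<longleftrightarrow> set_borel_measurable lborel U u \<and> set_integrable lborel U (\<lambda>z. (norm (u z))\<^sup>2)"

definition has_weak_deriv ::
    "(real \<times> real) set \<Rightarrow> 2 \<Rightarrow> (real \<times> real \<Rightarrow> complex) \<Rightarrow> (real \<times> real \<Rightarrow> complex) \<Rightarrow> bool" where
  "has_weak_deriv U j u g \<longleftrightarrow>
     (\<forall>\<phi>. test_fun U \<phi> \<longrightarrow>
        (LINT z:U|lborel. u z * pdiff j \<phi> z) = - (LINT z:U|lborel. g z * \<phi> z))"

definition H1 :: "(real \<times> real) set \<Rightarrow> (real \<times> real \<Rightarrow> complex) set" where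
  "H1 U = {u. L2 U u \<and> (\<forall>j. \<exists>g. L2 U g \<and> has_weak_deriv U j u g)}"

definition wderiv :: "(real \<times> real) set \<Rightarrow> 2 \<Rightarrow> (real \<times> real \<Rightarrow> complex) \<Rightarrow> real \<times> real \<Rightarrow> complex" where
  "wderiv U j u = (SOME g. L2 U g \<and> has_weak_deriv U j u g)"

definition H1_norm :: "(real \<times> real) set \<Rightarrow> (real \<times> real \<Rightarrow> complex) \<Rightarrow> real" where
  "H1_norm U u = sqrt ((LINT z:U|lborel. (norm (u z))\<^sup>2)
                     + (\<Sum>j\<in>UNIV. LINT z:U|lborel. (norm (wderiv U j u z))\<^sup>2))"

definition H1_norm_vec :: "(real \<times> real) set \<Rightarrow> (real \<times> real \<Rightarrow> complex^2) \<Rightarrow> real" where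
  "H1_norm_vec U u = sqrt (\<Sum>i\<in>UNIV. (H1_norm U (\<lambda>z. u z $ i))\<^sup>2)"

definition cdot :: "complex^2 \<Rightarrow> complex^2 \<Rightarrow> complex" where
  "cdot u v = (\<Sum>i\<in>UNIV. u $ i * cnj (v $ i))"

definition wgrad :: "(real \<times> real) set \<Rightarrow> (real \<times> real \<Rightarrow> complex^2) \<Rightarrow> real \<times> real \<Rightarrow> complex^2^2" where
  "wgrad U u z = (\<chi> i j. wderiv U j (\<lambda>w. u w $ i) z)"

definition wdiv :: "(real \<times> real) set \<Rightarrow> (real \<times> real \<Rightarrow> complex^2) \<Rightarrow> real \<times> real \<Rightarrow> complex" where
  "wdiv U u z = (\<Sum>i\<in>UNIV. wderiv U i (\<lambda>w. u w $ i) z)"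

definition mat_cnj :: "complex^2^2 \<Rightarrow> complex^2^2" where
  "mat_cnj A = (\<chi> i j. cnj (A $ i $ j))"

definition frob :: "complex^2^2 \<Rightarrow> complex^2^2 \<Rightarrow> complex" where
  "frob A B = trace (A ** transpose B)"


section \<open>Geometry and parameters\<close>

text \<open>In the usual notation the fields are \<open>\<Lambda>\<close>, \<open>f\<close>, \<open>b\<close>, \<open>\<omega>\<close>, \<open>\<lambda>\<close>, \<open>\<mu>\<close>, \<open>\<theta>\<close>.\<close>

record grating =
  period :: real
  profile :: "real \<Rightarrow> real"
  height :: real
  freq :: real
  lame_lambda :: real
  lame_mu :: real
  incidence :: real

definition Omega :: "grating \<Rightarrow> (real \<times> real) set" where
  "Omega p = {(x, y). 0 < x \<and> x < period p \<and> profile p x < y \<and> y < height p}"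

definition kappa1 :: "grating \<Rightarrow> real" where
  "kappa1 p = freq p / sqrt (lame_lambda p + 2 * lame_mu p)"

definition kappa2 :: "grating \<Rightarrow> real" where
  "kappa2 p = freq p / sqrt (lame_mu p)"

definition alpha :: "grating \<Rightarrow> real" where
  "alpha p = kappa1 p * sin (incidence p)"

definition alphan :: "grating \<Rightarrow> int \<Rightarrow> real" where
  "alphan p n = alpha p + 2 * pi * of_int n / period p"

definition vertical_wavenumber :: "real \<Rightarrow> real \<Rightarrow> complex" where
  "vertical_wavenumber \<kappa> a =
     (if \<bar>a\<bar> < \<kappa> then of_real (sqrt (\<kappa>\<^sup>2 - a\<^sup>2)) else \<i> * of_real (sqrt (a\<^sup>2 - \<kappa>\<^sup>2)))"

definition beta1 :: "grating \<Rightarrow> int \<Rightarrow> complex" where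
  "beta1 p n = vertical_wavenumber (kappa1 p) (alphan p n)"

definition beta2 :: "grating \<Rightarrow> int \<Rightarrow> complex" where
  "beta2 p n = vertical_wavenumber (kappa2 p) (alphan p n)"

definition chi :: "grating \<Rightarrow> int \<Rightarrow> complex" where
  "chi p n = of_real ((alphan p n)\<^sup>2) + beta1 p n * beta2 p n"

definition incident_dir :: "grating \<Rightarrow> real \<times> real" where
  "incident_dir p = (sin (incidence p), - cos (incidence p))"

definition u_inc :: "grating \<Rightarrow> real \<times> real \<Rightarrow> complex^2" where
  "u_inc p z = exp (\<i> * of_real (kappa1 p * (z \<bullet> incident_dir p))) *s
     vector [of_real (fst (incident_dir p)), of_real (snd (incident_dir p))]"


section \<open>Traces and quasi-periodic spaces\<close>

text \<open>The four conditions (summands) correspond to the top \<open>\<Gamma>\<close>, the profile \<open>S\<close>, and the left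
  and right sides of the cell. \<open>S\<close> is parametrised by \<open>x\<close>; as the profile is Lipschitz, this
  gives the same space as arc length, with an equivalent norm.\<close>

definition boundary_L2 :: "grating \<Rightarrow> (real \<times> real \<Rightarrow> complex) \<Rightarrow> bool" where
  "boundary_L2 p g \<longleftrightarrow>
     L2 {0<..<period p} (\<lambda>x. g (x, height p)) \<and>
     L2 {0<..<period p} (\<lambda>x. g (x, profile p x)) \<and>
     L2 {profile p 0<..<height p} (\<lambda>y. g (0, y)) \<and>
     L2 {profile p (period p)<..<height p} (\<lambda>y. g (period p, y))"

definition boundary_sqnorm :: "grating \<Rightarrow> (real \<times> real \<Rightarrow> complex) \<Rightarrow> real" where
  "boundary_sqnorm p g =
     (LINT x:{0<..<period p}|lborel. (norm (g (x, height p)))\<^sup>2) +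
     (LINT x:{0<..<period p}|lborel. (norm (g (x, profile p x)))\<^sup>2) +
     (LINT y:{profile p 0<..<height p}|lborel. (norm (g (0, y)))\<^sup>2) +
     (LINT y:{profile p (period p)<..<height p}|lborel. (norm (g (period p, y)))\<^sup>2)"

text \<open>The trace operator is the closure, from \<open>H\<^sup>1(\<Omega>)\<close> to \<open>L\<^sup>2(\<partial>\<Omega>)\<close>, of the restriction of
  functions smooth up to the boundary. Only the values of \<open>g\<close> on \<open>\<partial>\<Omega>\<close> matter.\<close>

definition has_trace :: "grating \<Rightarrow> (real \<times> real \<Rightarrow> complex) \<Rightarrow> (real \<times> real \<Rightarrow> complex) \<Rightarrow> bool" where
  "has_trace p u g \<longleftrightarrow> boundary_L2 p g \<and>
     (\<exists>\<phi> :: nat \<Rightarrow> real \<times> real \<Rightarrow> complex.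
        (\<forall>k. smooth (\<phi> k)) \<and>
        (\<lambda>k. H1_norm (Omega p) (\<lambda>z. \<phi> k z - u z)) \<longlonglongrightarrow> 0 \<and>
        (\<lambda>k. boundary_sqnorm p (\<lambda>z. \<phi> k z - g z)) \<longlonglongrightarrow> 0)"

definition bd_trace :: "grating \<Rightarrow> (real \<times> real \<Rightarrow> complex) \<Rightarrow> real \<times> real \<Rightarrow> complex" where
  "bd_trace p u = (SOME g. has_trace p u g)"

definition H1_qp :: "grating \<Rightarrow> (real \<times> real \<Rightarrow> complex) set" where
  "H1_qp p = {u \<in> H1 (Omega p). \<exists>g. has_trace p u g \<and>
     (AE y in lborel. y \<in> {profile p 0<..<height p} \<longrightarrow>
        g (period p, y) = g (0, y) * exp (\<i> * of_real (alpha p * period p)))}"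

definition eq_on_S :: "grating \<Rightarrow> (real \<times> real \<Rightarrow> complex) \<Rightarrow> (real \<times> real \<Rightarrow> complex) \<Rightarrow> bool" where
  "eq_on_S p u h \<longleftrightarrow> (\<exists>g. has_trace p u g \<and>
     (AE x in lborel. x \<in> {0<..<period p} \<longrightarrow> g (x, profile p x) = h (x, profile p x)))"

definition H1_S_qp :: "grating \<Rightarrow> (real \<times> real \<Rightarrow> complex) set" where
  "H1_S_qp p = {u \<in> H1_qp p. eq_on_S p u (\<lambda>z. 0)}"

definition H1_qp_vec :: "grating \<Rightarrow> (real \<times> real \<Rightarrow> complex^2) set" where
  "H1_qp_vec p = {u. \<forall>i. (\<lambda>z. u z $ i) \<in> H1_qp p}"

definition H1_S_qp_vec :: "grating \<Rightarrow> (real \<times> real \<Rightarrow> complex^2) set" where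
  "H1_S_qp_vec p = {u. \<forall>i. (\<lambda>z. u z $ i) \<in> H1_S_qp p}"


section \<open>Dirichlet-to-Neumann operator and its truncation\<close>

definition fourier_coeff :: "grating \<Rightarrow> (real \<times> real \<Rightarrow> complex) \<Rightarrow> int \<Rightarrow> complex" where
  "fourier_coeff p u n = 1 / of_real (period p) *
     (LINT x:{0<..<period p}|lborel.
        bd_trace p u (x, height p) * exp (- \<i> * of_real (alphan p n * x)))"

definition fourier_coeff_vec :: "grating \<Rightarrow> (real \<times> real \<Rightarrow> complex^2) \<Rightarrow> int \<Rightarrow> complex^2" where
  "fourier_coeff_vec p u n = (\<chi> i. fourier_coeff p (\<lambda>z. u z $ i) n)"

definition dtn_matrix :: "grating \<Rightarrow> int \<Rightarrow> complex^2^2" where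
  "dtn_matrix p n =
     (let c = \<i> / chi p n; w2 = of_real ((freq p)\<^sup>2); a = of_real (alphan p n);
          m = of_real (lame_mu p)
      in vector [vector [c * (w2 * beta1 p n), c * (m * a * chi p n - w2 * a)],
                 vector [c * (w2 * a - m * a * chi p n), c * (w2 * beta2 p n)]])"

definition dtn_mode :: "grating \<Rightarrow> (real \<times> real \<Rightarrow> complex^2) \<Rightarrow> int \<Rightarrow> real \<Rightarrow> complex^2" where
  "dtn_mode p u n x =
     exp (\<i> * of_real (alphan p n * x)) *s (dtn_matrix p n *v fourier_coeff_vec p u n)"

definition dtn_trunc :: "grating \<Rightarrow> nat \<Rightarrow> (real \<times> real \<Rightarrow> complex^2) \<Rightarrow> real \<Rightarrow> complex^2" where
  "dtn_trunc p N u x = (\<Sum>n\<in>{n. \<bar>n\<bar> \<le> int N}. dtn_mode p u n x)"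

definition top_integral :: "grating \<Rightarrow> (real \<Rightarrow> complex^2) \<Rightarrow> (real \<times> real \<Rightarrow> complex^2) \<Rightarrow> complex" where
  "top_integral p w v = (LINT x:{0<..<period p}|lborel.
     cdot (w x) (\<chi> i. bd_trace p (\<lambda>z. v z $ i) (x, height p)))"

text \<open>For \<open>u\<close> in \<open>H\<^sup>1\<close> the series \<open>\<T>u\<close> converges only in \<open>H\<^sup>-\<^sup>1\<^sup>/\<^sup>2(\<Gamma>)\<close>, so the integral of \<open>\<T>u\<close>
  against the conjugate of \<open>v\<close> over \<open>\<Gamma>\<close> is the duality pairing, i.e. the series is paired
  term by term.\<close>

definition dtn_pairing ::
    "grating \<Rightarrow> (real \<times> real \<Rightarrow> complex^2) \<Rightarrow> (real \<times> real \<Rightarrow> complex^2) \<Rightarrow> complex" where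
  "dtn_pairing p u v = (\<Sum>\<^sub>\<infinity>n\<in>UNIV. top_integral p (dtn_mode p u n) v)"


section \<open>Variational problem\<close>

definition sesq_form ::
    "grating \<Rightarrow> (real \<times> real \<Rightarrow> complex^2) \<Rightarrow> (real \<times> real \<Rightarrow> complex^2) \<Rightarrow> complex" where
  "sesq_form p u v =
     of_real (lame_mu p) *
       (LINT z:Omega p|lborel. frob (wgrad (Omega p) u z) (mat_cnj (wgrad (Omega p) v z)))
   + of_real (lame_lambda p + lame_mu p) *
       (LINT z:Omega p|lborel. wdiv (Omega p) u z * cnj (wdiv (Omega p) v z))
   - of_real ((freq p)\<^sup>2) * (LINT z:Omega p|lborel. cdot (u z) (v z))
   - dtn_pairing p u v"

definition is_solution :: "grating \<Rightarrow> (real \<times> real \<Rightarrow> complex^2) \<Rightarrow> bool" where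
  "is_solution p u \<longleftrightarrow> u \<in> H1_qp_vec p \<and>
     (\<forall>i. eq_on_S p (\<lambda>z. u z $ i) (\<lambda>z. - u_inc p z $ i)) \<and>
     (\<forall>v\<in>H1_S_qp_vec p. sesq_form p u v = 0)"

definition well_posed :: "grating \<Rightarrow> bool" where
  "well_posed p \<longleftrightarrow>
     (\<exists>u. is_solution p u) \<and>
     (\<forall>u w. is_solution p u \<longrightarrow> is_solution p w \<longrightarrow>
        (AE z in lborel. z \<in> Omega p \<longrightarrow> u z = w z)) \<and>
     (\<exists>C>0. \<forall>u. is_solution p u \<longrightarrow>
        H1_norm_vec (Omega p) u \<le> C * H1_norm_vec (Omega p) (u_inc p))"

end

theory Submission
  imports Defs
begin

text \<open>
  Below the line \<open>y = b\<close> and above the profile, the Fourier coefficients \<open>U\<^sub>n(y)\<close> of a solution are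
  sums of upward decaying exponentials as soon as both vertical wave numbers are imaginary, so
  \<open>U\<^sub>n(b)\<close> is smaller than the solution near a lower line by the factor \<open>exp (- \<gamma>\<^sub>2 \<cdot> distance)\<close>, up to
  powers of \<open>n\<close>, where \<open>\<gamma>\<^sub>2 = \<bar>\<beta>\<^sub>2\<bar>\<close>. The profile lies strictly below \<open>b'\<close>; hence the lower line can be
  taken strictly below \<open>b'\<close>. The bound then has an additional factor \<open>exp (- \<gamma>\<^sub>2 \<cdot> \<delta>)\<close> with \<open>\<delta> > 0\<close>, which
  absorbs all powers of \<open>n\<close> and makes the sum over the modes converge; for the coefficients of \<open>v\<close> on
  \<open>\<Gamma>\<close> a bound uniform in \<open>n\<close> is then enough (\<open>trace_coeff_bound\<close>).

  The decay is proved by duality and not by solving the differential equation for \<open>U\<^sub>n\<close>. The test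
  field is \<open>\<psi>(y) w(y) exp (i \<alpha>\<^sub>n x)\<close>, where \<open>\<psi>\<close> is a smooth cut-off that vanishes near the profile and
  equals 1 near \<open>\<Gamma>\<close>, and the conjugate of \<open>w\<close> is an explicit combination of \<open>exp (\<gamma>\<^sub>1 (y - b))\<close> and
  \<open>exp (\<gamma>\<^sub>2 (y - b))\<close> for which the differential operator vanishes where \<open>\<psi> = 1\<close>
  (\<open>adjoint_modes_solve\<close>). After all derivatives have been moved to the test field
  (\<open>sesq_form_test_field\<close>), two kinds of terms remain: a boundary term on \<open>\<Gamma>\<close>, and an integral of the
  solution against commutator terms that live where \<open>\<psi>\<close> is not constant. There \<open>w\<close> has the size
  \<open>exp (- \<gamma>\<^sub>2 \<cdot> distance)\<close>. The boundary term is linear in \<open>U\<^sub>n(b)\<close> and in the amplitudes of the two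
  exponentials, and nondegenerate because \<open>\<chi>\<^sub>n\<close> is not 0 (\<open>adjoint_conormal_identity\<close>), so suitable
  amplitudes isolate one component of \<open>U\<^sub>n(b)\<close> (\<open>fourier_coeff_decay\<close>). For a test field with a
  single mode the Dirichlet-to-Neumann series has one nonzero term, so its convergence for the
  solution is a consequence of the argument and not a prerequisite.

  Two facts about Sobolev functions are proved from the definitions. A weak derivative is unique
  almost everywhere (\<open>weak_deriv_unique\<close>), because test functions of product form approximate the
  indicator of every box. And Green's formula holds against weights of product form that vanish
  near the profile (\<open>green_y_trace\<close>, \<open>green_x_quasiperiodic\<close>): it holds on a rectangle for the smooth
  functions that approximate an element of \<open>H\<^sup>1\<close> together with its trace, and passes to the limit.
\<close>

section \<open>Smooth functions of one variable\<close>

text \<open>All test functions below are products \<open>g(x) h(y)\<close>, so smoothness in the plane is reduced to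
  smoothness on the line, where closure under products and reciprocals is an easy induction.\<close>

primrec Ck1 :: "nat \<Rightarrow> (real \<Rightarrow> complex) \<Rightarrow> bool" where
  "Ck1 0 f \<longleftrightarrow> continuous_on UNIV f"
| "Ck1 (Suc k) f \<longleftrightarrow> (\<exists>f'. (\<forall>x. (f has_vector_derivative f' x) (at x)) \<and> Ck1 k f')"

lemma Ck1_SucI:
  assumes "\<And>x. (f has_vector_derivative f' x) (at x)" "Ck1 k f'"
  shows "Ck1 (Suc k) f"
  using assms by auto

lemma Ck1_continuous:
  assumes "Ck1 k f" shows "continuous_on UNIV f"
proof (cases k)
  case (Suc m)
  then obtain f' where "\<And>x. (f has_vector_derivative f' x) (at x)"
    using assms by auto
  then show ?thesis
    by (meson continuous_at_imp_continuous_on has_vector_derivative_continuous)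
qed (use assms in auto)

lemma Ck1_Suc_imp: "Ck1 (Suc k) f \<Longrightarrow> Ck1 k f"
proof (induction k arbitrary: f)
  case 0
  then show ?case using Ck1_continuous[of "Suc 0" f] by simp
next
  case (Suc k)
  then show ?case by (metis Ck1.simps(2))
qed

lemma Ck1_const: "Ck1 k (\<lambda>x. c)"
proof (induction k arbitrary: c)
  case (Suc k)
  show ?case by (rule Ck1_SucI[OF has_vector_derivative_const]) (rule Suc)
qed auto

lemma Ck1_add: "Ck1 k f \<Longrightarrow> Ck1 k g \<Longrightarrow> Ck1 k (\<lambda>x. f x + g x)"
proof (induction k arbitrary: f g)
  case (Suc k)
  then obtain f' g' where *: "\<And>x. (f has_vector_derivative f' x) (at x)" "Ck1 k f'"
      "\<And>x. (g has_vector_derivative g' x) (at x)" "Ck1 k g'" by auto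
  show ?case
    by (rule Ck1_SucI[OF has_vector_derivative_add[OF *(1,3)]]) (use * Suc.IH in auto)
qed (auto intro: continuous_intros)

lemma Ck1_mult: "Ck1 k f \<Longrightarrow> Ck1 k g \<Longrightarrow> Ck1 k (\<lambda>x. f x * g x)"
proof (induction k arbitrary: f g)
  case (Suc k)
  then obtain f' g' where *: "\<And>x. (f has_vector_derivative f' x) (at x)" "Ck1 k f'"
      "\<And>x. (g has_vector_derivative g' x) (at x)" "Ck1 k g'" by auto
  show ?case
    by (rule Ck1_SucI[OF has_vector_derivative_mult[OF *(1,3)]])
       (use * Suc Ck1_Suc_imp Ck1_add in auto)
qed (auto intro: continuous_intros)

lemma Ck1_affine: "Ck1 k f \<Longrightarrow> Ck1 k (\<lambda>x. f (s * x + t))"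
proof (induction k arbitrary: f)
  case 0
  then show ?case
    by (auto intro!: continuous_on_compose2[of UNIV f] continuous_intros)
next
  case (Suc k)
  then obtain f' where *: "\<And>x. (f has_vector_derivative f' x) (at x)" "Ck1 k f'" by auto
  have "((\<lambda>x. f (s * x + t)) has_vector_derivative (of_real s * f' (s * x + t))) (at x)" for x
  proof -
    have "((\<lambda>x. s * x + t) has_vector_derivative s) (at x)"
      by (auto intro!: derivative_eq_intros)
    from vector_diff_chain_at[OF this *(1)] show ?thesis
      by (simp add: o_def scaleR_conv_of_real)
  qed
  then show ?case
    by (rule Ck1_SucI) (use * Suc.IH Ck1_mult Ck1_const in auto)
qed

lemma Ck1_inverse:
  assumes "\<And>x. f x \<noteq> 0"
  shows "Ck1 k f \<Longrightarrow> Ck1 k (\<lambda>x. inverse (f x))"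
proof (induction k)
  case 0
  then show ?case using assms by (auto intro!: continuous_intros)
next
  case (Suc k)
  then obtain f' where *: "\<And>x. (f has_vector_derivative f' x) (at x)" "Ck1 k f'" by auto
  have "((\<lambda>x. inverse (f x)) has_vector_derivative
          (- 1) * f' x * (inverse (f x) * inverse (f x))) (at x)" for x
    using field_vector_diff_chain_at[OF *(1) DERIV_inverse[OF assms]]
    by (simp add: o_def power2_eq_square mult_ac)
  then show ?case
    by (rule Ck1_SucI) (intro Ck1_mult Ck1_const *(2) Suc.IH Ck1_Suc_imp[OF Suc.prems])
qed

lemma exp_linear_deriv: "((\<lambda>x. exp (c * complex_of_real x)) has_vector_derivative c * exp (c * of_real x)) (at x)"
proof -
  have "((\<lambda>x::real. c * of_real x) has_vector_derivative c * of_real 1) (at x)"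
    by (intro has_vector_derivative_mult_right has_vector_derivative_of_real DERIV_ident)
  then have "((\<lambda>x::real. c * of_real x) has_vector_derivative c) (at x)"
    by simp
  from field_vector_diff_chain_at[OF this DERIV_exp] show ?thesis by (simp add: o_def)
qed

lemma Ck1_exp: "Ck1 k (\<lambda>x. exp (c * of_real x))"
proof (induction k)
  case (Suc k)
  show ?case
    by (rule Ck1_SucI[OF exp_linear_deriv]) (intro Ck1_mult Ck1_const Suc.IH)
qed (auto intro!: continuous_intros)

lemma Ck1_cnj: "Ck1 k f \<Longrightarrow> Ck1 k (\<lambda>x. cnj (f x))"
proof (induction k arbitrary: f)
  case 0
  then show ?case by (auto intro: continuous_on_cnj)
next
  case (Suc k)
  then obtain f' where *: "\<And>x. (f has_vector_derivative f' x) (at x)" "Ck1 k f'" by auto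
  show ?case
    by (rule Ck1_SucI[OF has_vector_derivative_cnj[OF *(1)] Suc.IH[OF *(2)]])
qed

lemma Ck1_deriv_obtain:
  assumes "\<And>k. Ck1 k f"
  obtains f' where "\<And>x. (f has_vector_derivative f' x) (at x)" "\<And>k. Ck1 k f'" "continuous_on UNIV f'"
proof -
  obtain f' where f': "\<And>x. (f has_vector_derivative f' x) (at x)" "Ck1 0 f'"
    using assms[of 1] by auto
  have "Ck1 k f'" for k
  proof -
    obtain g where g: "\<And>x. (f has_vector_derivative g x) (at x)" "Ck1 k g"
      using assms[of "Suc k"] by auto
    then have "g = f'" using f'(1) vector_derivative_unique_at by blast
    then show ?thesis using g(2) by simp
  qed
  then show thesis by (rule that[OF f'(1)]) (use f'(2) in simp)
qed

text \<open>At the end point \<open>a\<close> itself the derivative vanishes by continuity.\<close>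

lemma derivative_vanishes_below:
  fixes \<eta> \<eta>' :: "real \<Rightarrow> complex"
  assumes d: "\<And>y. (\<eta> has_vector_derivative \<eta>' y) (at y)" and c: "continuous_on UNIV \<eta>'"
    and 0: "\<And>y. y \<le> a \<Longrightarrow> \<eta> y = 0" and "y \<le> a"
  shows "\<eta>' y = 0"
proof -
  have "\<eta>' t = 0" if "t < a" for t
  proof -
    have "((\<lambda>_. 0) has_vector_derivative \<eta>' t) (at t)"
      by (rule has_vector_derivative_transform_within_open[OF d, of "{..<a}"]) (use that 0 in auto)
    then show ?thesis using vector_derivative_unique_at[OF _ has_vector_derivative_const] by blast
  qed
  then have "closure {..<a} \<subseteq> {t. \<eta>' t = 0}"
    by (intro closure_minimal closed_Collect_eq c continuous_on_const) auto
  then show ?thesis using \<open>y \<le> a\<close> by auto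
qed

text \<open>The family \<open>x\<^sup>-\<^sup>m exp (-c/x)\<close>, extended by 0 to the left, is closed under differentiation up to
  linear combinations. Smoothness at the origin is therefore one limit for all \<open>m\<close>. The parameter
  \<open>c\<close> is kept because \<open>exp (-c/x)\<close> tends to 1 for \<open>c \<rightarrow> 0\<close>, which produces indicator functions.\<close>

definition flat :: "real \<Rightarrow> nat \<Rightarrow> real \<Rightarrow> complex" where
  "flat c m x = (if x > 0 then of_real ((1/x) ^ m * exp (- c / x)) else 0)"

lemma flat_tendsto_0:
  assumes "c > 0" shows "((\<lambda>x. flat c m x) \<longlongrightarrow> 0) (at 0)"
proof -
  have 1: "((\<lambda>t::real. t ^ m * exp (- c * t)) \<longlongrightarrow> 0) at_top"
  proof -
    have "((\<lambda>t::real. (c * t) ^ m / exp (c * t)) \<longlongrightarrow> 0) at_top"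
      by (rule filterlim_compose[OF tendsto_power_div_exp_0[of m]])
        (use assms in \<open>auto intro!: filterlim_tendsto_pos_mult_at_top filterlim_ident\<close>)
    from tendsto_mult[OF tendsto_const[of "1/c^m"] this] show ?thesis
      using assms by (simp add: exp_minus field_simps)
  qed
  have "((\<lambda>x. (1/x) ^ m * exp (- c / x)) \<longlongrightarrow> 0) (at_right (0::real))"
    using filterlim_compose[OF 1 filterlim_inverse_at_top_right] by (simp add: divide_inverse)
  then have "((\<lambda>x. complex_of_real ((1/x) ^ m * exp (- c / x))) \<longlongrightarrow> 0) (at_right (0::real))"
    using tendsto_of_real[where 'a = complex and a = "0::real"] unfolding of_real_0 by blast
  then have R: "((\<lambda>x. flat c m x) \<longlongrightarrow> 0) (at_right 0)"
    by (rule Lim_transform_eventually)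
      (auto simp: eventually_at_right_field flat_def intro: exI[of _ 1])
  have L: "((\<lambda>x. flat c m x) \<longlongrightarrow> 0) (at_left 0)"
    by (rule Lim_transform_eventually[OF tendsto_const])
      (auto simp: eventually_at_left_field flat_def intro: exI[of _ "-1"])
  show ?thesis using filterlim_split_at[OF L R] .
qed

lemma flat_deriv:
  assumes c: "c > 0"
  shows "(flat c m has_vector_derivative
           (of_real (- real m) * flat c (Suc m) x + of_real c * flat c (m + 2) x)) (at x)"
proof (cases x "0::real" rule: linorder_cases)
  case less
  have "((\<lambda>x. 0) has_vector_derivative 0) (at x)" by simp
  then have "(flat c m has_vector_derivative 0) (at x)"
    by (rule has_vector_derivative_transform_within_open[of _ _ _ "{..<0}"])
       (use less in \<open>auto simp: flat_def\<close>)
  then show ?thesis using less by (simp add: flat_def)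
next
  case greater
  have "((\<lambda>x. (1/x) ^ m * exp (- c / x)) has_real_derivative
        (- real m * ((1/x) ^ Suc m * exp (- c / x)) + c * ((1/x) ^ (m+2) * exp (- c / x)))) (at x)"
  proof -
    have 1: "((\<lambda>x. 1/x) has_real_derivative - ((1/x) * (1/x))) (at x)"
      using greater by (auto intro!: derivative_eq_intros simp: power2_eq_square)
    have 2: "((\<lambda>x. exp (- c / x)) has_real_derivative exp (- c / x) * (c * ((1/x) * (1/x)))) (at x)"
      using greater by (auto intro!: derivative_eq_intros simp: power2_eq_square)
    from DERIV_mult[OF DERIV_power[OF 1, of m] 2] show ?thesis
      by (rule DERIV_cong) (cases m; simp add: algebra_simps add_divide_distrib diff_divide_distrib)
  qed
  then have "((\<lambda>x. complex_of_real ((1/x) ^ m * exp (- c / x))) has_vector_derivative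
     complex_of_real (- real m * ((1/x) ^ Suc m * exp (- c / x)) + c * ((1/x) ^ (m+2) * exp (- c / x)))) (at x)"
    by (intro has_vector_derivative_of_real)
  then have "(flat c m has_vector_derivative
     complex_of_real (- real m * ((1/x) ^ Suc m * exp (- c / x)) + c * ((1/x) ^ (m+2) * exp (- c / x)))) (at x)"
    by (rule has_vector_derivative_transform_within_open[of _ _ _ "{0<..}"])
       (use greater in \<open>auto simp: flat_def\<close>)
  then show ?thesis using greater by (simp add: flat_def)
next
  case equal
  have "((\<lambda>h. (flat c m (0 + h) - flat c m 0) /\<^sub>R h) \<longlongrightarrow> 0) (at 0)"
  proof (rule Lim_transform_eventually[OF flat_tendsto_0[OF c, of "Suc m"]])
    show "\<forall>\<^sub>F h in at 0. flat c (Suc m) h = (flat c m (0 + h) - flat c m 0) /\<^sub>R h"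
      by (rule eventually_at_topological[THEN iffD2])
        (auto simp: flat_def scaleR_conv_of_real field_simps intro!: exI[of _ UNIV])
  qed
  from tendsto_norm_zero[OF this] have "(flat c m has_vector_derivative 0) (at 0)"
    by (simp add: has_vector_derivative_def has_derivative_at bounded_linear_zero
          divide_inverse mult.commute)
  then show ?thesis using equal by (simp add: flat_def)
qed

lemma Ck1_flat: "c > 0 \<Longrightarrow> Ck1 k (flat c m)"
proof (induction k arbitrary: m)
  case 0
  then show ?case
    using Ck1_continuous[of "Suc 0"] flat_deriv[OF 0]
    by (meson continuous_at_imp_continuous_on has_vector_derivative_continuous Ck1.simps(1))
next
  case (Suc k)
  show ?case
    by (rule Ck1_SucI[OF flat_deriv[OF Suc.prems]]) (intro Ck1_add Ck1_mult Ck1_const Suc)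
qed

definition bump :: "real \<Rightarrow> real \<Rightarrow> real \<Rightarrow> real \<Rightarrow> complex" where
  "bump c a b x = flat c 0 (x - a) * flat c 0 (b - x)"

lemma Ck1_bump: assumes "c > 0" shows "Ck1 k (bump c a b)"
proof -
  have "Ck1 k (\<lambda>x. flat c 0 (1 * x + (-a)) * flat c 0 ((-1) * x + b))"
    by (intro Ck1_mult Ck1_affine Ck1_flat assms)
  moreover have "(\<lambda>x. flat c 0 (1 * x + (-a)) * flat c 0 ((-1) * x + b)) = bump c a b"
    by (auto simp: bump_def fun_eq_iff)
  ultimately show ?thesis by simp
qed

lemma bump_nonzero_iff: "bump c a b x \<noteq> 0 \<longleftrightarrow> x \<in> {a<..<b}"
  by (auto simp: bump_def flat_def)

lemma norm_bump_le: "c > 0 \<Longrightarrow> norm (bump c a b x) \<le> 1"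
  by (auto simp: bump_def flat_def norm_mult mult_le_one)

lemma bump_tendsto_indicator:
  "(\<lambda>k. bump (1 / real (Suc k)) a b x) \<longlonglongrightarrow> indicator {a<..<b} x"
proof (cases "x \<in> {a<..<b}")
  case True
  have *: "(\<lambda>k. complex_of_real (exp (- (1 / real (Suc k)) / t))) \<longlonglongrightarrow> 1" for t
  proof -
    have "(\<lambda>k. 1 / real (Suc k)) \<longlonglongrightarrow> 0" by (rule LIMSEQ_Suc[OF lim_1_over_n])
    from tendsto_exp[OF tendsto_mult[OF tendsto_minus[OF this] tendsto_const[of "inverse t"]]]
    have "(\<lambda>k. exp (- (1 / real (Suc k)) / t)) \<longlonglongrightarrow> 1" by (simp add: divide_inverse)
    from tendsto_of_real[OF this, where 'a = complex] show ?thesis by simp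
  qed
  from tendsto_mult[OF *[of "x-a"] *[of "b-x"]] True show ?thesis
    by (simp add: bump_def flat_def)
qed (auto simp: bump_def flat_def)

text \<open>The quotient of \<open>exp (-1/(y-a))\<close> by its sum with \<open>exp (-1/(b-y))\<close>, where both functions are 0
  outside their half-lines; for \<open>a < b\<close> the sum never vanishes.\<close>

lemma smooth_cutoff_exists:
  fixes a b :: real assumes "a < b"
  shows "\<exists>\<psi>. (\<forall>k. Ck1 k \<psi>) \<and> (\<forall>y\<le>a. \<psi> y = 0) \<and> (\<forall>y\<ge>b. \<psi> y = 1)"
proof -
  define D where "D = (\<lambda>y. flat 1 0 (1 * y + (-a)) + flat 1 0 ((-1) * y + b))"
  define \<psi> where "\<psi> = (\<lambda>y. flat 1 0 (1 * y + (-a)) * inverse (D y))"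
  have D: "D y \<noteq> 0" for y
  proof -
    have "Re (D y) > 0" using assms by (auto simp: D_def flat_def intro: add_pos_pos)
    then show ?thesis by auto
  qed
  have "Ck1 k \<psi>" for k
  proof -
    have 1: "Ck1 k (\<lambda>y. flat 1 0 (1 * y + (-a)))" "Ck1 k (\<lambda>y. flat 1 0 ((-1) * y + b))"
      by (intro Ck1_affine Ck1_flat; simp)+
    then have "Ck1 k D" unfolding D_def by (rule Ck1_add)
    then show ?thesis unfolding \<psi>_def by (intro Ck1_mult[OF 1(1)] Ck1_inverse D)
  qed
  moreover have "\<psi> y = 0" if "y \<le> a" for y using that by (simp add: \<psi>_def flat_def)
  moreover have "\<psi> y = 1" if "y \<ge> b" for y
    using that assms D[of y] by (simp add: \<psi>_def D_def flat_def)
  ultimately show ?thesis by blast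
qed

section \<open>Functions of two variables\<close>

abbreviation tensor :: "(real \<Rightarrow> complex) \<Rightarrow> (real \<Rightarrow> complex) \<Rightarrow> real \<times> real \<Rightarrow> complex" where
  "tensor h \<eta> \<equiv> (\<lambda>z. h (fst z) * \<eta> (snd z))"

lemma axis_dir_simps [simp]: "axis_dir 1 = (1, 0)" "axis_dir 2 = (0, 1)"
  by (auto simp: axis_dir_def)

lemma pdiff_eqI:
  assumes "(\<phi> has_derivative D) (at z)"
  shows "pdiff j \<phi> z = D (axis_dir j)"
  using frechet_derivative_at[OF assms] by (simp add: pdiff_def)

lemma tensor_has_derivative:
  assumes "(g has_vector_derivative g') (at (fst z))" "(h has_vector_derivative h') (at (snd z))"
  shows "((\<lambda>z::real\<times>real. g (fst z) * h (snd z) :: complex) has_derivative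
           (\<lambda>d. fst d *\<^sub>R (g' * h (snd z)) + snd d *\<^sub>R (g (fst z) * h'))) (at z)"
proof -
  have 1: "((\<lambda>z. g (fst z)) has_derivative (\<lambda>d. fst d *\<^sub>R g')) (at z)"
    using has_derivative_compose[OF has_derivative_fst[OF has_derivative_ident]] assms(1)
    unfolding has_vector_derivative_def by fastforce
  have 2: "((\<lambda>z. h (snd z)) has_derivative (\<lambda>d. snd d *\<^sub>R h')) (at z)"
    using has_derivative_compose[OF has_derivative_snd[OF has_derivative_ident]] assms(2)
    unfolding has_vector_derivative_def by fastforce
  show ?thesis
    by (rule has_derivative_eq_rhs[OF has_derivative_mult[OF 1 2]]) (simp add: fun_eq_iff algebra_simps)
qed

lemma pdiff_tensor:
  assumes "\<And>x. (g has_vector_derivative g' x) (at x)" "\<And>x. (h has_vector_derivative h' x) (at x)"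
  shows "pdiff 1 (\<lambda>z. g (fst z) * h (snd z)) = (\<lambda>z. g' (fst z) * h (snd z))"
    and "pdiff 2 (\<lambda>z. g (fst z) * h (snd z)) = (\<lambda>z. g (fst z) * h' (snd z))"
  using pdiff_eqI[OF tensor_has_derivative[OF assms(1) assms(2)]] by (simp_all add: fun_eq_iff)

lemma C_k_tensor:
  "Ck1 k g \<Longrightarrow> Ck1 k h \<Longrightarrow> C_k k (\<lambda>z. g (fst z) * h (snd z))"
proof (induction k arbitrary: g h)
  case 0
  then show ?case
    by (auto intro!: continuous_on_mult continuous_on_compose2[of UNIV g] continuous_on_compose2[of UNIV h] continuous_intros)
next
  case (Suc k)
  then obtain g' h' where *: "\<And>x. (g has_vector_derivative g' x) (at x)" "Ck1 k g'"
      "\<And>x. (h has_vector_derivative h' x) (at x)" "Ck1 k h'" by auto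
  have "(\<lambda>z. g (fst z) * h (snd z)) differentiable at z" for z
    using tensor_has_derivative[OF *(1,3)] unfolding differentiable_def by blast
  moreover have "C_k k (pdiff j (\<lambda>z. g (fst z) * h (snd z)))" for j
    using exhaust_2[of j] Suc.IH[OF *(2) Ck1_Suc_imp[OF Suc.prems(2)]]
      Suc.IH[OF Ck1_Suc_imp[OF Suc.prems(1)] *(4)] pdiff_tensor[OF *(1,3)] by metis
  ultimately show ?case by simp
qed

lemma smooth_tensor:
  assumes "\<And>k. Ck1 k g" "\<And>k. Ck1 k h"
  shows "smooth (\<lambda>z. g (fst z) * h (snd z))"
  using assms C_k_tensor by (auto simp: smooth_def)

abbreviation C1 :: "(real \<times> real \<Rightarrow> complex) \<Rightarrow> bool" where
  "C1 \<equiv> C_k (Suc 0)"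

lemma smooth_imp_C1: "smooth \<phi> \<Longrightarrow> C1 \<phi>" unfolding smooth_def by blast

lemma C1_has_derivative: "C1 \<phi> \<Longrightarrow> (\<phi> has_derivative frechet_derivative \<phi> (at z)) (at z)"
  by (metis C_k.simps(2) frechet_derivative_works)

lemma C1_continuous: "C1 \<phi> \<Longrightarrow> continuous_on UNIV \<phi>"
  by (simp add: differentiable_imp_continuous_within continuous_at_imp_continuous_on)

lemma C1_continuous_pdiff: "C1 \<phi> \<Longrightarrow> continuous_on UNIV (pdiff j \<phi>)" by simp

lemma pdiff_mult:
  assumes "C1 f" "C1 g"
  shows "pdiff j (\<lambda>z. f z * g z) z = pdiff j f z * g z + f z * pdiff j g z"
  using pdiff_eqI[OF has_derivative_mult[OF C1_has_derivative[OF assms(1)] C1_has_derivative[OF assms(2)]]]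
  by (simp add: pdiff_def)

lemma C1_mult:
  assumes "C1 f" "C1 g" shows "C1 (\<lambda>z. f z * g z)"
proof -
  have "pdiff j (\<lambda>z. f z * g z) = (\<lambda>z. pdiff j f z * g z + f z * pdiff j g z)" for j
    using pdiff_mult[OF assms] by auto
  moreover have "continuous_on UNIV (\<lambda>z. pdiff j f z * g z + f z * pdiff j g z)" for j
    using C1_continuous[OF assms(1)] C1_continuous[OF assms(2)]
      C1_continuous_pdiff[OF assms(1)] C1_continuous_pdiff[OF assms(2)]
    by (intro continuous_intros)
  ultimately show ?thesis using assms by (auto intro!: differentiable_mult)
qed

lemma C1_vector_derivative_fst:
  assumes "C1 F" shows "((\<lambda>x. F (x, y)) has_vector_derivative pdiff 1 F (x, y)) (at x)"
proof -
  have "((\<lambda>x. (x, y)) has_derivative (\<lambda>t. (t, 0))) (at x)"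
    by (auto intro!: derivative_eq_intros)
  from has_derivative_compose[OF this C1_has_derivative[OF assms]]
  have "((\<lambda>x. F (x, y)) has_derivative (\<lambda>t. frechet_derivative F (at (x,y)) (t, 0))) (at x)" .
  moreover have "frechet_derivative F (at (x,y)) (t, 0) = t *\<^sub>R pdiff 1 F (x,y)" for t
    using linear_scale[OF has_derivative_linear[OF C1_has_derivative[OF assms]], of "(x,y)" t "(1,0)"]
    by (simp add: pdiff_def)
  ultimately show ?thesis by (simp add: has_vector_derivative_def)
qed

lemma C1_vector_derivative_snd:
  assumes "C1 F" shows "((\<lambda>y. F (x, y)) has_vector_derivative pdiff 2 F (x, y)) (at y)"
proof -
  have "((\<lambda>y. (x, y)) has_derivative (\<lambda>t. (0, t))) (at y)"
    by (auto intro!: derivative_eq_intros)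
  from has_derivative_compose[OF this C1_has_derivative[OF assms]]
  have "((\<lambda>y. F (x, y)) has_derivative (\<lambda>t. frechet_derivative F (at (x,y)) (0, t))) (at y)" .
  moreover have "frechet_derivative F (at (x,y)) (0, t) = t *\<^sub>R pdiff 2 F (x,y)" for t
    using linear_scale[OF has_derivative_linear[OF C1_has_derivative[OF assms]], of "(x,y)" t "(0,1)"]
    by (simp add: pdiff_def)
  ultimately show ?thesis by (simp add: has_vector_derivative_def)
qed

lemma integral_rect_pdiff2:
  assumes F: "C1 F" and "c \<le> d"
  shows "integral (cbox (a, c) (b, d)) (pdiff 2 F) = integral {a..b} (\<lambda>x. F (x, d) - F (x, c))"
proof -
  have "integral (cbox (a, c) (b, d)) (pdiff 2 F)
      = integral (cbox a b) (\<lambda>x. integral (cbox c d) (\<lambda>y. pdiff 2 F (x, y)))"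
    by (rule integral_prod_continuous) (use C1_continuous_pdiff[OF F] continuous_on_subset in blast)
  also have "(\<lambda>x. integral (cbox c d) (\<lambda>y. pdiff 2 F (x, y))) = (\<lambda>x. F (x, d) - F (x, c))"
  proof
    fix x
    show "integral (cbox c d) (\<lambda>y. pdiff 2 F (x, y)) = F (x, d) - F (x, c)"
      using fundamental_theorem_of_calculus[OF \<open>c \<le> d\<close>, of "\<lambda>y. F (x, y)" "\<lambda>y. pdiff 2 F (x, y)"]
        C1_vector_derivative_snd[OF F, of x]
      by (metis cbox_interval has_vector_derivative_at_within integral_unique)
  qed
  finally show ?thesis by simp
qed

lemma integral_rect_pdiff1:
  assumes F: "C1 F" and "a \<le> b"
  shows "integral (cbox (a, c) (b, d)) (pdiff 1 F) = integral {c..d} (\<lambda>y. F (b, y) - F (a, y))"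
proof -
  have cont: "continuous_on (cbox (a, c) (b, d)) (pdiff 1 F)"
    using C1_continuous_pdiff[OF F] continuous_on_subset by blast
  have "integral (cbox (a, c) (b, d)) (pdiff 1 F)
      = integral (cbox a b) (\<lambda>x. integral (cbox c d) (\<lambda>y. pdiff 1 F (x, y)))"
    by (rule integral_prod_continuous) (rule cont)
  also have "\<dots> = integral (cbox c d) (\<lambda>y. integral (cbox a b) (\<lambda>x. pdiff 1 F (x, y)))"
    using integral_swap_continuous[of a c b d "\<lambda>x y. pdiff 1 F (x, y)"] cont by simp
  also have "(\<lambda>y. integral (cbox a b) (\<lambda>x. pdiff 1 F (x, y))) = (\<lambda>y. F (b, y) - F (a, y))"
  proof
    fix y
    show "integral (cbox a b) (\<lambda>x. pdiff 1 F (x, y)) = F (b, y) - F (a, y)"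
      using fundamental_theorem_of_calculus[OF \<open>a \<le> b\<close>, of "\<lambda>x. F (x, y)" "\<lambda>x. pdiff 1 F (x, y)"]
        C1_vector_derivative_fst[OF F, of y]
      by (metis cbox_interval has_vector_derivative_at_within integral_unique)
  qed
  finally show ?thesis by simp
qed

declare C_k.simps(2) [simp del]

section \<open>Square-integrable functions on bounded sets\<close>

lemma bounded_set_integrable_const:
  assumes "bounded U" "U \<in> sets borel"
  shows "set_integrable lborel U (\<lambda>_::'a::euclidean_space. c::'b::{banach,second_countable_topology})"
  unfolding set_integrable_def
  using assms emeasure_bounded_finite[OF assms(1)]
  by (intro integrable_scaleR_left impI integrable_real_indicator) (auto simp: infinity_ennreal_def)

lemma L2_add:
  assumes "L2 U u" "L2 U v"
  shows "L2 U (\<lambda>z. u z + v z)"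
proof -
  have m: "set_borel_measurable lborel U (\<lambda>z. u z + v z)"
    using assms borel_measurable_add unfolding L2_def set_borel_measurable_def scaleR_add_right
    by blast
  have "set_integrable lborel U (\<lambda>z. 2 * (norm (u z))\<^sup>2 + 2 * (norm (v z))\<^sup>2)"
    using assms by (auto simp: L2_def)
  moreover have "set_borel_measurable lborel U (\<lambda>z. (norm (u z + v z))\<^sup>2)"
  proof -
    have "(\<lambda>z. (norm (indicator U z *\<^sub>R (u z + v z)))\<^sup>2) \<in> borel_measurable lborel"
      using m unfolding set_borel_measurable_def by measurable
    also have "(\<lambda>z. (norm (indicator U z *\<^sub>R (u z + v z)))\<^sup>2)
        = (\<lambda>z. indicator U z *\<^sub>R (norm (u z + v z))\<^sup>2)"
      by (auto simp: fun_eq_iff indicator_def)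
    finally show ?thesis unfolding set_borel_measurable_def .
  qed
  moreover have "(norm (u z + v z))\<^sup>2 \<le> 2 * (norm (u z))\<^sup>2 + 2 * (norm (v z))\<^sup>2" for z
  proof -
    have "(norm (u z + v z))\<^sup>2 \<le> (norm (u z) + norm (v z))\<^sup>2"
      by (simp add: norm_triangle_ineq power_mono)
    also have "\<dots> \<le> 2 * (norm (u z))\<^sup>2 + 2 * (norm (v z))\<^sup>2"
      using sum_squares_bound[of "norm (u z)" "norm (v z)"] by (simp add: power2_sum)
    finally show ?thesis .
  qed
  then have "AE z in lborel. z \<in> U \<longrightarrow> norm ((norm (u z + v z))\<^sup>2)
      \<le> norm (2 * (norm (u z))\<^sup>2 + 2 * (norm (v z))\<^sup>2)"
    by simp
  ultimately have "set_integrable lborel U (\<lambda>z. (norm (u z + v z))\<^sup>2)"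
    by (rule set_integrable_bound)
  with m show ?thesis by (simp add: L2_def)
qed

lemma L2_cmult:
  assumes "L2 U u" shows "L2 U (\<lambda>z. c * u z)"
proof -
  have "(\<lambda>z. c * (indicator U z *\<^sub>R u z)) \<in> borel_measurable lborel"
    using assms borel_measurable_times[OF borel_measurable_const]
    unfolding L2_def set_borel_measurable_def by blast
  then show ?thesis using assms
    unfolding L2_def set_borel_measurable_def
    by (auto simp: norm_mult power_mult_distrib)
qed

lemma L2_diff: "L2 U u \<Longrightarrow> L2 U v \<Longrightarrow> L2 U (\<lambda>z. u z - v z)"
  using L2_add[OF _ L2_cmult[of U v "-1"], of u] by simp

lemma L2_set_integrable:
  fixes U :: "'a::euclidean_space set"
  assumes "L2 U u" "bounded U" "U \<in> sets borel"
  shows "set_integrable lborel U u"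
proof (rule set_integrable_bound)
  show "set_integrable lborel U (\<lambda>z. 1 + (norm (u z))\<^sup>2)"
    using assms(1) by (intro set_integral_add(1) bounded_set_integrable_const[OF assms(2,3)]) (simp add: L2_def)
  show "set_borel_measurable lborel U u" using assms by (simp add: L2_def)
  have "norm (u z) \<le> 1 + (norm (u z))\<^sup>2" for z
  proof -
    have "2 * norm (u z) \<le> (norm (u z))\<^sup>2 + 1"
      using sum_squares_bound[of "norm (u z)" 1] by simp
    then show ?thesis using norm_ge_zero[of "u z"] by linarith
  qed
  then show "AE z in lborel. z \<in> U \<longrightarrow> norm (u z) \<le> norm (1 + (norm (u z))\<^sup>2)" by auto
qed

lemma L2_continuous:
  fixes U :: "'a::euclidean_space set"
  assumes "continuous_on UNIV \<phi>" "bounded U" "U \<in> sets borel"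
  shows "L2 U \<phi>"
proof -
  have m: "set_borel_measurable lborel U \<phi>"
    unfolding set_borel_measurable_def using assms borel_measurable_continuous_onI[OF assms(1)]
    by (intro borel_measurable_scaleR borel_measurable_indicator) auto
  have "compact (\<phi> ` closure U)"
    using assms by (intro compact_continuous_image continuous_on_subset[OF assms(1)]) auto
  then obtain B where B: "\<And>z. z \<in> U \<Longrightarrow> norm (\<phi> z) \<le> B"
    using closure_subset by (metis compact_imp_bounded bounded_iff image_eqI subsetD)
  have "set_integrable lborel U (\<lambda>z. (norm (\<phi> z))\<^sup>2)"
  proof (rule set_integrable_bound[OF bounded_set_integrable_const[OF assms(2,3), of "B\<^sup>2"]])
    show "set_borel_measurable lborel U (\<lambda>z. (norm (\<phi> z))\<^sup>2)"
      unfolding set_borel_measurable_def using assms borel_measurable_continuous_onI[OF assms(1)]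
      by (intro borel_measurable_scaleR borel_measurable_indicator borel_measurable_power borel_measurable_norm) auto
    show "AE z in lborel. z \<in> U \<longrightarrow> norm ((norm (\<phi> z))\<^sup>2) \<le> norm (B\<^sup>2)"
      using B by (auto intro!: power_mono)
  qed
  with m show ?thesis by (simp add: L2_def)
qed

lemma set_integrable_mult_bounded:
  fixes w :: "'a::euclidean_space \<Rightarrow> complex"
  assumes "set_integrable lborel U u" "continuous_on UNIV w" "\<And>z. z \<in> U \<Longrightarrow> norm (w z) \<le> B"
  shows "set_integrable lborel U (\<lambda>z. u z * w z)"
proof (rule set_integrable_bound)
  show "set_integrable lborel U (\<lambda>z. of_real B * u z)" using assms(1) by auto
  have "(\<lambda>z. (indicator U z *\<^sub>R u z) * w z) \<in> borel_measurable lborel"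
    using assms borel_measurable_continuous_onI[OF assms(2)]
    by (intro borel_measurable_times) (auto simp: set_integrable_def)
  then show "set_borel_measurable lborel U (\<lambda>z. u z * w z)"
    by (simp add: set_borel_measurable_def)
  have "norm (u z * w z) \<le> norm (of_real B * u z)" if "z \<in> U" for z
  proof -
    have "norm (w z) \<le> \<bar>B\<bar>" using assms(3)[OF that] by linarith
    then show ?thesis
      using mult_left_mono[OF _ norm_ge_zero[of "u z"], of "norm (w z)" "\<bar>B\<bar>"]
      by (simp add: norm_mult mult.commute)
  qed
  then show "AE z in lborel. z \<in> U \<longrightarrow> norm (u z * w z) \<le> norm (of_real B * u z)" by auto
qed

lemma continuous_bounded_on:
  fixes w :: "'a::euclidean_space \<Rightarrow> complex"
  assumes "continuous_on UNIV w" "bounded U"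
  obtains B where "B > 0" "\<And>z. z \<in> U \<Longrightarrow> norm (w z) \<le> B"
proof -
  have "compact (w ` closure U)"
    using assms by (intro compact_continuous_image continuous_on_subset[OF assms(1)]) auto
  then obtain B where "B > 0" "\<And>z. z \<in> closure U \<Longrightarrow> norm (w z) \<le> B"
    by (metis compact_imp_bounded bounded_pos image_eqI)
  with that closure_subset show thesis by (meson subsetD)
qed

lemma L2_mult_integrable:
  fixes U :: "'a::euclidean_space set"
  assumes "L2 U u" "bounded U" "U \<in> sets borel" "continuous_on UNIV w"
  shows "set_integrable lborel U (\<lambda>z. u z * w z)"
  by (rule continuous_bounded_on[OF assms(4,2)])
    (rule set_integrable_mult_bounded[OF L2_set_integrable[OF assms(1-3)] assms(4)])

definition L2_norm :: "'a::euclidean_space set \<Rightarrow> ('a \<Rightarrow> complex) \<Rightarrow> real" where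
  "L2_norm U u = sqrt (LINT z:U|lborel. (norm (u z))\<^sup>2)"

lemma set_integral_nonneg_norm: "0 \<le> (LINT z:U|lborel. (norm (u z))\<^sup>2)"
  unfolding set_lebesgue_integral_def by (rule Bochner_Integration.integral_nonneg) auto

lemma L2_norm_nonneg: "0 \<le> L2_norm U u"
  using set_integral_nonneg_norm by (simp add: L2_norm_def)

text \<open>The integral of \<open>(\<bar>u\<bar> - s)\<^sup>2\<close> is a nonnegative quadratic polynomial in \<open>s\<close>; its value at the mean of
  \<open>\<bar>u\<bar>\<close> is the Cauchy-Schwarz inequality.\<close>

lemma integral_norm_le_L2_norm:
  fixes U :: "'a::euclidean_space set"
  assumes "L2 U u" "bounded U" "U \<in> sets borel"
  shows "(LINT z:U|lborel. norm (u z)) \<le> sqrt (measure lborel U) * L2_norm U u"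
proof -
  define I where "I = (LINT z:U|lborel. norm (u z))"
  define J where "J = (LINT z:U|lborel. (norm (u z))\<^sup>2)"
  define m where "m = measure lborel U"
  have i: "set_integrable lborel U (\<lambda>z. norm (u z))"
    using L2_set_integrable[OF assms] by (rule set_integrable_norm)
  have j: "set_integrable lborel U (\<lambda>z. (norm (u z))\<^sup>2)" using assms by (simp add: L2_def)
  have c: "set_integrable lborel U (\<lambda>z. r)" for r :: real
    by (rule bounded_set_integrable_const[OF assms(2,3)])
  have I0: "0 \<le> I" unfolding I_def set_lebesgue_integral_def by (rule Bochner_Integration.integral_nonneg) auto
  have J0: "0 \<le> J" unfolding J_def by (rule set_integral_nonneg_norm)
  have m0: "0 \<le> m" by (simp add: m_def)
  have *: "0 \<le> J - 2 * s * I + s\<^sup>2 * m" for s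
  proof -
    have eq: "(norm (u z))\<^sup>2 - 2 * s * norm (u z) + s\<^sup>2 = (norm (u z) - s)\<^sup>2" for z
      by (simp add: power2_diff)
    have "0 \<le> (LINT z:U|lborel. (norm (u z))\<^sup>2 - 2 * s * norm (u z) + s\<^sup>2)"
      unfolding set_lebesgue_integral_def eq by (rule Bochner_Integration.integral_nonneg) auto
    also have "\<dots> = (LINT z:U|lborel. (norm (u z))\<^sup>2 - 2 * s * norm (u z)) + (LINT z:U|lborel. s\<^sup>2)"
      by (intro set_integral_add(2) set_integral_diff(1) set_integrable_mult_right i j c)
    also have "(LINT z:U|lborel. (norm (u z))\<^sup>2 - 2 * s * norm (u z)) = J - (LINT z:U|lborel. 2 * s * norm (u z))"
      unfolding J_def by (intro set_integral_diff(2) set_integrable_mult_right i j)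
    also have "(LINT z:U|lborel. 2 * s * norm (u z)) = 2 * s * I"
      unfolding I_def by (rule set_integral_mult_right)
    also have "(LINT z:U|lborel. s\<^sup>2) = s\<^sup>2 * m"
      by (simp add: set_lebesgue_integral_def m_def)
    finally show ?thesis .
  qed
  have "I\<^sup>2 \<le> m * J"
  proof (cases "m = 0")
    case True
    \<comment> \<open>The polynomial is now linear in \<open>s\<close>; a large \<open>s\<close> would make it negative.\<close>
    have "I = 0"
    proof (rule ccontr)
      assume "I \<noteq> 0"
      then have "2 * ((J + 1) / I) * I = 2 * (J + 1)" by simp
      then show False using *[of "(J + 1) / I"] True J0 by simp
    qed
    then show ?thesis using True by simp
  next
    case False
    then have "m > 0" using m0 by simp
    with *[of "I / m"] show ?thesis by (simp add: field_simps power2_eq_square)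
  qed
  then have "I \<le> sqrt (m * J)" using real_le_rsqrt by blast
  then show ?thesis by (simp add: I_def J_def m_def L2_norm_def real_sqrt_mult)
qed

lemma norm_L2_pairing_le:
  fixes U :: "'a::euclidean_space set"
  assumes "L2 U u" "bounded U" "U \<in> sets borel" "continuous_on UNIV w"
    and "\<And>z. z \<in> U \<Longrightarrow> norm (w z) \<le> B" "0 \<le> B"
  shows "norm (LINT z:U|lborel. u z * w z) \<le> B * (sqrt (measure lborel U) * L2_norm U u)"
proof -
  have "norm (LINT z:U|lborel. u z * w z) \<le> (LINT z:U|lborel. norm (u z * w z))"
    by (rule set_integral_norm_bound[OF L2_mult_integrable[OF assms(1-4)]])
  also have "\<dots> \<le> (LINT z:U|lborel. B * norm (u z))"
  proof (rule set_integral_mono)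
    show "set_integrable lborel U (\<lambda>z. norm (u z * w z))"
      by (rule set_integrable_norm[OF L2_mult_integrable[OF assms(1-4)]])
    show "set_integrable lborel U (\<lambda>z. B * norm (u z))"
      by (rule set_integrable_mult_right) (rule set_integrable_norm[OF L2_set_integrable[OF assms(1-3)]])
    show "norm (u z * w z) \<le> B * norm (u z)" if "z \<in> U" for z
      using mult_left_mono[OF assms(5)[OF that] norm_ge_zero[of "u z"]]
      by (simp add: norm_mult mult.commute)
  qed
  also have "\<dots> = B * (LINT z:U|lborel. norm (u z))" by simp
  also have "\<dots> \<le> B * (sqrt (measure lborel U) * L2_norm U u)"
    by (rule mult_left_mono[OF integral_norm_le_L2_norm[OF assms(1-3)] assms(6)])
  finally show ?thesis .
qed

lemma L2_pairing_tendsto: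
  fixes U :: "'a::euclidean_space set"
  assumes "\<And>k. L2 U (u k)" "L2 U v" "bounded U" "U \<in> sets borel" "continuous_on UNIV w"
    and "(\<lambda>k. L2_norm U (\<lambda>z. u k z - v z)) \<longlonglongrightarrow> 0"
  shows "(\<lambda>k. LINT z:U|lborel. u k z * w z) \<longlonglongrightarrow> (LINT z:U|lborel. v z * w z)"
proof -
  obtain B where B: "B > 0" "\<And>z. z \<in> U \<Longrightarrow> norm (w z) \<le> B"
    using continuous_bounded_on[OF assms(5,3)] by blast
  have "(\<lambda>k. (LINT z:U|lborel. u k z * w z) - (LINT z:U|lborel. v z * w z)) \<longlonglongrightarrow> 0"
  proof (rule Lim_null_comparison)
    show "(\<lambda>k. B * (sqrt (measure lborel U) * L2_norm U (\<lambda>z. u k z - v z))) \<longlonglongrightarrow> 0"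
      using tendsto_mult_right_zero[OF tendsto_mult_right_zero[OF assms(6)]] .
    have "norm ((LINT z:U|lborel. u k z * w z) - (LINT z:U|lborel. v z * w z))
        \<le> B * (sqrt (measure lborel U) * L2_norm U (\<lambda>z. u k z - v z))" for k
    proof -
      have "(LINT z:U|lborel. u k z * w z) - (LINT z:U|lborel. v z * w z)
          = (LINT z:U|lborel. (u k z - v z) * w z)"
        using set_integral_diff(2)[OF L2_mult_integrable[OF assms(1,3,4,5)] L2_mult_integrable[OF assms(2-5)]]
        by (simp add: left_diff_distrib)
      also have "norm \<dots> \<le> B * (sqrt (measure lborel U) * L2_norm U (\<lambda>z. u k z - v z))"
        using B by (intro norm_L2_pairing_le L2_diff assms) auto
      finally show ?thesis .
    qed
    then show "\<forall>\<^sub>F k in sequentially. norm ((LINT z:U|lborel. u k z * w z) - (LINT z:U|lborel. v z * w z))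
        \<le> B * (sqrt (measure lborel U) * L2_norm U (\<lambda>z. u k z - v z))" by simp
  qed
  then show ?thesis by (simp add: LIM_zero_iff)
qed

section \<open>Uniqueness of weak derivatives\<close>

lemma mem_box_Pair: "(x, y) \<in> box (a, c) (b, d) \<longleftrightarrow> x \<in> box a b \<and> y \<in> box c d"
  by (force simp: box_def Basis_prod_def)

lemma test_fun_bump:
  assumes "c > 0" "cbox (a1, a2) (b1, b2) \<subseteq> U"
  shows "test_fun U (\<lambda>z. bump c a1 b1 (fst z) * bump c a2 b2 (snd z))"
proof -
  have "{z. bump c a1 b1 (fst z) * bump c a2 b2 (snd z) \<noteq> 0} \<subseteq> cbox (a1, a2) (b1, b2)"
    by (auto simp: bump_nonzero_iff)
  then have sub: "closure {z. bump c a1 b1 (fst z) * bump c a2 b2 (snd z) \<noteq> 0} \<subseteq> cbox (a1, a2) (b1, b2)"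
    by (rule closure_minimal) (rule closed_cbox)
  moreover have "compact (closure {z. bump c a1 b1 (fst z) * bump c a2 b2 (snd z) \<noteq> 0})"
    using sub by (meson bounded_cbox bounded_subset closed_closure compact_eq_bounded_closed)
  ultimately show ?thesis
    using assms(2) smooth_tensor[OF Ck1_bump[OF assms(1)] Ck1_bump[OF assms(1)]]
    unfolding test_fun_def by blast
qed

text \<open>The functions \<open>exp (-c/(x-a)) exp (-c/(b-x))\<close> are bounded by 1 and converge to the indicator of
  \<open>(a,b)\<close> as \<open>c\<close> tends to 0, so dominated convergence applies to their products.\<close>

lemma test_orthogonal_box_integral_0:
  assumes U: "bounded U" "U \<in> sets borel" and g: "L2 U g"
    and orth: "\<And>\<phi>. test_fun U \<phi> \<Longrightarrow> (LINT z:U|lborel. g z * \<phi> z) = 0"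
    and box: "cbox (a1, a2) (b1, b2) \<subseteq> U"
  shows "(LINT z:box (a1, a2) (b1, b2)|lborel. g z) = 0"
proof -
  define \<phi> where "\<phi> = (\<lambda>k z. bump (1 / real (Suc k)) a1 b1 (fst z) * bump (1 / real (Suc k)) a2 b2 (snd z))"
  have tf: "test_fun U (\<phi> k)" for k
    unfolding \<phi>_def by (rule test_fun_bump[OF _ box]) simp
  have cont: "continuous_on UNIV (\<phi> k)" for k
    using tf[of k] smooth_imp_C1 C1_continuous unfolding test_fun_def by blast
  have int: "integrable lborel (\<lambda>z. indicator U z *\<^sub>R g z)"
    using L2_set_integrable[OF g U] by (simp add: set_integrable_def)
  have le: "norm (\<phi> k z) \<le> 1" for k z
    unfolding \<phi>_def norm_mult by (intro mult_le_one norm_bump_le) auto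
  have sub: "box (a1, a2) (b1, b2) \<subseteq> U" using box box_subset_cbox by blast
  have ind: "indicator U z *\<^sub>R (g z * indicator (box (a1, a2) (b1, b2)) z)
      = indicator (box (a1, a2) (b1, b2)) z *\<^sub>R g z" for z
    using sub by (auto simp: indicator_def)
  have "(\<lambda>k. LINT z|lborel. indicator U z *\<^sub>R (g z * \<phi> k z))
      \<longlonglongrightarrow> (LINT z|lborel. indicator U z *\<^sub>R (g z * indicator (box (a1, a2) (b1, b2)) z))"
  proof (rule integral_dominated_convergence)
    show "integrable lborel (\<lambda>z. norm (indicator U z *\<^sub>R g z))" using int by (rule integrable_norm)
    show "AE z in lborel. norm (indicator U z *\<^sub>R (g z * \<phi> k z)) \<le> norm (indicator U z *\<^sub>R g z)" for k
    proof (rule AE_I2)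
      fix z
      have "norm (indicator U z *\<^sub>R g z) * norm (\<phi> k z) \<le> norm (indicator U z *\<^sub>R g z)"
        using mult_left_mono[OF le[of k z] norm_ge_zero[of "indicator U z *\<^sub>R g z"]] by simp
      then show "norm (indicator U z *\<^sub>R (g z * \<phi> k z)) \<le> norm (indicator U z *\<^sub>R g z)"
        by (simp add: norm_mult)
    qed
    show "(\<lambda>z. indicator U z *\<^sub>R (g z * \<phi> k z)) \<in> borel_measurable lborel" for k
    proof -
      have "\<phi> k \<in> borel_measurable lborel"
        using borel_measurable_continuous_onI[OF cont[of k]] by simp
      from borel_measurable_times[OF borel_measurable_integrable[OF int] this] show ?thesis by simp
    qed
    show "(\<lambda>z. indicator U z *\<^sub>R (g z * indicator (box (a1, a2) (b1, b2)) z)) \<in> borel_measurable lborel"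
    proof -
      have eq: "indicator (box (a1, a2) (b1, b2)) z *\<^sub>R (indicator U z *\<^sub>R g z)
          = indicator (box (a1, a2) (b1, b2)) z *\<^sub>R g z" for z
        using sub by (auto simp: indicator_def)
      have "integrable lborel (\<lambda>z. indicator (box (a1, a2) (b1, b2)) z *\<^sub>R (indicator U z *\<^sub>R g z))"
        by (rule integrable_mult_indicator[OF _ int]) simp
      then show ?thesis unfolding ind eq by (rule borel_measurable_integrable)
    qed
    have "(\<lambda>k. \<phi> k z) \<longlonglongrightarrow> indicator (box (a1, a2) (b1, b2)) z" for z
    proof -
      have "indicator (box (a1, a2) (b1, b2)) z
          = (indicator {a1<..<b1} (fst z) * indicator {a2<..<b2} (snd z) :: complex)"
        by (cases z) (auto simp: mem_box_Pair indicator_def)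
      then show ?thesis unfolding \<phi>_def
        by (simp only:) (intro tendsto_mult bump_tendsto_indicator)
    qed
    then show "AE z in lborel. (\<lambda>k. indicator U z *\<^sub>R (g z * \<phi> k z))
      \<longlonglongrightarrow> indicator U z *\<^sub>R (g z * indicator (box (a1, a2) (b1, b2)) z)"
      by (intro AE_I2 tendsto_intros)
  qed
  moreover have "(LINT z|lborel. indicator U z *\<^sub>R (g z * \<phi> k z)) = 0" for k
    using orth[OF tf] by (simp add: set_lebesgue_integral_def)
  ultimately have "(\<lambda>k::nat. 0) \<longlonglongrightarrow> (LINT z|lborel. indicator U z *\<^sub>R (g z * indicator (box (a1, a2) (b1, b2)) z))"
    by (simp only:)
  then have "(LINT z|lborel. indicator U z *\<^sub>R (g z * indicator (box (a1, a2) (b1, b2)) z)) = 0"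
    by (rule LIMSEQ_unique[OF _ tendsto_const])
  then show ?thesis unfolding ind by (simp add: set_lebesgue_integral_def)
qed

text \<open>Boxes are stable under intersection and generate the Borel sets; the Borel sets on which the
  integral vanishes form a Dynkin system.\<close>

lemma integral_zero_on_boxes_imp_AE_zero:
  fixes G :: "real \<times> real \<Rightarrow> complex"
  assumes int: "integrable lborel G" and 0: "\<And>a b. (LINT z:box a b|lborel. G z) = 0"
  shows "AE z in lborel. G z = 0"
proof (rule sigma_finite_measure.density_zero[OF sigma_finite_lborel int])
  have si: "integrable lborel (\<lambda>z. indicator A z *\<^sub>R G z)" if "A \<in> sets borel" for A
    using integrable_mult_indicator[OF _ int, of A] that by simp
  define Q :: "nat \<Rightarrow> (real \<times> real) set" where "Q = (\<lambda>k. box (- real k, - real k) (real k, real k))"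
  have all: "(LINT z|lborel. G z) = 0"
  proof -
    have "(\<lambda>k. LINT z|lborel. indicator (Q k) z *\<^sub>R G z) \<longlonglongrightarrow> (LINT z|lborel. G z)"
    proof (rule integral_dominated_convergence)
      show "integrable lborel (\<lambda>z. norm (G z))" using int by simp
      show "AE z in lborel. norm (indicator (Q k) z *\<^sub>R G z) \<le> norm (G z)" for k
        by (auto simp: indicator_def)
      show "(\<lambda>z. indicator (Q k) z *\<^sub>R G z) \<in> borel_measurable lborel" for k
        using si by (auto simp: Q_def)
      have "(\<lambda>k. indicator (Q k) z *\<^sub>R G z) \<longlonglongrightarrow> G z" for z
      proof (rule tendsto_eventually)
        obtain N :: nat where N: "\<bar>fst z\<bar> + \<bar>snd z\<bar> < real N" using reals_Archimedean2 by blast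
        show "\<forall>\<^sub>F k in sequentially. indicator (Q k) z *\<^sub>R G z = G z"
          using eventually_ge_at_top[of N]
        proof eventually_elim
          case (elim k)
          then have "\<bar>fst z\<bar> + \<bar>snd z\<bar> < real k" using N by linarith
          then have "z \<in> Q k"
            by (cases z) (auto simp: Q_def mem_box_Pair)
          then show ?case by simp
        qed
      qed
      then show "AE z in lborel. (\<lambda>k. indicator (Q k) z *\<^sub>R G z) \<longlonglongrightarrow> G z" by auto
    qed (use int in auto)
    moreover have "(LINT z|lborel. indicator (Q k) z *\<^sub>R G z) = 0" for k
      using 0 unfolding set_lebesgue_integral_def Q_def by blast
    ultimately have "(\<lambda>k::nat. 0) \<longlonglongrightarrow> (LINT z|lborel. G z)" by simp
    then show ?thesis by (rule LIMSEQ_unique[OF _ tendsto_const])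
  qed
  fix A :: "(real \<times> real) set" assume "A \<in> sets lborel"
  then have A: "A \<in> sigma_sets UNIV (range (\<lambda>(a, b). box a b))"
    by (simp add: borel_eq_box)
  have meas: "X \<in> sets borel" if "X \<in> sigma_sets UNIV (range (\<lambda>(a, b). box a b))" for X :: "(real \<times> real) set"
    using that by (simp add: borel_eq_box)
  have stable: "Int_stable (range (\<lambda>(a, b). box a b :: (real \<times> real) set))"
    by (auto simp: Int_stable_def box_Int_box)
  have "range (\<lambda>(a, b). box a b :: (real \<times> real) set) \<subseteq> Pow UNIV" by simp
  with stable show "(LINT z:A|lborel. G z) = 0"
    using A
  proof (induct rule: sigma_sets_induct_disjoint)
    case (basic A)
    then show ?case using 0 by auto
  next
    case empty
    then show ?case by (simp add: set_lebesgue_integral_def)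
  next
    case (compl A)
    then have "A \<in> sets borel" by (intro meas) auto
    then have "(LINT z:UNIV - A|lborel. G z) = (LINT z|lborel. G z) - (LINT z:A|lborel. G z)"
    proof -
      have "indicator (UNIV - A) z *\<^sub>R G z = G z - indicator A z *\<^sub>R G z" for z
        by (simp add: indicator_def)
      then show ?thesis
        unfolding set_lebesgue_integral_def
        using Bochner_Integration.integral_diff[OF int si[OF \<open>A \<in> sets borel\<close>]] by simp
    qed
    then show ?case using compl all by simp
  next
    case (union A)
    then have "A i \<in> sets lborel" for i using meas by auto
    then have "(LINT z:(\<Union>i. A i)|lborel. G z) = (\<Sum>i. LINT z:A i|lborel. G z)"
      using union
      by (intro lebesgue_integral_countable_add) (auto simp: disjoint_family_on_def set_integrable_def intro!: si)
    then show ?case using union by simp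
  qed
qed

text \<open>Only boxes whose closure lies in \<open>U\<close> carry test functions; \<open>U\<close> is a countable union of closed boxes,
  and the boundary of a box is a null set.\<close>

lemma test_orthogonal_imp_AE_zero:
  assumes U: "bounded U" "open U" and g: "L2 U g"
    and orth: "\<And>\<phi>. test_fun U \<phi> \<Longrightarrow> (LINT z:U|lborel. g z * \<phi> z) = 0"
  shows "AE z in lborel. z \<in> U \<longrightarrow> g z = 0"
proof -
  have Ub: "U \<in> sets borel" using U(2) by simp
  obtain \<D> where \<D>: "countable \<D>" "\<D> \<subseteq> Pow U" "\<And>X. X \<in> \<D> \<Longrightarrow> \<exists>a b. X = cbox a b" "\<Union>\<D> = U"
    using open_countable_Union_open_cbox[OF U(2)] by metis
  have int: "integrable lborel (\<lambda>z. indicator U z *\<^sub>R g z)"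
    using L2_set_integrable[OF g U(1) Ub] by (simp add: set_integrable_def)
  have "AE z in lborel. z \<in> X \<longrightarrow> g z = 0" if X: "X \<in> \<D>" for X
  proof -
    obtain a b where ab: "X = cbox a b" using \<D>(3) X by blast
    have sub: "cbox a b \<subseteq> U" using \<D>(2) X ab by blast
    have eq: "indicator (box a b) z *\<^sub>R (indicator U z *\<^sub>R g z) = indicator (box a b) z *\<^sub>R g z" for z
      using sub box_subset_cbox by (auto simp: indicator_def)
    have int': "integrable lborel (\<lambda>z. indicator (box a b) z *\<^sub>R g z)"
      using integrable_mult_indicator[OF _ int, of "box a b"] unfolding eq by simp
    have "AE z in lborel. indicator (box a b) z *\<^sub>R g z = 0"
    proof (rule integral_zero_on_boxes_imp_AE_zero[OF int'])
      fix c d :: "real \<times> real"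
      have "\<exists>a' b'. box c d \<inter> box a b = box a' b' \<and> (box a' b' = {} \<or> cbox a' b' \<subseteq> cbox a b)"
      proof -
        define a' where "a' = (max (fst a) (fst c), max (snd a) (snd c))"
        define b' where "b' = (min (fst b) (fst d), min (snd b) (snd d))"
        have "box c d \<inter> box a b = box a' b'"
          by (cases a; cases b; cases c; cases d) (auto simp: a'_def b'_def mem_box_Pair)
        moreover have "cbox a' b' \<subseteq> cbox a b"
          by (cases a; cases b; cases c; cases d) (auto simp: a'_def b'_def)
        ultimately show ?thesis by blast
      qed
      then obtain a' b' where i: "box c d \<inter> box a b = box a' b'"
        and "box a' b' = {} \<or> cbox a' b' \<subseteq> cbox a b" by blast
      then have "(LINT z:box a' b'|lborel. g z) = 0"
        using test_orthogonal_box_integral_0[OF U(1) Ub g orth, of "fst a'" "snd a'" "fst b'" "snd b'"] sub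
        by (auto simp: set_lebesgue_integral_def)
      then show "(LINT z:box c d|lborel. indicator (box a b) z *\<^sub>R g z) = 0"
        unfolding set_lebesgue_integral_def i[symmetric]
        by (simp add: indicator_inter_arith)
    qed
    moreover have "AE z in lborel. z \<notin> cbox a b - box a b"
    proof -
      have "cbox a b - box a b \<in> null_sets lborel"
        using negligible_frontier_interval[of a b]
        by (simp add: negligible_iff_null_sets null_sets_completion_iff)
      then show ?thesis by (rule AE_not_in)
    qed
    ultimately show ?thesis unfolding ab by eventually_elim (auto simp: indicator_def split: if_splits)
  qed
  then have "AE z in lborel. \<forall>X\<in>\<D>. z \<in> X \<longrightarrow> g z = 0"
    by (subst AE_ball_countable[OF \<D>(1)]) blast
  then show ?thesis by eventually_elim (use \<D>(4) in auto)
qed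

section \<open>Sobolev functions on a bounded open set\<close>

lemma wderiv_props:
  assumes "u \<in> H1 U"
  shows "L2 U (wderiv U j u)" "has_weak_deriv U j u (wderiv U j u)"
  using someI_ex[of "\<lambda>g. L2 U g \<and> has_weak_deriv U j u g"] assms
  by (auto simp: H1_def wderiv_def)

lemma test_fun_C1: "test_fun U \<phi> \<Longrightarrow> C1 \<phi>"
  unfolding test_fun_def by (blast intro: smooth_imp_C1)

lemma weak_deriv_unique:
  assumes U: "bounded U" "open U" and L: "L2 U g" "L2 U h"
    and w: "has_weak_deriv U j u g" "has_weak_deriv U j u h"
  shows "AE z in lborel. z \<in> U \<longrightarrow> g z = h z"
proof -
  have Ub: "U \<in> sets borel" using U(2) by simp
  have "AE z in lborel. z \<in> U \<longrightarrow> g z - h z = 0"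
  proof (rule test_orthogonal_imp_AE_zero[OF U L2_diff[OF L]])
    fix \<phi> assume \<phi>: "test_fun U \<phi>"
    have c: "continuous_on UNIV \<phi>" by (rule C1_continuous[OF test_fun_C1[OF \<phi>]])
    have "(LINT z:U|lborel. (g z - h z) * \<phi> z) = (LINT z:U|lborel. g z * \<phi> z) - (LINT z:U|lborel. h z * \<phi> z)"
      unfolding left_diff_distrib
      by (rule set_integral_diff(2)[OF L2_mult_integrable[OF L(1) U(1) Ub c] L2_mult_integrable[OF L(2) U(1) Ub c]])
    also have "\<dots> = 0" using w \<phi> unfolding has_weak_deriv_def by (metis add.inverse_inverse diff_self)
    finally show "(LINT z:U|lborel. (g z - h z) * \<phi> z) = 0" .
  qed
  then show ?thesis by simp
qed

lemma has_weak_deriv_diff: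
  assumes U: "bounded U" "U \<in> sets borel" and L: "L2 U u" "L2 U v" "L2 U g" "L2 U h"
    and w: "has_weak_deriv U j u g" "has_weak_deriv U j v h"
  shows "has_weak_deriv U j (\<lambda>z. u z - v z) (\<lambda>z. g z - h z)"
  unfolding has_weak_deriv_def
proof (intro allI impI)
  fix \<phi> assume \<phi>: "test_fun U \<phi>"
  have c: "continuous_on UNIV \<phi>" "continuous_on UNIV (pdiff j \<phi>)"
    using C1_continuous C1_continuous_pdiff test_fun_C1[OF \<phi>] by blast+
  note i = L2_mult_integrable[OF _ U]
  show "(LINT z:U|lborel. (u z - v z) * pdiff j \<phi> z) = - (LINT z:U|lborel. (g z - h z) * \<phi> z)"
    unfolding left_diff_distrib set_integral_diff(2)[OF i[OF L(1) c(2)] i[OF L(2) c(2)]]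
        set_integral_diff(2)[OF i[OF L(3) c(1)] i[OF L(4) c(1)]]
        w[unfolded has_weak_deriv_def, rule_format, OF \<phi>] by (rule minus_diff_minus)
qed

text \<open>The product of \<open>\<phi>\<close> with a test function has compact support in \<open>U\<close>, so its derivative has
  integral 0 over any rectangle that contains \<open>U\<close>.\<close>

lemma C1_has_weak_deriv:
  assumes \<phi>: "C1 \<phi>" and U: "bounded U" "open U"
  shows "has_weak_deriv U j \<phi> (pdiff j \<phi>)"
  unfolding has_weak_deriv_def
proof (intro allI impI)
  fix \<psi> assume \<psi>: "test_fun U \<psi>"
  have Ub: "U \<in> sets borel" using U(2) by simp
  define K where "K = closure {z. \<psi> z \<noteq> 0}"
  have K: "K \<subseteq> U" "closed K" using \<psi> by (auto simp: test_fun_def K_def)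
  have \<psi>0: "\<psi> z = 0" if "z \<notin> K" for z
    using that subsetD[OF closure_subset, of z "{z. \<psi> z \<noteq> 0}"] unfolding K_def by auto
  define F where "F = (\<lambda>z. \<phi> z * \<psi> z)"
  have F: "C1 F" unfolding F_def by (rule C1_mult[OF \<phi> test_fun_C1[OF \<psi>]])
  have F0: "F z = 0" if "z \<notin> U" for z
    using \<psi>0[of z] K(1) that by (cases "z \<in> K") (auto simp: F_def)
  have dF0: "pdiff j F z = 0" if "z \<notin> U" for z
  proof -
    have "(F has_derivative (\<lambda>_. 0)) (at z)"
    proof (rule has_derivative_transform_within_open[of "\<lambda>_. 0" _ _ _ "- K"])
      show "open (- K)" "z \<in> - K" using K that by auto
      show "0 = F x" if "x \<in> - K" for x using \<psi>0 that by (simp add: F_def)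
    qed simp
    from pdiff_eqI[OF this] show ?thesis .
  qed
  obtain r where r: "r > 0" "\<And>z. z \<in> U \<Longrightarrow> norm z < r"
    using U(1) by (metis bounded_pos_less)
  have box: "\<bar>x\<bar> < r" "\<bar>y\<bar> < r" if "(x, y) \<in> U" for x y
    using r(2)[OF that] norm_fst_le[of x y] norm_snd_le[of y x] by auto
  have Usub: "U \<subseteq> cbox (-r, -r) (r, r)"
  proof
    fix z assume "z \<in> U"
    then show "z \<in> cbox (-r, -r) (r, r)" using box[of "fst z" "snd z"] by (cases z) auto
  qed
  have "(LINT z:U|lborel. pdiff j F z) = (LINT z:cbox (-r, -r) (r, r)|lborel. pdiff j F z)"
    unfolding set_lebesgue_integral_def
    by (rule Bochner_Integration.integral_cong) (use dF0 Usub in \<open>auto simp: indicator_def\<close>)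
  also have "\<dots> = integral (cbox (-r, -r) (r, r)) (pdiff j F)"
    by (rule set_borel_integral_eq_integral(2)[OF L2_set_integrable[OF L2_continuous[OF C1_continuous_pdiff[OF F]]]])
      auto
  also have "\<dots> = 0"
  proof -
    have "F (x, r) = 0" "F (x, -r) = 0" "F (r, x) = 0" "F (-r, x) = 0" for x
      using F0 box by (force simp: abs_less_iff)+
    then show ?thesis
      using exhaust_2[of j] integral_rect_pdiff1[OF F, of "-r" r "-r" r] integral_rect_pdiff2[OF F, of "-r" r "-r" r] r(1)
      by auto
  qed
  finally have "(LINT z:U|lborel. pdiff j F z) = 0" .
  moreover have "pdiff j F = (\<lambda>z. pdiff j \<phi> z * \<psi> z + \<phi> z * pdiff j \<psi> z)"
    unfolding F_def using pdiff_mult[OF \<phi> test_fun_C1[OF \<psi>]] by blast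
  moreover have "set_integrable lborel U (\<lambda>z. pdiff j \<phi> z * \<psi> z)" "set_integrable lborel U (\<lambda>z. \<phi> z * pdiff j \<psi> z)"
    by (intro L2_mult_integrable L2_continuous C1_continuous C1_continuous_pdiff U(1) Ub \<phi> test_fun_C1[OF \<psi>])+
  ultimately have "(LINT z:U|lborel. pdiff j \<phi> z * \<psi> z) + (LINT z:U|lborel. \<phi> z * pdiff j \<psi> z) = 0"
    by (simp add: set_integral_add(2))
  then show "(LINT z:U|lborel. \<phi> z * pdiff j \<psi> z) = - (LINT z:U|lborel. pdiff j \<phi> z * \<psi> z)"
    by (simp add: add_eq_0_iff)
qed

lemma C1_H1:
  assumes "C1 \<phi>" "bounded U" "open U" shows "\<phi> \<in> H1 U"
proof -
  have Ub: "U \<in> sets borel" using assms(3) by simp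
  show ?thesis
    using C1_has_weak_deriv[OF assms] L2_continuous[OF C1_continuous[OF assms(1)] assms(2) Ub]
      L2_continuous[OF C1_continuous_pdiff[OF assms(1)] assms(2) Ub]
    unfolding H1_def by blast
qed

lemma AE_wderiv_C1:
  assumes "C1 \<phi>" "bounded U" "open U"
  shows "AE z in lborel. z \<in> U \<longrightarrow> wderiv U j \<phi> z = pdiff j \<phi> z"
proof -
  have Ub: "U \<in> sets borel" using assms(3) by simp
  show ?thesis
    by (rule weak_deriv_unique[OF assms(2,3) wderiv_props(1)[OF C1_H1[OF assms]]
          L2_continuous[OF C1_continuous_pdiff[OF assms(1)] assms(2) Ub]
          wderiv_props(2)[OF C1_H1[OF assms]] C1_has_weak_deriv[OF assms]])
qed

text \<open>The approximation in the definition of a trace is measured by the chosen weak derivative of the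
  difference; uniqueness turns it into a statement about the difference of the derivatives.\<close>

lemma AE_wderiv_C1_diff:
  assumes "C1 \<phi>" "u \<in> H1 U" "bounded U" "open U"
  shows "AE z in lborel. z \<in> U \<longrightarrow> wderiv U j (\<lambda>z. \<phi> z - u z) z = pdiff j \<phi> z - wderiv U j u z"
    and "(\<lambda>z. \<phi> z - u z) \<in> H1 U"
proof -
  have Ub: "U \<in> sets borel" using assms(4) by simp
  have L: "L2 U \<phi>" "L2 U (pdiff k \<phi>)" "L2 U u" "L2 U (wderiv U k u)" for k
    using L2_continuous[OF C1_continuous[OF assms(1)] assms(3) Ub]
      L2_continuous[OF C1_continuous_pdiff[OF assms(1)] assms(3) Ub] wderiv_props(1)[OF assms(2)] assms(2)
    by (auto simp: H1_def)
  have w: "has_weak_deriv U k (\<lambda>z. \<phi> z - u z) (\<lambda>z. pdiff k \<phi> z - wderiv U k u z)" for k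
    by (rule has_weak_deriv_diff[OF assms(3) Ub L(1,3,2,4) C1_has_weak_deriv[OF assms(1,3,4)] wderiv_props(2)[OF assms(2)]])
  show H: "(\<lambda>z. \<phi> z - u z) \<in> H1 U"
    unfolding H1_def using L2_diff[OF L(1,3)] L2_diff[OF L(2,4)] w by blast
  show "AE z in lborel. z \<in> U \<longrightarrow> wderiv U j (\<lambda>z. \<phi> z - u z) z = pdiff j \<phi> z - wderiv U j u z"
    by (rule weak_deriv_unique[OF assms(3,4) wderiv_props(1)[OF H] L2_diff[OF L(2,4)] wderiv_props(2)[OF H] w])
qed

lemma set_integral_cong_AE_measurable:
  fixes f g :: "'a::euclidean_space \<Rightarrow> 'b::{banach, second_countable_topology}"
  assumes "set_borel_measurable lborel U f" "set_borel_measurable lborel U g"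
    and "AE z in lborel. z \<in> U \<longrightarrow> f z = g z"
  shows "(LINT z:U|lborel. f z) = (LINT z:U|lborel. g z)"
  unfolding set_lebesgue_integral_def
  using assms unfolding set_borel_measurable_def
  by (intro integral_cong_AE) (auto elim!: eventually_mono simp: indicator_def)

lemma set_integrable_measurable: "set_integrable M U f \<Longrightarrow> set_borel_measurable M U f"
  unfolding set_integrable_def set_borel_measurable_def by (rule borel_measurable_integrable)

lemma L2_norm_cong_AE:
  assumes "L2 U f" "L2 U g" "AE z in lborel. z \<in> U \<longrightarrow> f z = g z"
  shows "L2_norm U f = L2_norm U g"
proof -
  have "(LINT z:U|lborel. (norm (f z))\<^sup>2) = (LINT z:U|lborel. (norm (g z))\<^sup>2)"
    using assms by (intro set_integral_cong_AE_measurable set_integrable_measurable)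
      (auto simp: L2_def elim!: eventually_mono)
  then show ?thesis by (simp add: L2_norm_def)
qed

lemma H1_norm_eq: "H1_norm U u = sqrt ((L2_norm U u)\<^sup>2 + (\<Sum>j\<in>UNIV. (L2_norm U (wderiv U j u))\<^sup>2))"
  by (simp add: H1_norm_def L2_norm_def real_sqrt_pow2[OF set_integral_nonneg_norm])

lemma L2_norm_le_H1_norm: "L2_norm U u \<le> H1_norm U u"
  unfolding H1_norm_eq by (rule real_le_rsqrt) (simp add: sum_nonneg)

lemma L2_norm_wderiv_le_H1_norm: "L2_norm U (wderiv U j u) \<le> H1_norm U u"
  unfolding H1_norm_eq using member_le_sum[of j UNIV "\<lambda>j. (L2_norm U (wderiv U j u))\<^sup>2"]
  by (intro real_le_rsqrt) (auto intro: add_increasing)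

lemma H1_norm_component_le: "H1_norm U (\<lambda>z. u z $ i) \<le> H1_norm_vec U u"
  unfolding H1_norm_vec_def
  by (rule real_le_rsqrt) (rule member_le_sum; simp)

lemma H1_norm_vec_nonneg: "0 \<le> H1_norm_vec U u"
  unfolding H1_norm_vec_def by (simp add: sum_nonneg)

lemma H1_norm_zero:
  assumes "bounded U" "open U" shows "H1_norm U (\<lambda>z. 0) = 0"
proof -
  have C: "C1 (\<lambda>z. 0)"
    using C_k_tensor[OF Ck1_const[of "Suc 0" 0] Ck1_const[of "Suc 0" 0]] by simp
  have Ub: "U \<in> sets borel" using assms(2) by simp
  have p: "pdiff j (\<lambda>z. 0) = (\<lambda>z. 0)" for j using pdiff_eqI[OF has_derivative_const] by blast
  have "AE z in lborel. z \<in> U \<longrightarrow> wderiv U j (\<lambda>z. 0) z = 0" for j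
    using AE_wderiv_C1[OF C assms, of j] unfolding p .
  then have "L2_norm U (wderiv U j (\<lambda>z. 0)) = L2_norm U (\<lambda>z. 0)" for j
    by (intro L2_norm_cong_AE wderiv_props C1_H1[OF C assms] L2_continuous assms(1) Ub) auto
  then show ?thesis by (simp add: H1_norm_eq L2_norm_def set_lebesgue_integral_def)
qed

lemma H1_approx_pairing_tendsto:
  assumes U: "bounded U" "open U" and u: "u \<in> H1 U" and \<phi>: "\<And>k. C1 (\<phi> k)"
    and lim: "(\<lambda>k. H1_norm U (\<lambda>z. \<phi> k z - u z)) \<longlonglongrightarrow> 0" and w: "continuous_on UNIV w"
  shows "(\<lambda>k. LINT z:U|lborel. \<phi> k z * w z) \<longlonglongrightarrow> (LINT z:U|lborel. u z * w z)"
    and "(\<lambda>k. LINT z:U|lborel. pdiff j (\<phi> k) z * w z) \<longlonglongrightarrow> (LINT z:U|lborel. wderiv U j u z * w z)"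
proof -
  have Ub: "U \<in> sets borel" using U(2) by simp
  have L: "L2 U (\<phi> k)" "L2 U (pdiff j (\<phi> k))" "L2 U u" "L2 U (wderiv U j u)" for k
    using L2_continuous[OF C1_continuous[OF \<phi>] U(1) Ub]
      L2_continuous[OF C1_continuous_pdiff[OF \<phi>] U(1) Ub] wderiv_props(1)[OF u] u
    by (auto simp: H1_def)
  have le: "(\<lambda>k. f k) \<longlonglongrightarrow> 0" if "\<And>k. 0 \<le> f k" "\<And>k. f k \<le> H1_norm U (\<lambda>z. \<phi> k z - u z)" for f
    by (rule tendsto_sandwich[OF _ _ tendsto_const lim]) (use that in auto)
  show "(\<lambda>k. LINT z:U|lborel. \<phi> k z * w z) \<longlonglongrightarrow> (LINT z:U|lborel. u z * w z)"
    by (rule L2_pairing_tendsto[OF L(1,3) U(1) Ub w le]) (rule L2_norm_nonneg, rule L2_norm_le_H1_norm)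
  have "L2_norm U (\<lambda>z. pdiff j (\<phi> k) z - wderiv U j u z) = L2_norm U (wderiv U j (\<lambda>z. \<phi> k z - u z))" for k
    by (rule L2_norm_cong_AE[OF wderiv_props(1)[OF AE_wderiv_C1_diff(2)[OF \<phi> u U]]
          L2_diff[OF L(2,4)] AE_wderiv_C1_diff(1)[OF \<phi> u U], symmetric])
  then show "(\<lambda>k. LINT z:U|lborel. pdiff j (\<phi> k) z * w z) \<longlonglongrightarrow> (LINT z:U|lborel. wderiv U j u z * w z)"
    by (intro L2_pairing_tendsto[OF L(2,4) U(1) Ub w le]) (simp_all add: L2_norm_nonneg L2_norm_wderiv_le_H1_norm)
qed

section \<open>Green's formulas in the periodic cell\<close>

text \<open>Only weights that vanish below the line \<open>y = a\<close> are used. As the profile stays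
  below this line, integrals over the cell against such weights are integrals over a rectangle.\<close>

locale cell =
  fixes p :: grating and a :: real
  assumes period_pos: "0 < period p"
    and profile_periodic: "profile p (period p) = profile p 0"
    and profile_cont: "continuous_on UNIV (profile p)"
    and profile_below: "\<And>x. 0 \<le> x \<Longrightarrow> x \<le> period p \<Longrightarrow> profile p x < a"
    and below_height: "a < height p"
begin

lemma open_Omega: "open (Omega p)"
proof -
  have "Omega p = {z. 0 < fst z} \<inter> {z. fst z < period p} \<inter> {z. profile p (fst z) < snd z} \<inter> {z. snd z < height p}"
    by (auto simp: Omega_def)
  moreover have "continuous_on UNIV (\<lambda>z::real\<times>real. profile p (fst z))"
    by (intro continuous_on_compose2[OF profile_cont] continuous_intros) auto
  ultimately show ?thesis
    by (auto intro!: open_Int open_Collect_less continuous_intros)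
qed

lemma bounded_Omega: "bounded (Omega p)"
proof -
  have "compact (profile p ` {0..period p})"
    using profile_cont by (intro compact_continuous_image continuous_on_subset[OF profile_cont]) auto
  then obtain B where B: "\<And>x. x \<in> {0..period p} \<Longrightarrow> norm (profile p x) \<le> B"
    by (metis bounded_iff compact_imp_bounded image_eqI)
  have "Omega p \<subseteq> cbox (0, - B) (period p, height p)"
  proof
    fix z assume "z \<in> Omega p"
    then show "z \<in> cbox (0, - B) (period p, height p)"
      using B[of "fst z"] by (cases z) (auto simp: Omega_def)
  qed
  then show ?thesis by (rule bounded_subset[OF bounded_cbox])
qed

lemma borel_Omega: "Omega p \<in> sets borel"
  using open_Omega by simp

lemma Omega_above: "y > a \<Longrightarrow> (x, y) \<in> Omega p \<longleftrightarrow> 0 < x \<and> x < period p \<and> y < height p"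
  using profile_below[of x] by (auto simp: Omega_def)

lemma set_integral_Omega_above:
  assumes "continuous_on UNIV G" "\<And>z. snd z \<le> a \<Longrightarrow> G z = 0"
  shows "(LINT z:Omega p|lborel. G z) = integral (cbox (0, a) (period p, height p)) (G :: _ \<Rightarrow> complex)"
proof -
  have "(LINT z:Omega p|lborel. G z) = (LINT z:box (0, a) (period p, height p)|lborel. G z)"
    unfolding set_lebesgue_integral_def
  proof (rule Bochner_Integration.integral_cong[OF refl])
    fix z
    show "indicator (Omega p) z *\<^sub>R G z = indicator (box (0, a) (period p, height p)) z *\<^sub>R G z"
      using assms(2)[of z] Omega_above[of "snd z" "fst z"]
      by (cases z; cases "snd z \<le> a") (auto simp: mem_box_Pair indicator_def)
  qed
  also have "\<dots> = integral (box (0, a) (period p, height p)) G"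
    by (rule set_borel_integral_eq_integral(2)[OF L2_set_integrable[OF L2_continuous[OF assms(1)]]]) auto
  finally show ?thesis by (simp add: integral_open_interval)
qed

lemma set_integral_interval_eq:
  assumes "continuous_on UNIV (G :: real \<Rightarrow> complex)"
  shows "(LINT x:{c<..<d}|lborel. G x) = integral {c..d} G"
  using set_borel_integral_eq_integral(2)[OF L2_set_integrable[OF L2_continuous[OF assms]], of "{c<..<d}"]
  by (simp add: integral_open_interval_real)

context
  fixes h h' \<eta> \<eta>' :: "real \<Rightarrow> complex"
  assumes dh: "\<And>x. (h has_vector_derivative h' x) (at x)" and ch': "continuous_on UNIV h'"
    and d\<eta>: "\<And>y. (\<eta> has_vector_derivative \<eta>' y) (at y)" and c\<eta>': "continuous_on UNIV \<eta>'"
    and \<eta>0: "\<And>y. y \<le> a \<Longrightarrow> \<eta> y = 0"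
begin

lemma tensor_Ck1: "Ck1 (Suc 0) h" "Ck1 (Suc 0) \<eta>"
  using Ck1_SucI[of h h' 0] Ck1_SucI[of \<eta> \<eta>' 0] dh d\<eta> ch' c\<eta>' by auto

lemma tensor_C1: "C1 (tensor h \<eta>)"
  by (rule C_k_tensor[OF tensor_Ck1])

lemma cont_h: "continuous_on UNIV h" and cont_\<eta>: "continuous_on UNIV \<eta>"
  using tensor_Ck1 Ck1_continuous by blast+

lemma cont_tensors: "continuous_on UNIV (tensor h \<eta>)" "continuous_on UNIV (tensor h' \<eta>)"
    "continuous_on UNIV (tensor h \<eta>')"
  by (intro continuous_on_mult continuous_on_compose2[OF cont_h] continuous_on_compose2[OF cont_\<eta>]
      continuous_on_compose2[OF ch'] continuous_on_compose2[OF c\<eta>'] continuous_intros subset_UNIV)+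

lemma weight_deriv_below: "y \<le> a \<Longrightarrow> \<eta>' y = 0"
  by (rule derivative_vanishes_below[OF d\<eta> c\<eta>' \<eta>0])

text \<open>The contribution of the lower side of the rectangle is 0 because the weight vanishes there.\<close>

lemma green_y_C1:
  assumes \<phi>: "C1 \<phi>"
  shows "(LINT z:Omega p|lborel. pdiff 2 \<phi> z * tensor h \<eta> z) + (LINT z:Omega p|lborel. \<phi> z * tensor h \<eta>' z)
     = (LINT x:{0<..<period p}|lborel. \<phi> (x, height p) * (h x * \<eta> (height p)))"
proof -
  define F where "F = (\<lambda>z. \<phi> z * tensor h \<eta> z)"
  have F: "C1 F" unfolding F_def by (rule C1_mult[OF \<phi> tensor_C1])
  have dF: "pdiff 2 F = (\<lambda>z. pdiff 2 \<phi> z * tensor h \<eta> z + \<phi> z * tensor h \<eta>' z)"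
    using pdiff_mult[OF \<phi> tensor_C1] pdiff_tensor(2)[OF dh d\<eta>] by (simp add: F_def fun_eq_iff)
  have i: "set_integrable lborel (Omega p) (\<lambda>z. pdiff 2 \<phi> z * tensor h \<eta> z)"
      "set_integrable lborel (Omega p) (\<lambda>z. \<phi> z * tensor h \<eta>' z)"
    by (intro L2_mult_integrable[OF L2_continuous] C1_continuous C1_continuous_pdiff \<phi> bounded_Omega borel_Omega cont_tensors)+
  have "(LINT z:Omega p|lborel. pdiff 2 \<phi> z * tensor h \<eta> z) + (LINT z:Omega p|lborel. \<phi> z * tensor h \<eta>' z)
      = (LINT z:Omega p|lborel. pdiff 2 F z)"
    unfolding dF by (rule set_integral_add(2)[OF i, symmetric])
  also have "\<dots> = integral (cbox (0, a) (period p, height p)) (pdiff 2 F)"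
    by (rule set_integral_Omega_above[OF C1_continuous_pdiff[OF F]]) (simp add: dF \<eta>0 weight_deriv_below)
  also have "\<dots> = integral {0..period p} (\<lambda>x. F (x, height p) - F (x, a))"
    using below_height by (intro integral_rect_pdiff2[OF F]) simp
  also have "\<dots> = integral {0..period p} (\<lambda>x. \<phi> (x, height p) * (h x * \<eta> (height p)))"
    by (simp add: F_def \<eta>0)
  also have "\<dots> = (LINT x:{0<..<period p}|lborel. \<phi> (x, height p) * (h x * \<eta> (height p)))"
    by (intro set_integral_interval_eq[symmetric] continuous_intros cont_h
        continuous_on_compose2[OF C1_continuous[OF \<phi>]] subset_UNIV)
  finally show ?thesis .
qed

lemma set_integral_above_profile:
  assumes "continuous_on UNIV (G :: real \<Rightarrow> complex)" "\<And>y. y \<le> a \<Longrightarrow> G y = 0"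
  shows "(LINT y:{profile p 0<..<height p}|lborel. G y) = integral {a..height p} G"
proof -
  have "(LINT y:{profile p 0<..<height p}|lborel. G y) = (LINT y:{a<..<height p}|lborel. G y)"
    unfolding set_lebesgue_integral_def
    by (rule Bochner_Integration.integral_cong[OF refl])
      (use assms(2) profile_below[of 0] period_pos in \<open>auto simp: indicator_def\<close>)
  then show ?thesis using set_integral_interval_eq[OF assms(1)] by simp
qed

lemma green_x_C1:
  assumes \<phi>: "C1 \<phi>"
  shows "(LINT z:Omega p|lborel. pdiff 1 \<phi> z * tensor h \<eta> z) + (LINT z:Omega p|lborel. \<phi> z * tensor h' \<eta> z)
     = (LINT y:{profile p 0<..<height p}|lborel. \<phi> (period p, y) * (h (period p) * \<eta> y))
     - (LINT y:{profile p 0<..<height p}|lborel. \<phi> (0, y) * (h 0 * \<eta> y))"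
proof -
  define F where "F = (\<lambda>z. \<phi> z * tensor h \<eta> z)"
  have F: "C1 F" unfolding F_def by (rule C1_mult[OF \<phi> tensor_C1])
  have dF: "pdiff 1 F = (\<lambda>z. pdiff 1 \<phi> z * tensor h \<eta> z + \<phi> z * tensor h' \<eta> z)"
    using pdiff_mult[OF \<phi> tensor_C1] pdiff_tensor(1)[OF dh d\<eta>] by (simp add: F_def fun_eq_iff)
  have i: "set_integrable lborel (Omega p) (\<lambda>z. pdiff 1 \<phi> z * tensor h \<eta> z)"
      "set_integrable lborel (Omega p) (\<lambda>z. \<phi> z * tensor h' \<eta> z)"
    by (intro L2_mult_integrable[OF L2_continuous] C1_continuous C1_continuous_pdiff \<phi> bounded_Omega borel_Omega cont_tensors)+
  have c: "continuous_on UNIV (\<lambda>y. \<phi> (x, y) * (h x * \<eta> y))" for x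
    by (intro continuous_intros cont_\<eta> continuous_on_compose2[OF C1_continuous[OF \<phi>]] subset_UNIV)
  have "(LINT z:Omega p|lborel. pdiff 1 \<phi> z * tensor h \<eta> z) + (LINT z:Omega p|lborel. \<phi> z * tensor h' \<eta> z)
      = (LINT z:Omega p|lborel. pdiff 1 F z)"
    unfolding dF by (rule set_integral_add(2)[OF i, symmetric])
  also have "\<dots> = integral (cbox (0, a) (period p, height p)) (pdiff 1 F)"
    by (rule set_integral_Omega_above[OF C1_continuous_pdiff[OF F]]) (simp add: dF \<eta>0)
  also have "\<dots> = integral {a..height p} (\<lambda>y. F (period p, y) - F (0, y))"
    using period_pos by (intro integral_rect_pdiff1[OF F]) simp
  also have "\<dots> = integral {a..height p} (\<lambda>y. \<phi> (period p, y) * (h (period p) * \<eta> y))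
      - integral {a..height p} (\<lambda>y. \<phi> (0, y) * (h 0 * \<eta> y))"
    unfolding F_def fst_conv snd_conv
    by (intro Henstock_Kurzweil_Integration.integral_diff integrable_continuous_real continuous_on_subset[OF c] subset_UNIV)
  also have "\<dots> = (LINT y:{profile p 0<..<height p}|lborel. \<phi> (period p, y) * (h (period p) * \<eta> y))
     - (LINT y:{profile p 0<..<height p}|lborel. \<phi> (0, y) * (h 0 * \<eta> y))"
    using set_integral_above_profile[OF c] by (simp add: \<eta>0)
  finally show ?thesis .
qed

end

end

lemma boundary_sqnorm_nonneg_pieces:
  "L2_norm {0<..<period p} (\<lambda>x. g (x, height p)) \<le> sqrt (boundary_sqnorm p g)"
  "L2_norm {profile p 0<..<height p} (\<lambda>y. g (0, y)) \<le> sqrt (boundary_sqnorm p g)"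
  "L2_norm {profile p (period p)<..<height p} (\<lambda>y. g (period p, y)) \<le> sqrt (boundary_sqnorm p g)"
  using set_integral_nonneg_norm[of "{0<..<period p}" "\<lambda>x. g (x, height p)"]
    set_integral_nonneg_norm[of "{0<..<period p}" "\<lambda>x. g (x, profile p x)"]
    set_integral_nonneg_norm[of "{profile p 0<..<height p}" "\<lambda>y. g (0, y)"]
    set_integral_nonneg_norm[of "{profile p (period p)<..<height p}" "\<lambda>y. g (period p, y)"]
  by (auto simp: L2_norm_def boundary_sqnorm_def)

context cell
begin

lemma boundary_pairing_tendsto:
  assumes g: "boundary_L2 p g" and \<phi>: "\<And>k. C1 (\<phi> k)"
    and lim: "(\<lambda>k. boundary_sqnorm p (\<lambda>z. \<phi> k z - g z)) \<longlonglongrightarrow> 0" and w: "continuous_on UNIV w"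
  shows "(\<lambda>k. LINT x:{0<..<period p}|lborel. \<phi> k (x, height p) * w x)
      \<longlonglongrightarrow> (LINT x:{0<..<period p}|lborel. g (x, height p) * w x)"
    and "(\<lambda>k. LINT y:{profile p 0<..<height p}|lborel. \<phi> k (0, y) * w y)
      \<longlonglongrightarrow> (LINT y:{profile p 0<..<height p}|lborel. g (0, y) * w y)"
    and "(\<lambda>k. LINT y:{profile p 0<..<height p}|lborel. \<phi> k (period p, y) * w y)
      \<longlonglongrightarrow> (LINT y:{profile p 0<..<height p}|lborel. g (period p, y) * w y)"
proof -
  have s: "(\<lambda>k. sqrt (boundary_sqnorm p (\<lambda>z. \<phi> k z - g z))) \<longlonglongrightarrow> 0"
    using tendsto_real_sqrt[OF lim] by simp
  have le: "(\<lambda>k. f k) \<longlonglongrightarrow> 0" if "\<And>k. 0 \<le> f k" "\<And>k. f k \<le> sqrt (boundary_sqnorm p (\<lambda>z. \<phi> k z - g z))" for f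
    by (rule tendsto_sandwich[OF _ _ tendsto_const s]) (use that in auto)
  have c: "continuous_on UNIV (\<lambda>x. \<phi> k (x, y))" "continuous_on UNIV (\<lambda>y. \<phi> k (x, y))" for k x y
    by (intro continuous_on_compose2[OF C1_continuous[OF \<phi>]] continuous_intros subset_UNIV)+
  have L: "L2 {c<..<d} (\<lambda>x. \<phi> k (x, y))" "L2 {c<..<d} (\<lambda>y. \<phi> k (x, y))" for k c d x y
    by (intro L2_continuous c; simp)+
  have e: "(\<lambda>k. L2_norm {0<..<period p} (\<lambda>x. \<phi> k (x, height p) - g (x, height p))) \<longlonglongrightarrow> 0"
    "(\<lambda>k. L2_norm {profile p 0<..<height p} (\<lambda>y. \<phi> k (0, y) - g (0, y))) \<longlonglongrightarrow> 0"
    "(\<lambda>k. L2_norm {profile p 0<..<height p} (\<lambda>y. \<phi> k (period p, y) - g (period p, y))) \<longlonglongrightarrow> 0"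
    by (rule le[OF L2_norm_nonneg], use boundary_sqnorm_nonneg_pieces[of p "\<lambda>z. \<phi> k z - g z" for k] in
          \<open>simp add: profile_periodic\<close>)+
  have G: "L2 {0<..<period p} (\<lambda>x. g (x, height p))" "L2 {profile p 0<..<height p} (\<lambda>y. g (0, y))"
    "L2 {profile p 0<..<height p} (\<lambda>y. g (period p, y))"
    using g by (simp_all add: boundary_L2_def profile_periodic)
  show "(\<lambda>k. LINT x:{0<..<period p}|lborel. \<phi> k (x, height p) * w x)
      \<longlonglongrightarrow> (LINT x:{0<..<period p}|lborel. g (x, height p) * w x)"
    by (rule L2_pairing_tendsto[OF L(1) G(1) _ _ w e(1)]) auto
  show "(\<lambda>k. LINT y:{profile p 0<..<height p}|lborel. \<phi> k (0, y) * w y)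
      \<longlonglongrightarrow> (LINT y:{profile p 0<..<height p}|lborel. g (0, y) * w y)"
    by (rule L2_pairing_tendsto[OF L(2) G(2) _ _ w e(2)]) auto
  show "(\<lambda>k. LINT y:{profile p 0<..<height p}|lborel. \<phi> k (period p, y) * w y)
      \<longlonglongrightarrow> (LINT y:{profile p 0<..<height p}|lborel. g (period p, y) * w y)"
    by (rule L2_pairing_tendsto[OF L(2) G(3) _ _ w e(3)]) auto
qed

context
  fixes h h' \<eta> \<eta>' :: "real \<Rightarrow> complex"
  assumes dh: "\<And>x. (h has_vector_derivative h' x) (at x)" and ch': "continuous_on UNIV h'"
    and d\<eta>: "\<And>y. (\<eta> has_vector_derivative \<eta>' y) (at y)" and c\<eta>': "continuous_on UNIV \<eta>'"
    and \<eta>0: "\<And>y. y \<le> a \<Longrightarrow> \<eta> y = 0"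
begin

lemmas weight = dh ch' d\<eta> c\<eta>' \<eta>0

lemma green_y_trace:
  assumes u: "u \<in> H1 (Omega p)" and g: "has_trace p u g"
  shows "(LINT z:Omega p|lborel. wderiv (Omega p) 2 u z * tensor h \<eta> z) + (LINT z:Omega p|lborel. u z * tensor h \<eta>' z)
     = \<eta> (height p) * (LINT x:{0<..<period p}|lborel. g (x, height p) * h x)"
proof -
  obtain \<phi> where bd: "boundary_L2 p g" and \<phi>: "\<And>k. smooth (\<phi> k)"
    and l: "(\<lambda>k. H1_norm (Omega p) (\<lambda>z. \<phi> k z - u z)) \<longlonglongrightarrow> 0"
      "(\<lambda>k. boundary_sqnorm p (\<lambda>z. \<phi> k z - g z)) \<longlonglongrightarrow> 0"
    using g unfolding has_trace_def by blast
  have C: "C1 (\<phi> k)" for k by (rule smooth_imp_C1[OF \<phi>])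
  note ct = cont_tensors[OF weight]
  have "continuous_on UNIV (\<lambda>x. h x * \<eta> (height p))"
    by (intro continuous_intros cont_h[OF weight])
  note R = boundary_pairing_tendsto(1)[OF bd C l(2) this]
  have L: "(\<lambda>k. (LINT z:Omega p|lborel. pdiff 2 (\<phi> k) z * tensor h \<eta> z) + (LINT z:Omega p|lborel. \<phi> k z * tensor h \<eta>' z))
      \<longlonglongrightarrow> (LINT z:Omega p|lborel. wderiv (Omega p) 2 u z * tensor h \<eta> z) + (LINT z:Omega p|lborel. u z * tensor h \<eta>' z)"
    by (intro tendsto_add H1_approx_pairing_tendsto bounded_Omega open_Omega u C l(1) ct)
  have "(LINT z:Omega p|lborel. wderiv (Omega p) 2 u z * tensor h \<eta> z) + (LINT z:Omega p|lborel. u z * tensor h \<eta>' z)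
      = (LINT x:{0<..<period p}|lborel. g (x, height p) * (h x * \<eta> (height p)))"
    by (rule LIMSEQ_unique[OF L Lim_transform_eventually[OF R]])
      (rule always_eventually, rule allI, rule green_y_C1[OF weight C, symmetric])
  also have "\<dots> = \<eta> (height p) * (LINT x:{0<..<period p}|lborel. g (x, height p) * h x)"
    by (simp add: mult_ac flip: set_integral_mult_right)
  finally show ?thesis .
qed

text \<open>The condition on \<open>h\<close> says that \<open>h\<close> has the conjugate quasi-periodicity, so the two lateral
  integrals cancel.\<close>

lemma green_x_quasiperiodic:
  assumes u: "u \<in> H1_qp p" and qp: "h (period p) * exp (\<i> * of_real (alpha p * period p)) = h 0"
  shows "(LINT z:Omega p|lborel. wderiv (Omega p) 1 u z * tensor h \<eta> z) + (LINT z:Omega p|lborel. u z * tensor h' \<eta> z) = 0"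
proof -
  define q where "q = exp (\<i> * of_real (alpha p * period p))"
  obtain g where g: "has_trace p u g" and gq: "AE y in lborel. y \<in> {profile p 0<..<height p} \<longrightarrow>
        g (period p, y) = g (0, y) * q"
    using u unfolding H1_qp_def q_def by blast
  have uH: "u \<in> H1 (Omega p)" using u by (simp add: H1_qp_def)
  obtain \<phi> where bd: "boundary_L2 p g" and \<phi>: "\<And>k. smooth (\<phi> k)"
    and l: "(\<lambda>k. H1_norm (Omega p) (\<lambda>z. \<phi> k z - u z)) \<longlonglongrightarrow> 0"
      "(\<lambda>k. boundary_sqnorm p (\<lambda>z. \<phi> k z - g z)) \<longlonglongrightarrow> 0"
    using g unfolding has_trace_def by blast
  have C: "C1 (\<phi> k)" for k by (rule smooth_imp_C1[OF \<phi>])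
  note ct = cont_tensors[OF weight]
  have c: "continuous_on UNIV (\<lambda>y. h x * \<eta> y)" for x
    by (intro continuous_intros cont_\<eta>[OF weight])
  note R = tendsto_diff[OF boundary_pairing_tendsto(3)[OF bd C l(2) c[of "period p"]]
      boundary_pairing_tendsto(2)[OF bd C l(2) c[of 0]]]
  have L: "(\<lambda>k. (LINT z:Omega p|lborel. pdiff 1 (\<phi> k) z * tensor h \<eta> z) + (LINT z:Omega p|lborel. \<phi> k z * tensor h' \<eta> z))
      \<longlonglongrightarrow> (LINT z:Omega p|lborel. wderiv (Omega p) 1 u z * tensor h \<eta> z) + (LINT z:Omega p|lborel. u z * tensor h' \<eta> z)"
    by (intro tendsto_add H1_approx_pairing_tendsto bounded_Omega open_Omega uH C l(1) ct)
  have "(LINT z:Omega p|lborel. wderiv (Omega p) 1 u z * tensor h \<eta> z) + (LINT z:Omega p|lborel. u z * tensor h' \<eta> z)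
      = (LINT y:{profile p 0<..<height p}|lborel. g (period p, y) * (h (period p) * \<eta> y))
      - (LINT y:{profile p 0<..<height p}|lborel. g (0, y) * (h 0 * \<eta> y))"
    by (rule LIMSEQ_unique[OF L Lim_transform_eventually[OF R]])
      (rule always_eventually, rule allI, rule green_x_C1[OF weight C, symmetric])
  also have "(LINT y:{profile p 0<..<height p}|lborel. g (period p, y) * (h (period p) * \<eta> y))
      = (LINT y:{profile p 0<..<height p}|lborel. g (0, y) * (h 0 * \<eta> y))"
  proof (rule set_integral_cong_AE_measurable)
    show "set_borel_measurable lborel {profile p 0<..<height p} (\<lambda>y. g (period p, y) * (h (period p) * \<eta> y))"
      using bd by (intro set_integrable_measurable L2_mult_integrable c) (auto simp: boundary_L2_def profile_periodic)
    show "set_borel_measurable lborel {profile p 0<..<height p} (\<lambda>y. g (0, y) * (h 0 * \<eta> y))"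
      using bd by (intro set_integrable_measurable L2_mult_integrable c) (auto simp: boundary_L2_def)
    show "AE y in lborel. y \<in> {profile p 0<..<height p} \<longrightarrow>
        g (period p, y) * (h (period p) * \<eta> y) = g (0, y) * (h 0 * \<eta> y)"
      using gq by eventually_elim (simp add: qp[folded q_def, symmetric] mult_ac)
  qed
  finally show ?thesis by simp
qed

end

lemma bd_trace_has_trace: "u \<in> H1_qp p \<Longrightarrow> has_trace p u (bd_trace p u)"
  unfolding H1_qp_def bd_trace_def using someI_ex[of "has_trace p u"] by blast

text \<open>The constant sequence is the required approximation.\<close>

lemma smooth_has_trace:
  assumes "smooth \<phi>" shows "has_trace p \<phi> \<phi>"
proof -
  have c: "continuous_on UNIV \<phi>" by (rule C1_continuous[OF smooth_imp_C1[OF assms]])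
  have "boundary_L2 p \<phi>"
    unfolding boundary_L2_def
    by (intro conjI L2_continuous continuous_on_compose2[OF c] continuous_intros profile_cont subset_UNIV) auto
  moreover have "boundary_sqnorm p (\<lambda>z. \<phi> z - \<phi> z) = 0"
    by (simp add: boundary_sqnorm_def set_lebesgue_integral_def)
  ultimately show ?thesis
    unfolding has_trace_def using H1_norm_zero[OF bounded_Omega open_Omega] assms
    by (intro conjI exI[of _ "\<lambda>_. \<phi>"]) auto
qed

text \<open>By Green's formula the pairing of a trace with a smooth weight is determined by the function in
  the interior; the Fourier coefficients on the top side do not depend on the chosen trace.\<close>

lemma trace_pairing_unique:
  assumes "u \<in> H1 (Omega p)" "has_trace p u g1" "has_trace p u g2" "\<And>k. Ck1 k h"
  shows "(LINT x:{0<..<period p}|lborel. g1 (x, height p) * h x)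
     = (LINT x:{0<..<period p}|lborel. g2 (x, height p) * h x)"
proof -
  obtain \<psi> where \<psi>: "\<And>k. Ck1 k \<psi>" "\<And>y. y \<le> a \<Longrightarrow> \<psi> y = 0" "\<psi> (height p) = 1"
    using smooth_cutoff_exists[OF below_height] by auto
  obtain \<psi>' where \<psi>': "\<And>x. (\<psi> has_vector_derivative \<psi>' x) (at x)" "continuous_on UNIV \<psi>'"
    using Ck1_deriv_obtain[OF \<psi>(1)] by metis
  obtain h' where h': "\<And>x. (h has_vector_derivative h' x) (at x)" "continuous_on UNIV h'"
    using Ck1_deriv_obtain[OF assms(4)] by metis
  show ?thesis
    using green_y_trace[OF h' \<psi>' \<psi>(2) assms(1,2)] green_y_trace[OF h' \<psi>' \<psi>(2) assms(1,3)] \<psi>(3) by simp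
qed

end

section \<open>Quasi-periodic test fields\<close>

text \<open>The conjugate of the quasi-periodic wave \<open>exp (i \<alpha>\<^sub>n x)\<close>. Conjugates are carried by the weights
  throughout, because the test field enters the sesquilinear form conjugated.\<close>

definition cwave :: "grating \<Rightarrow> int \<Rightarrow> real \<Rightarrow> complex" where
  "cwave p n x = exp ((- \<i> * of_real (alphan p n)) * of_real x)"

lemma Ck1_cwave: "Ck1 k (cwave p n)"
  using Ck1_exp[of k "- \<i> * of_real (alphan p n)"] unfolding cwave_def[abs_def] .

lemma cwave_deriv: "(cwave p n has_vector_derivative (- \<i> * of_real (alphan p n)) * cwave p n x) (at x)"
  using exp_linear_deriv[of "- \<i> * of_real (alphan p n)" x] unfolding cwave_def[abs_def] .

lemma cont_cwave: "continuous_on UNIV (cwave p n)"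
  by (rule Ck1_continuous[OF Ck1_cwave])

lemma norm_cwave: "norm (cwave p n x) = 1"
  by (simp add: cwave_def)

lemma cnj_cwave: "exp (\<i> * of_real (alphan p n * x)) = cnj (cwave p n x)"
  by (simp add: cwave_def exp_cnj mult.assoc)

lemma fourier_coeff_cwave:
  "fourier_coeff p u n = 1 / of_real (period p) *
     (LINT x:{0<..<period p}|lborel. bd_trace p u (x, height p) * cwave p n x)"
  by (simp add: fourier_coeff_def cwave_def mult.assoc)

lemma set_integral_cnj: "(LINT x:A|M. cnj (f x)) = cnj (LINT x:A|M. f x)"
  unfolding set_lebesgue_integral_def
  by (simp flip: Bochner_Integration.integral_cnj)

lemma L2_cnj:
  assumes "L2 U f" shows "L2 U (\<lambda>z. cnj (f z))"
proof -
  have "(\<lambda>x. cnj (indicator U x *\<^sub>R f x)) \<in> borel_measurable lborel"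
    using assms unfolding L2_def set_borel_measurable_def
    by (intro borel_measurable_continuous_on[OF continuous_on_cnj[OF continuous_on_id]]) auto
  then show ?thesis using assms unfolding L2_def set_borel_measurable_def by simp
qed

text \<open>The weak derivative of a smooth test field is known only almost everywhere. Measurability of
  the chosen representative makes the exchange under the integral legitimate.\<close>

lemma pairing_swap_AE:
  assumes "L2 U f" "L2 U g" "set_integrable lborel U (\<lambda>z. f z * w z)"
    and ae: "AE z in lborel. z \<in> U \<longrightarrow> g z = w z"
  shows "set_integrable lborel U (\<lambda>z. f z * g z)"
    and "(LINT z:U|lborel. f z * g z) = (LINT z:U|lborel. f z * w z)"
proof -
  have "(\<lambda>z. (indicator U z *\<^sub>R f z) * (indicator U z *\<^sub>R g z)) \<in> borel_measurable lborel"
    using assms(1,2) unfolding L2_def set_borel_measurable_def by (intro borel_measurable_times) auto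
  also have "(\<lambda>z. (indicator U z *\<^sub>R f z) * (indicator U z *\<^sub>R g z)) = (\<lambda>z. indicator U z *\<^sub>R (f z * g z))"
    by (auto simp: fun_eq_iff indicator_def)
  finally have m: "set_borel_measurable lborel U (\<lambda>z. f z * g z)"
    unfolding set_borel_measurable_def .
  show "set_integrable lborel U (\<lambda>z. f z * g z)"
    by (rule set_integrable_bound[OF assms(3) m]) (use ae in \<open>auto elim: eventually_mono\<close>)
  show "(LINT z:U|lborel. f z * g z) = (LINT z:U|lborel. f z * w z)"
    by (rule set_integral_cong_AE_measurable[OF m set_integrable_measurable[OF assms(3)]])
      (use ae in \<open>auto elim: eventually_mono\<close>)
qed

context cell
begin

lemma cwave_period: "cwave p n (period p) * exp (\<i> * of_real (alpha p * period p)) = 1"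
proof -
  have "cwave p n (period p) * exp (\<i> * of_real (alpha p * period p))
      = exp (- \<i> * of_real (alphan p n) * of_real (period p) + \<i> * of_real (alpha p * period p))"
    by (simp only: cwave_def exp_add)
  also have "- \<i> * of_real (alphan p n) * of_real (period p) + \<i> * of_real (alpha p * period p)
      = of_real (2 * of_int (- n) * pi) * \<i>"
    using period_pos by (simp add: alphan_def field_simps)
  also have "exp \<dots> = 1" by (rule exp_integer_2pi) simp
  finally show ?thesis .
qed

lemma cwave_0 [simp]: "cwave p n 0 = 1"
  by (simp add: cwave_def)

lemma fourier_coeff_trace:
  assumes "u \<in> H1_qp p" "has_trace p u g"
  shows "of_real (period p) * fourier_coeff p u n = (LINT x:{0<..<period p}|lborel. g (x, height p) * cwave p n x)"
proof -
  have "u \<in> H1 (Omega p)" using assms(1) by (simp add: H1_qp_def)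
  from trace_pairing_unique[OF this bd_trace_has_trace[OF assms(1)] assms(2) Ck1_cwave] show ?thesis
    using period_pos by (simp add: fourier_coeff_cwave)
qed

lemma cwave_orthogonal:
  "(LINT x:{0<..<period p}|lborel. cnj (cwave p n x) * cwave p m x)
     = (if m = n then of_real (period p) else 0)"
proof -
  have eq: "cnj (cwave p n x) * cwave p m x = exp ((\<i> * of_real (alphan p n - alphan p m)) * of_real x)" for x
    unfolding cnj_cwave[symmetric] unfolding cwave_def exp_add[symmetric] by (simp add: algebra_simps)
  define c where "c = \<i> * of_real (alphan p n - alphan p m)"
  have diff: "alphan p n - alphan p m = 2 * pi * of_int (n - m) / period p"
    by (simp add: alphan_def diff_divide_distrib algebra_simps)
  have "(LINT x:{0<..<period p}|lborel. exp (c * of_real x)) = integral {0..period p} (\<lambda>x. exp (c * of_real x))"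
    by (intro set_integral_interval_eq continuous_intros)
  also have "\<dots> = (if m = n then of_real (period p) else 0)"
  proof (cases "m = n")
    case True
    then show ?thesis using period_pos by (simp add: c_def scaleR_conv_of_real)
  next
    case False
    then have c0: "c \<noteq> 0" using period_pos by (simp add: c_def diff)
    have "((\<lambda>x. exp (c * of_real x)) has_integral (exp (c * of_real (period p)) / c - exp (c * of_real 0) / c)) {0..period p}"
    proof (rule fundamental_theorem_of_calculus)
      fix x
      have "((\<lambda>x. (1/c) * exp (c * of_real x)) has_vector_derivative (1/c) * (c * exp (c * of_real x))) (at x within {0..period p})"
        by (rule has_vector_derivative_at_within[OF has_vector_derivative_mult_right[OF exp_linear_deriv]])
      then show "((\<lambda>x. exp (c * of_real x) / c) has_vector_derivative exp (c * of_real x)) (at x within {0..period p})"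
        using c0 by (simp add: field_simps)
    qed (use period_pos in simp)
    moreover have "exp (c * of_real (period p)) = 1"
    proof -
      have "c * of_real (period p) = of_real (2 * of_int (n - m) * pi) * \<i>"
        unfolding c_def diff using period_pos by (simp add: field_simps)
      then show ?thesis using exp_integer_2pi[of "of_int (n - m)"] by simp
    qed
    ultimately show ?thesis using False by (simp add: integral_unique)
  qed
  finally show ?thesis unfolding eq c_def .
qed

abbreviation test_comp :: "int \<Rightarrow> (real \<Rightarrow> complex) \<Rightarrow> real \<times> real \<Rightarrow> complex" where
  "test_comp n W \<equiv> (\<lambda>z. cnj (tensor (cwave p n) W z))"

context
  fixes W :: "real \<Rightarrow> complex" and n :: int
  assumes W: "\<And>k. Ck1 k W" and W0: "\<And>y. y \<le> a \<Longrightarrow> W y = 0"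
begin

lemma smooth_test: "smooth (test_comp n W)"
  using smooth_tensor[OF Ck1_cnj[OF Ck1_cwave] Ck1_cnj[OF W], of p n] by simp

lemma test_H1_qp: "(test_comp n W) \<in> H1_qp p"
  unfolding H1_qp_def
proof (intro CollectI conjI exI)
  show "(test_comp n W) \<in> H1 (Omega p)"
    by (rule C1_H1[OF smooth_imp_C1[OF smooth_test] bounded_Omega open_Omega])
  show "has_trace p (test_comp n W) (test_comp n W)"
    by (rule smooth_has_trace[OF smooth_test])
  have "cnj (cwave p n (period p)) = exp (\<i> * of_real (alpha p * period p))"
  proof -
    define q where "q = exp (\<i> * of_real (alpha p * period p))"
    have "cnj q * q = 1" unfolding q_def exp_cnj by (simp flip: exp_add)
    moreover have "cnj (cwave p n (period p)) * cnj q = 1"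
      using arg_cong[OF cwave_period[of n], of cnj] by (simp add: q_def)
    ultimately have "cnj (cwave p n (period p)) = q"
      by (metis mult.assoc mult.commute mult.right_neutral)
    then show ?thesis by (simp add: q_def)
  qed
  then show "AE y in lborel. y \<in> {profile p 0<..<height p} \<longrightarrow>
      cnj (tensor (cwave p n) W (period p, y))
      = cnj (tensor (cwave p n) W (0, y)) * exp (\<i> * of_real (alpha p * period p))"
    by (simp add: mult.commute)
qed

lemma test_H1_S_qp: "(test_comp n W) \<in> H1_S_qp p"
  unfolding H1_S_qp_def eq_on_S_def
  using test_H1_qp smooth_has_trace[OF smooth_test]
  by (intro CollectI conjI exI[of _ "\<lambda>z. cnj (tensor (cwave p n) W z)"])
    (auto intro!: AE_I2 W0 less_imp_le profile_below)

lemma fourier_coeff_test: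
  "of_real (period p) * fourier_coeff p (test_comp n W) m
     = (if m = n then of_real (period p) * cnj (W (height p)) else 0)"
proof -
  have "of_real (period p) * fourier_coeff p (test_comp n W) m
      = (LINT x:{0<..<period p}|lborel. cnj (W (height p)) * (cnj (cwave p n x) * cwave p m x))"
    by (subst fourier_coeff_trace[OF test_H1_qp smooth_has_trace[OF smooth_test]]) (simp add: mult_ac)
  then show ?thesis by (simp add: cwave_orthogonal)
qed

lemma test_L2_wderiv: "L2 (Omega p) (wderiv (Omega p) j (test_comp n W))"
  by (rule wderiv_props(1)[OF C1_H1[OF smooth_imp_C1[OF smooth_test] bounded_Omega open_Omega]])

lemma AE_wderiv_test:
  assumes W': "\<And>y. (W has_vector_derivative W' y) (at y)"
  shows "AE z in lborel. z \<in> Omega p \<longrightarrow> cnj (wderiv (Omega p) 1 (test_comp n W) z)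
       = (- \<i> * of_real (alphan p n)) * tensor (cwave p n) W z"
    and "AE z in lborel. z \<in> Omega p \<longrightarrow> cnj (wderiv (Omega p) 2 (test_comp n W) z)
       = tensor (cwave p n) W' z"
proof -
  have d: "pdiff 1 (test_comp n W) = (\<lambda>z. cnj ((- \<i> * of_real (alphan p n)) * tensor (cwave p n) W z))"
    "pdiff 2 (test_comp n W) = (\<lambda>z. cnj (tensor (cwave p n) W' z))"
    using pdiff_tensor[OF has_vector_derivative_cnj[OF cwave_deriv] has_vector_derivative_cnj[OF W'], of p n]
    by (simp_all add: fun_eq_iff)
  note ae = AE_wderiv_C1[OF smooth_imp_C1[OF smooth_test] bounded_Omega open_Omega]
  show "AE z in lborel. z \<in> Omega p \<longrightarrow> cnj (wderiv (Omega p) 1 (test_comp n W) z)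
       = (- \<i> * of_real (alphan p n)) * tensor (cwave p n) W z"
    using ae[of 1] unfolding d by eventually_elim (intro impI, drule (1) mp, simp only: complex_cnj_cnj)
  show "AE z in lborel. z \<in> Omega p \<longrightarrow> cnj (wderiv (Omega p) 2 (test_comp n W) z)
       = tensor (cwave p n) W' z"
    using ae[of 2] unfolding d by eventually_elim (intro impI, drule (1) mp, simp only: complex_cnj_cnj)
qed

end

lemma top_integral_dtn_mode:
  assumes v: "v \<in> H1_qp_vec p"
  shows "top_integral p (dtn_mode p u n) v = of_real (period p) *
     (\<Sum>i\<in>UNIV. (dtn_matrix p n *v fourier_coeff_vec p u n) $ i * cnj (fourier_coeff p (\<lambda>z. v z $ i) n))"
    and "set_integrable lborel {0<..<period p} (\<lambda>x. cdot (dtn_mode p u n x) (\<chi> i. bd_trace p (\<lambda>z. v z $ i) (x, height p)))"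
proof -
  define X where "X = dtn_matrix p n *v fourier_coeff_vec p u n"
  define g where "g = (\<lambda>i x. bd_trace p (\<lambda>z. v z $ i) (x, height p))"
  have vi: "(\<lambda>z. v z $ i) \<in> H1_qp p" for i using v by (simp add: H1_qp_vec_def)
  have L: "L2 {0<..<period p} (g i)" for i
    using bd_trace_has_trace[OF vi[of i]] by (simp add: has_trace_def boundary_L2_def g_def)
  have eq: "cdot (dtn_mode p u n x) (\<chi> i. bd_trace p (\<lambda>z. v z $ i) (x, height p))
      = (\<Sum>i\<in>UNIV. X $ i * cnj (g i x * cwave p n x))" for x
    unfolding cdot_def dtn_mode_def cnj_cwave by (simp add: X_def g_def mult_ac)
  have "set_integrable lborel {0<..<period p} (\<lambda>x. g i x * cwave p n x)" for i
    by (rule L2_mult_integrable[OF L _ _ cont_cwave]) auto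
  then have int: "set_integrable lborel {0<..<period p} (\<lambda>x. X $ i * cnj (g i x * cwave p n x))" for i
    unfolding set_integrable_def
    using integrable_mult_right[of "X $ i"] integrable_cnj[of lborel "\<lambda>x. indicator {0<..<period p} x *\<^sub>R (g i x * cwave p n x)" for i]
    by (simp add: mult_ac scaleR_conv_of_real)
  have "top_integral p (dtn_mode p u n) v = (\<Sum>i\<in>UNIV. LINT x:{0<..<period p}|lborel. X $ i * cnj (g i x * cwave p n x))"
    unfolding top_integral_def eq using int by (simp add: sum_2 set_integral_add(2))
  also have "\<dots> = (\<Sum>i\<in>UNIV. X $ i * cnj (of_real (period p) * fourier_coeff p (\<lambda>z. v z $ i) n))"
    unfolding set_integral_mult_right set_integral_cnj using period_pos
    by (simp add: g_def fourier_coeff_cwave)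
  also have "\<dots> = of_real (period p) * (\<Sum>i\<in>UNIV. X $ i * cnj (fourier_coeff p (\<lambda>z. v z $ i) n))"
    by (simp add: sum_distrib_left mult_ac)
  finally show "top_integral p (dtn_mode p u n) v = of_real (period p) *
     (\<Sum>i\<in>UNIV. (dtn_matrix p n *v fourier_coeff_vec p u n) $ i * cnj (fourier_coeff p (\<lambda>z. v z $ i) n))"
    by (simp add: X_def)
  show "set_integrable lborel {0<..<period p} (\<lambda>x. cdot (dtn_mode p u n x) (\<chi> i. bd_trace p (\<lambda>z. v z $ i) (x, height p)))"
    unfolding eq using int by (simp add: sum_2 set_integral_add(1))
qed

text \<open>Up to the factor \<open>period p\<close>, this pairs the \<open>n\<close>-th Fourier coefficient of \<open>f(\<cdot>, y)\<close> with \<open>\<eta>(y)\<close>. It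
  is written as an integral over the cell, where Green's formulas apply directly.\<close>

definition mode_int :: "int \<Rightarrow> (real \<times> real \<Rightarrow> complex) \<Rightarrow> (real \<Rightarrow> complex) \<Rightarrow> complex" where
  "mode_int n f \<eta> = (LINT z:Omega p|lborel. f z * tensor (cwave p n) \<eta> z)"

lemma mode_int_integrable:
  assumes "L2 (Omega p) f" "continuous_on UNIV \<eta>"
  shows "set_integrable lborel (Omega p) (\<lambda>z. f z * tensor (cwave p n) \<eta> z)"
  by (intro L2_mult_integrable assms bounded_Omega borel_Omega continuous_on_mult
      continuous_on_compose2[OF cont_cwave] continuous_on_compose2[OF assms(2)] continuous_intros subset_UNIV)

lemma mode_int_dx:
  assumes u: "u \<in> H1_qp p" and \<eta>: "\<And>k. Ck1 k \<eta>" "\<And>y. y \<le> a \<Longrightarrow> \<eta> y = 0"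
  shows "mode_int n (wderiv (Omega p) 1 u) \<eta> = \<i> * of_real (alphan p n) * mode_int n u \<eta>"
proof -
  obtain \<eta>' where \<eta>': "\<And>x. (\<eta> has_vector_derivative \<eta>' x) (at x)" "continuous_on UNIV \<eta>'"
    using Ck1_deriv_obtain[OF \<eta>(1)] by metis
  have "continuous_on UNIV (\<lambda>x. - \<i> * of_real (alphan p n) * cwave p n x)"
    by (intro continuous_intros cont_cwave)
  from green_x_quasiperiodic[OF cwave_deriv this \<eta>' \<eta>(2) u] cwave_period[of n]
  have "mode_int n (wderiv (Omega p) 1 u) \<eta> + (LINT z:Omega p|lborel. (- \<i> * of_real (alphan p n)) * (u z * tensor (cwave p n) \<eta> z)) = 0"
    by (simp add: mode_int_def mult_ac)
  then have "mode_int n (wderiv (Omega p) 1 u) \<eta> + (- \<i> * of_real (alphan p n)) * mode_int n u \<eta> = 0"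
    unfolding set_integral_mult_right mode_int_def .
  then show ?thesis by (simp add: add_eq_0_iff)
qed

lemma mode_int_dy:
  assumes u: "u \<in> H1_qp p" and \<eta>: "\<And>k. Ck1 k \<eta>" "\<And>y. y \<le> a \<Longrightarrow> \<eta> y = 0"
    and \<eta>': "\<And>x. (\<eta> has_vector_derivative \<eta>' x) (at x)" "continuous_on UNIV \<eta>'"
  shows "mode_int n (wderiv (Omega p) 2 u) \<eta>
     = \<eta> (height p) * (of_real (period p) * fourier_coeff p u n) - mode_int n u \<eta>'"
proof -
  have c: "continuous_on UNIV (\<lambda>x. - \<i> * of_real (alphan p n) * cwave p n x)"
    by (intro continuous_intros cont_cwave)
  have "u \<in> H1 (Omega p)" using u by (simp add: H1_qp_def)
  from green_y_trace[OF cwave_deriv c \<eta>' \<eta>(2) this bd_trace_has_trace[OF u]]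
  show ?thesis
    unfolding fourier_coeff_trace[OF u bd_trace_has_trace[OF u]] mode_int_def by (simp add: algebra_simps)
qed

lemma frob_sum: "frob A B = (\<Sum>i\<in>UNIV. \<Sum>j\<in>UNIV. A $ i $ j * B $ i $ j)"
  by (simp add: frob_def trace_def matrix_matrix_mult_def transpose_def)

definition test_field :: "int \<Rightarrow> (2 \<Rightarrow> real \<Rightarrow> complex) \<Rightarrow> real \<times> real \<Rightarrow> complex^2" where
  "test_field n W z = (\<chi> i. cnj (tensor (cwave p n) (W i) z))"

text \<open>All derivatives of \<open>u\<close> are moved to the test field. The coefficients of \<open>u\<close> on the top boundary
  appear both through Green's formula in \<open>y\<close> and through the Dirichlet-to-Neumann operator. The
  latter contributes one mode only, since the test field is orthogonal to all the others.\<close>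

lemma sesq_form_test_field:
  fixes n :: int and u :: "real \<times> real \<Rightarrow> complex^2" and W W' W'' :: "2 \<Rightarrow> real \<Rightarrow> complex"
  assumes u: "u \<in> H1_qp_vec p"
    and W: "\<And>i k. Ck1 k (W i)" "\<And>i y. y \<le> a \<Longrightarrow> W i y = 0"
    and W': "\<And>i y. (W i has_vector_derivative W' i y) (at y)" "\<And>i k. Ck1 k (W' i)"
    and W'': "\<And>i y. (W' i has_vector_derivative W'' i y) (at y)" "\<And>i. continuous_on UNIV (W'' i)"
  defines "c \<equiv> \<i> * of_real (alphan p n)" and "J \<equiv> (\<lambda>i. mode_int n (\<lambda>z. u z $ i))"
    and "U \<equiv> (\<lambda>i. of_real (period p) * fourier_coeff p (\<lambda>z. u z $ i) n)"
    and "m \<equiv> of_real (lame_mu p)" and "l \<equiv> of_real (lame_lambda p + lame_mu p)"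
    and "b \<equiv> height p"
  shows "sesq_form p u (test_field n W) =
      m * (\<Sum>i\<in>UNIV. - (c\<^sup>2) * J i (W i) + W' i b * U i - J i (W'' i))
    + l * (- (c\<^sup>2) * J 1 (W 1) - c * (W 1 b * U 2 - J 2 (W' 1)) + c * J 1 (W' 2) + W' 2 b * U 2 - J 2 (W'' 2))
    - of_real ((freq p)\<^sup>2) * (\<Sum>i\<in>UNIV. J i (W i))
    - (\<Sum>i\<in>UNIV. \<Sum>j\<in>UNIV. dtn_matrix p n $ i $ j * U j * W i b)"
proof -
  define \<Omega> where "\<Omega> = Omega p"
  define u' where "u' = (\<lambda>i z. u z $ i)"
  define D where "D = (\<lambda>j i. wderiv \<Omega> j (u' i))"
  define v where "v = (\<lambda>i z. cnj (tensor (cwave p n) (W i) z))"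
  define E where "E = (\<lambda>j i. wderiv \<Omega> j (v i))"
  have ui: "u' i \<in> H1_qp p" for i using u by (simp add: H1_qp_vec_def u'_def)
  then have uH: "u' i \<in> H1 \<Omega>" for i by (simp add: H1_qp_def \<Omega>_def)
  have Lu: "L2 \<Omega> (u' i)" for i using uH[of i] by (simp add: H1_def)
  have LD: "L2 \<Omega> (D j i)" for i j unfolding D_def by (rule wderiv_props(1)[OF uH])
  have LE: "L2 \<Omega> (\<lambda>z. cnj (E j i z))" for i j
    unfolding E_def v_def \<Omega>_def by (rule L2_cnj[OF test_L2_wderiv[OF W]])
  have cW: "continuous_on UNIV (W i)" "continuous_on UNIV (W' i)" for i
    using W(1) W'(2) Ck1_continuous by blast+
  have W'0: "W' i y = 0" if "y \<le> a" for i y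
    by (rule derivative_vanishes_below[OF W'(1) cW(2) W(2) that])
  have cc: "- c = - \<i> * of_real (alphan p n)" by (simp add: c_def)

  have p1: "set_integrable lborel \<Omega> (\<lambda>z. D k i z * cnj (E 1 j z))"
      "(LINT z:\<Omega>|lborel. D k i z * cnj (E 1 j z)) = - c * mode_int n (D k i) (W j)" for k i j
  proof -
    have int: "set_integrable lborel \<Omega> (\<lambda>z. D k i z * (- c * tensor (cwave p n) (W j) z))"
      using set_integrable_mult_right[of "- c", OF mode_int_integrable[OF LD[unfolded \<Omega>_def, of k i] cW(1)[of j], where n = n]]
      by (simp add: \<Omega>_def mult_ac)
    have ae: "AE z in lborel. z \<in> \<Omega> \<longrightarrow> cnj (E 1 j z) = - c * tensor (cwave p n) (W j) z"
      unfolding E_def v_def \<Omega>_def cc by (rule AE_wderiv_test(1)[OF W W'(1)])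
    show "set_integrable lborel \<Omega> (\<lambda>z. D k i z * cnj (E 1 j z))"
      by (rule pairing_swap_AE(1)[OF LD LE int ae])
    have "(LINT z:\<Omega>|lborel. D k i z * cnj (E 1 j z)) = (LINT z:\<Omega>|lborel. - c * (D k i z * tensor (cwave p n) (W j) z))"
      by (subst pairing_swap_AE(2)[OF LD LE int ae]) (simp add: mult_ac)
    then show "(LINT z:\<Omega>|lborel. D k i z * cnj (E 1 j z)) = - c * mode_int n (D k i) (W j)"
      unfolding set_integral_mult_right by (simp add: mode_int_def \<Omega>_def)
  qed
  have p2: "set_integrable lborel \<Omega> (\<lambda>z. D k i z * cnj (E 2 j z))"
      "(LINT z:\<Omega>|lborel. D k i z * cnj (E 2 j z)) = mode_int n (D k i) (W' j)" for k i j
  proof -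
    have int: "set_integrable lborel \<Omega> (\<lambda>z. D k i z * (tensor (cwave p n) (W' j) z))"
      using mode_int_integrable[OF LD[unfolded \<Omega>_def, of k i] cW(2)[of j], where n = n] by (simp add: \<Omega>_def)
    have ae: "AE z in lborel. z \<in> \<Omega> \<longrightarrow> cnj (E 2 j z) = tensor (cwave p n) (W' j) z"
      unfolding E_def v_def \<Omega>_def by (rule AE_wderiv_test(2)[OF W W'(1)])
    show "set_integrable lborel \<Omega> (\<lambda>z. D k i z * cnj (E 2 j z))"
      by (rule pairing_swap_AE(1)[OF LD LE int ae])
    show "(LINT z:\<Omega>|lborel. D k i z * cnj (E 2 j z)) = mode_int n (D k i) (W' j)"
      by (subst pairing_swap_AE(2)[OF LD LE int ae]) (simp add: mode_int_def \<Omega>_def)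
  qed
  have J: "J i = mode_int n (u' i)" for i by (simp add: J_def u'_def)
  have dx: "mode_int n (D 1 i) \<eta> = c * J i \<eta>" if "\<And>k. Ck1 k \<eta>" "\<And>y. y \<le> a \<Longrightarrow> \<eta> y = 0" for \<eta> i
    unfolding D_def \<Omega>_def c_def J by (rule mode_int_dx[OF ui that])
  have dy: "mode_int n (D 2 i) \<eta> = \<eta> b * U i - J i \<eta>'"
    if "\<And>k. Ck1 k \<eta>" "\<And>y. y \<le> a \<Longrightarrow> \<eta> y = 0" "\<And>x. (\<eta> has_vector_derivative \<eta>' x) (at x)" "continuous_on UNIV \<eta>'" for \<eta> \<eta>' i
    unfolding D_def \<Omega>_def b_def U_def J using mode_int_dy[OF ui that] by (simp add: u'_def)
  have dW1: "mode_int n (D 1 i) (W j) = c * J i (W j)" for i j by (rule dx[OF W])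
  have dW2: "mode_int n (D 1 i) (W' j) = c * J i (W' j)" for i j by (rule dx[OF W'(2) W'0])
  have dW3: "mode_int n (D 2 i) (W j) = W j b * U i - J i (W' j)" for i j by (rule dy[OF W W'(1) cW(2)])
  have dW4: "mode_int n (D 2 i) (W' j) = W' j b * U i - J i (W'' j)" for i j by (rule dy[OF W'(2) W'0 W''])
  note dW = dW1 dW2 dW3 dW4

  have "(LINT z:\<Omega>|lborel. frob (wgrad \<Omega> u z) (mat_cnj (wgrad \<Omega> (test_field n W) z)))
      = (LINT z:\<Omega>|lborel. (\<Sum>i\<in>UNIV. D 1 i z * cnj (E 1 i z) + D 2 i z * cnj (E 2 i z)))"
    by (simp add: frob_sum sum_2 wgrad_def mat_cnj_def D_def E_def u'_def v_def test_field_def)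
  also have "\<dots> = (\<Sum>i\<in>UNIV. - c * mode_int n (D 1 i) (W i) + mode_int n (D 2 i) (W' i))"
    by (simp add: sum_2 set_integral_add p1 p2)
  also have "\<dots> = (\<Sum>i\<in>UNIV. - (c\<^sup>2) * J i (W i) + W' i b * U i - J i (W'' i))"
    unfolding dW by (simp add: power2_eq_square algebra_simps)
  finally have t1: "(LINT z:\<Omega>|lborel. frob (wgrad \<Omega> u z) (mat_cnj (wgrad \<Omega> (test_field n W) z)))
      = (\<Sum>i\<in>UNIV. - (c\<^sup>2) * J i (W i) + W' i b * U i - J i (W'' i))" .

  have "(LINT z:\<Omega>|lborel. wdiv \<Omega> u z * cnj (wdiv \<Omega> (test_field n W) z))
      = (LINT z:\<Omega>|lborel. D 1 1 z * cnj (E 1 1 z) + D 2 2 z * cnj (E 1 1 z)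
           + (D 1 1 z * cnj (E 2 2 z) + D 2 2 z * cnj (E 2 2 z)))"
    by (simp add: wdiv_def sum_2 D_def E_def u'_def v_def test_field_def algebra_simps)
  also have "\<dots> = - c * mode_int n (D 1 1) (W 1) - c * mode_int n (D 2 2) (W 1)
      + (mode_int n (D 1 1) (W' 2) + mode_int n (D 2 2) (W' 2))"
    by (simp add: set_integral_add p1 p2)
  also have "\<dots> = - (c\<^sup>2) * J 1 (W 1) - c * (W 1 b * U 2 - J 2 (W' 1)) + c * J 1 (W' 2) + W' 2 b * U 2 - J 2 (W'' 2)"
    unfolding dW by (simp add: power2_eq_square algebra_simps)
  finally have t2: "(LINT z:\<Omega>|lborel. wdiv \<Omega> u z * cnj (wdiv \<Omega> (test_field n W) z))
      = - (c\<^sup>2) * J 1 (W 1) - c * (W 1 b * U 2 - J 2 (W' 1)) + c * J 1 (W' 2) + W' 2 b * U 2 - J 2 (W'' 2)" .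

  have t3: "(LINT z:\<Omega>|lborel. cdot (u z) (test_field n W z)) = (\<Sum>i\<in>UNIV. J i (W i))"
    using mode_int_integrable[OF Lu[unfolded \<Omega>_def] cW(1), where n = n]
    by (simp add: cdot_def test_field_def sum_2 set_integral_add mode_int_def J_def u'_def \<Omega>_def)

  have vqp: "test_field n W \<in> H1_qp_vec p"
    using test_H1_qp[OF W] by (simp add: H1_qp_vec_def test_field_def)
  have fc: "of_real (period p) * fourier_coeff p (\<lambda>z. test_field n W z $ i) k
      = (if k = n then of_real (period p) * cnj (W i b) else 0)" for i k
    using fourier_coeff_test[OF W, where n = n and m = k] by (simp add: test_field_def b_def)
  have per: "complex_of_real (period p) \<noteq> 0" using period_pos by simp
  have fc': "fourier_coeff p (\<lambda>z. test_field n W z $ i) k = (if k = n then cnj (W i b) else 0)" for i k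
    using fc[of i k] per by (simp split: if_splits)
  have "dtn_pairing p u (test_field n W) = (\<Sum>\<^sub>\<infinity>k\<in>{n}. top_integral p (dtn_mode p u k) (test_field n W))"
    unfolding dtn_pairing_def
    by (rule infsum_cong_neutral) (auto simp: top_integral_dtn_mode(1)[OF vqp] fc')
  also have "\<dots> = top_integral p (dtn_mode p u n) (test_field n W)" by simp
  also have "\<dots> = (\<Sum>i\<in>UNIV. \<Sum>j\<in>UNIV. dtn_matrix p n $ i $ j * U j * W i b)"
    unfolding top_integral_dtn_mode(1)[OF vqp] fc'
    by (simp add: matrix_vector_mult_def sum_2 fourier_coeff_vec_def U_def algebra_simps)
  finally have t4: "dtn_pairing p u (test_field n W) = (\<Sum>i\<in>UNIV. \<Sum>j\<in>UNIV. dtn_matrix p n $ i $ j * U j * W i b)" .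
  show ?thesis
    unfolding sesq_form_def t1[unfolded \<Omega>_def] t2[unfolded \<Omega>_def] t3[unfolded \<Omega>_def] t4 m_def l_def by simp
qed

end

section \<open>Evanescent modes\<close>

lemma vertical_wavenumber_evanescent:
  assumes "\<kappa> < \<bar>\<alpha>\<bar>"
  shows "vertical_wavenumber \<kappa> \<alpha> = \<i> * of_real (sqrt (\<alpha>\<^sup>2 - \<kappa>\<^sup>2))"
  using assms by (simp add: vertical_wavenumber_def)

text \<open>For evanescent modes \<open>\<beta>\<^sub>1 = i decay1\<close>, \<open>\<beta>\<^sub>2 = i decay2\<close>, and \<open>\<chi> = chi_re\<close> is real.\<close>

definition decay1 :: "grating \<Rightarrow> int \<Rightarrow> real" where
  "decay1 p n = sqrt ((alphan p n)\<^sup>2 - (kappa1 p)\<^sup>2)"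

definition decay2 :: "grating \<Rightarrow> int \<Rightarrow> real" where
  "decay2 p n = sqrt ((alphan p n)\<^sup>2 - (kappa2 p)\<^sup>2)"

definition chi_re :: "grating \<Rightarrow> int \<Rightarrow> real" where
  "chi_re p n = (alphan p n)\<^sup>2 - decay1 p n * decay2 p n"

locale elastic =
  fixes p :: grating
  assumes period0: "0 < period p" and freq0: "0 < freq p" and mu0: "0 < lame_mu p"
    and lm0: "0 < lame_lambda p + lame_mu p"
begin

lemma kappa_sq: "(lame_lambda p + 2 * lame_mu p) * (kappa1 p)\<^sup>2 = (freq p)\<^sup>2" "lame_mu p * (kappa2 p)\<^sup>2 = (freq p)\<^sup>2"
  using mu0 lm0 by (simp_all add: kappa1_def kappa2_def power_divide)

lemma kappa_pos: "0 < kappa1 p" "0 < kappa2 p"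
  using freq0 mu0 lm0 by (simp_all add: kappa1_def kappa2_def)

lemma kappa_less: "kappa1 p < kappa2 p"
  unfolding kappa1_def kappa2_def using freq0 mu0 lm0
  by (intro divide_strict_left_mono) (auto intro!: mult_pos_pos)

context
  fixes n :: int
  assumes ev: "kappa2 p < \<bar>alphan p n\<bar>"
begin

lemma sq_less: "(kappa2 p)\<^sup>2 < (alphan p n)\<^sup>2" "(kappa1 p)\<^sup>2 < (kappa2 p)\<^sup>2"
  using power_strict_mono[OF ev, of 2] power_strict_mono[OF kappa_less, of 2] kappa_pos by simp_all

lemma decay_sq: "(decay1 p n)\<^sup>2 = (alphan p n)\<^sup>2 - (kappa1 p)\<^sup>2" "(decay2 p n)\<^sup>2 = (alphan p n)\<^sup>2 - (kappa2 p)\<^sup>2"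
  using sq_less by (simp_all add: decay1_def decay2_def)

lemma decay_pos: "0 < decay2 p n" "decay2 p n < decay1 p n"
  using sq_less by (simp_all add: decay1_def decay2_def)

lemma decay_le: "decay1 p n \<le> \<bar>alphan p n\<bar>" "decay2 p n \<le> \<bar>alphan p n\<bar>"
  by (simp_all add: decay1_def decay2_def real_sqrt_le_iff flip: real_sqrt_abs)

lemma beta_decay: "beta1 p n = \<i> * of_real (decay1 p n)" "beta2 p n = \<i> * of_real (decay2 p n)"
  using ev kappa_less by (auto simp: beta1_def beta2_def decay1_def decay2_def intro!: vertical_wavenumber_evanescent)

lemma chi_eq: "chi p n = of_real (chi_re p n)"
proof -
  have "beta1 p n * beta2 p n = (\<i> * \<i>) * of_real (decay1 p n * decay2 p n)"
    by (simp only: beta_decay of_real_mult mult_ac)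
  then show ?thesis by (simp add: chi_def chi_re_def)
qed

text \<open>The difference \<open>\<alpha>\<^sup>2 - \<gamma>\<^sub>1 \<gamma>\<^sub>2\<close> is at least the mean of \<open>\<kappa>\<^sub>1\<^sup>2\<close> and \<open>\<kappa>\<^sub>2\<^sup>2\<close>, by the inequality
  of arithmetic and geometric means.\<close>

lemma chi_lower: "(kappa2 p)\<^sup>2 / 2 \<le> chi_re p n"
proof -
  have "2 * (decay1 p n * decay2 p n) \<le> (decay1 p n)\<^sup>2 + (decay2 p n)\<^sup>2"
    using sum_squares_bound[of "decay1 p n" "decay2 p n"] by simp
  then show ?thesis using zero_le_power2[of "kappa1 p"] unfolding decay_sq chi_re_def by linarith
qed

lemma chi_pos: "0 < chi_re p n"
  using chi_lower zero_less_power[OF kappa_pos(2), of 2] by linarith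

lemma dtn_entries:
  "dtn_matrix p n $ 1 $ 1 = - of_real ((freq p)\<^sup>2 * decay1 p n / chi_re p n)"
  "dtn_matrix p n $ 1 $ 2 = \<i> * of_real (lame_mu p * alphan p n - (freq p)\<^sup>2 * alphan p n / chi_re p n)"
  "dtn_matrix p n $ 2 $ 1 = - \<i> * of_real (lame_mu p * alphan p n - (freq p)\<^sup>2 * alphan p n / chi_re p n)"
  "dtn_matrix p n $ 2 $ 2 = - of_real ((freq p)\<^sup>2 * decay2 p n / chi_re p n)"
  using chi_pos by (simp_all add: dtn_matrix_def Let_def beta_decay chi_eq field_simps)

text \<open>Linear growth in \<open>\<alpha>\<^sub>n\<close>, as for an operator of order 1.\<close>

lemma norm_dtn_entry:
  "norm (dtn_matrix p n $ i $ j) \<le> (lame_mu p + (freq p)\<^sup>2 / ((kappa2 p)\<^sup>2 / 2)) * \<bar>alphan p n\<bar>"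
proof -
  define w where "w = (freq p)\<^sup>2 / ((kappa2 p)\<^sup>2 / 2)"
  have w0: "0 \<le> w" by (simp add: w_def)
  have wle: "(freq p)\<^sup>2 / chi_re p n \<le> w"
    unfolding w_def using chi_lower chi_pos kappa_pos by (intro divide_left_mono) auto
  have 1: "\<bar>(freq p)\<^sup>2 * t / chi_re p n\<bar> \<le> w * \<bar>alphan p n\<bar>" if "\<bar>t\<bar> \<le> \<bar>alphan p n\<bar>" for t
  proof -
    have "\<bar>(freq p)\<^sup>2 * t / chi_re p n\<bar> = (freq p)\<^sup>2 / chi_re p n * \<bar>t\<bar>"
      using chi_pos by (simp add: abs_mult)
    also have "\<dots> \<le> w * \<bar>alphan p n\<bar>"
      by (rule mult_mono[OF wle that w0 abs_ge_zero])
    finally show ?thesis .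
  qed
  have m: "0 \<le> lame_mu p * \<bar>alphan p n\<bar>" using mu0 by simp
  have "\<bar>lame_mu p * alphan p n\<bar> = lame_mu p * \<bar>alphan p n\<bar>" using mu0 by (simp add: abs_mult)
  then have 2: "\<bar>lame_mu p * alphan p n - (freq p)\<^sup>2 * alphan p n / chi_re p n\<bar> \<le> lame_mu p * \<bar>alphan p n\<bar> + w * \<bar>alphan p n\<bar>"
    using 1[of "alphan p n"] by linarith
  have g: "\<bar>decay1 p n\<bar> \<le> \<bar>alphan p n\<bar>" "\<bar>decay2 p n\<bar> \<le> \<bar>alphan p n\<bar>"
    using decay_le decay_pos by auto
  have e: "i = 1 \<or> i = 2" "j = 1 \<or> j = 2" using exhaust_2 by auto
  have "norm (dtn_matrix p n $ i $ j) \<le> lame_mu p * \<bar>alphan p n\<bar> + w * \<bar>alphan p n\<bar>"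
    using e 1[OF g(1)] 1[OF g(2)] 2 m
    by (elim disjE; simp only: dtn_entries norm_mult norm_minus_cancel norm_of_real norm_ii; linarith)
  then show ?thesis by (simp add: w_def distrib_right)
qed

end

end

text \<open>The conjugated vectors of a compressional mode \<open>(i\<alpha>, -\<gamma>\<^sub>1) exp (\<gamma>\<^sub>1 (y-b))\<close> and of a shear mode
  \<open>(\<gamma>\<^sub>2, i\<alpha>) exp (\<gamma>\<^sub>2 (y-b))\<close>, with amplitudes \<open>s\<close> and \<open>t\<close>, solve the Navier equation. Here \<open>k1, k2\<close> are
  the squared wave numbers, \<open>l = \<lambda> + \<mu>\<close>, \<open>om = \<omega>\<^sup>2\<close>, and \<open>E1, E2\<close> are the values of the exponentials.\<close>

lemma adjoint_modes_solve:
  fixes I al g1 g2 k1 k2 m l om s t E1 E2 :: complex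
  assumes "I * I = - 1" "g1 * g1 = al * al - k1" "g2 * g2 = al * al - k2"
    and "(l + m) * k1 = om" "m * k2 = om"
  shows "(m * (al * al) + l * (al * al) - om) * (s * (I * al) * E1 + t * g2 * E2)
      + (- m * (s * (I * al) * g1 * g1 * E1 + t * g2 * g2 * g2 * E2)
         + l * (I * al) * (- s * g1 * g1 * E1 + t * (I * al) * g2 * E2)) = 0"
    and "(m * (al * al) - om) * (- s * g1 * E1 + t * (I * al) * E2)
      + (- (m + l) * (- s * g1 * g1 * g1 * E1 + t * (I * al) * g2 * g2 * E2)
         + l * (I * al) * (s * (I * al) * g1 * E1 + t * g2 * g2 * E2)) = 0"
  using assms by algebra+

text \<open>The conormal derivative of these modes minus the Dirichlet-to-Neumann term, paired with boundary
  values \<open>(U1, U2)\<close>; \<open>X\<close> is the inverse of \<open>\<chi>\<close>. The modes decay downwards while the matrix of the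
  operator belongs to upward decay, so the two contributions add up and do not cancel. The two
  linear forms in \<open>(U1, U2)\<close> on the right have a determinant equal to \<open>\<chi>\<close> up to sign.\<close>

lemma adjoint_conormal_identity:
  fixes I al g1 g2 k1 k2 m l om X s t U1 U2 w1 w2 :: complex
  assumes "I * I = - 1" "g1 * g1 = al * al - k1" "g2 * g2 = al * al - k2"
    and "(l + m) * k1 = om" "m * k2 = om" "X * (al * al - g1 * g2) = 1"
    and "w1 = s * (I * al) + t * g2" "w2 = - s * g1 + t * (I * al)"
  shows "m * ((s * (I * al) * g1 + t * g2 * g2) * U1 + (- s * g1 * g1 + t * (I * al) * g2) * U2)
      + l * (- (I * al) * w1 * U2 + (- s * g1 * g1 + t * (I * al) * g2) * U2)
      - (- (om * g1 * X) * U1 * w1 + I * (m * al - om * al * X) * U2 * w1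
         + (- I * (m * al - om * al * X)) * U1 * w2 + - (om * g2 * X) * U2 * w2)
    = 2 * om * X * (s * g1 * (I * al * U1 - g2 * U2) + t * g2 * (g1 * U1 + I * al * U2))"
proof -
  have s1: "m * (I * al * g1) - (- (om * g1 * X) * (I * al) + (- I * (m * al - om * al * X)) * (- g1))
      = 2 * om * X * g1 * (I * al)" by algebra
  have s2: "m * (- g1 * g1) + l * (- (I * al) * (I * al) + - g1 * g1)
      - (I * (m * al - om * al * X) * (I * al) + - (om * g2 * X) * (- g1)) = 2 * om * X * g1 * (- g2)"
    using assms(1,2,4,6) by algebra
  have t1: "m * (g2 * g2) - (- (om * g1 * X) * g2 + (- I * (m * al - om * al * X)) * (I * al))
      = 2 * om * X * g2 * g1"
    using assms(1,3,5,6) by algebra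
  have t2: "m * ((I * al) * g2) + l * (- (I * al) * g2 + (I * al) * g2)
      - (I * (m * al - om * al * X) * g2 + - (om * g2 * X) * (I * al)) = 2 * om * X * g2 * (I * al)"
    by algebra
  show ?thesis unfolding assms(7,8) using s1 s2 t1 t2 by algebra
qed

definition two_exp :: "real \<Rightarrow> real \<Rightarrow> real \<Rightarrow> complex \<Rightarrow> complex \<Rightarrow> real \<Rightarrow> complex" where
  "two_exp g1 g2 b A B y = A * exp (of_real g1 * of_real (y - b)) + B * exp (of_real g2 * of_real (y - b))"

lemma two_exp_at [simp]: "two_exp g1 g2 b A B b = A + B"
  by (simp add: two_exp_def)

lemma two_exp_deriv:
  "(two_exp g1 g2 b A B has_vector_derivative two_exp g1 g2 b (A * of_real g1) (B * of_real g2) y) (at y)"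
proof -
  have "((\<lambda>y. exp (of_real g * complex_of_real (y - b))) has_vector_derivative of_real g * exp (of_real g * of_real (y - b))) (at y)" for g :: real
    using vector_diff_chain_at[of "\<lambda>y. y - b" 1 y "\<lambda>x. exp (of_real g * complex_of_real x)", OF _ exp_linear_deriv]
    by (simp add: o_def has_vector_derivative_diff_const)
  from has_vector_derivative_add[OF has_vector_derivative_mult_right[OF this[of g1], of A] has_vector_derivative_mult_right[OF this[of g2], of B]]
  show ?thesis unfolding two_exp_def[abs_def] by (simp add: mult.assoc)
qed

lemma Ck1_two_exp: "Ck1 k (two_exp g1 g2 b A B)"
proof -
  have "Ck1 k (\<lambda>y. A * exp (of_real g1 * of_real (1 * y + (- b))) + B * exp (of_real g2 * of_real (1 * y + (- b))))"
    by (intro Ck1_add Ck1_mult Ck1_const Ck1_affine[of k "\<lambda>x. exp (of_real g * complex_of_real x)" for g] Ck1_exp)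
  then show ?thesis unfolding two_exp_def[abs_def] by simp
qed

text \<open>Below the level \<open>b2\<close> the slower exponential dominates.\<close>

lemma norm_two_exp_le:
  assumes "0 \<le> g2" "g2 \<le> g1" "y \<le> b2" "b2 \<le> b" "norm A + norm B \<le> S"
  shows "norm (two_exp g1 g2 b A B y) \<le> S * exp (- g2 * (b - b2))"
proof -
  have e: "norm (exp (of_real g * complex_of_real (y - b))) \<le> exp (- g2 * (b - b2))" if "g2 \<le> g" for g
  proof -
    have "g * (y - b) \<le> g2 * (y - b)" using that assms by (intro mult_right_mono_neg) auto
    also have "\<dots> \<le> g2 * (b2 - b)" using assms by (intro mult_left_mono) auto
    also have "\<dots> = - g2 * (b - b2)" by (simp add: algebra_simps)
    finally have "g * (y - b) \<le> - g2 * (b - b2)" .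
    then show ?thesis by (simp add: norm_exp_eq_Re)
  qed
  have "norm (two_exp g1 g2 b A B y) \<le> norm A * exp (- g2 * (b - b2)) + norm B * exp (- g2 * (b - b2))"
    unfolding two_exp_def
    by (rule order_trans[OF norm_triangle_ineq]) (auto simp only: norm_mult intro!: add_mono mult_left_mono e assms(2) order_refl norm_ge_zero)
  also have "\<dots> = (norm A + norm B) * exp (- g2 * (b - b2))" by (simp add: distrib_right)
  also have "\<dots> \<le> S * exp (- g2 * (b - b2))" using assms(5) by (intro mult_right_mono) auto
  finally show ?thesis .
qed

text \<open>The derivatives vanish outside the transition interval \<open>[a,b]\<close>, so they are bounded by
  compactness of this interval.\<close>

lemma smooth_cutoff_bounded:
  fixes a b :: real assumes "a < b"
  obtains \<psi> \<psi>' \<psi>'' K where "\<And>k. Ck1 k \<psi>" "\<And>k. Ck1 k \<psi>'" "\<And>k. Ck1 k \<psi>''"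
    "\<And>y. (\<psi> has_vector_derivative \<psi>' y) (at y)" "\<And>y. (\<psi>' has_vector_derivative \<psi>'' y) (at y)"
    "\<And>y. y \<le> a \<Longrightarrow> \<psi> y = 0" "\<And>y. b \<le> y \<Longrightarrow> \<psi> y = 1" "\<And>y. b < y \<Longrightarrow> \<psi>' y = 0" "\<And>y. b < y \<Longrightarrow> \<psi>'' y = 0"
    "0 < K" "\<And>y. norm (\<psi> y) \<le> K" "\<And>y. norm (\<psi>' y) \<le> K" "\<And>y. norm (\<psi>'' y) \<le> K"
proof -
  obtain \<psi> where \<psi>: "\<And>k. Ck1 k \<psi>" "\<And>y. y \<le> a \<Longrightarrow> \<psi> y = 0" "\<And>y. b \<le> y \<Longrightarrow> \<psi> y = 1"
    using smooth_cutoff_exists[OF assms] by blast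
  obtain \<psi>' where d1: "\<And>y. (\<psi> has_vector_derivative \<psi>' y) (at y)" "\<And>k. Ck1 k \<psi>'" "continuous_on UNIV \<psi>'"
    using Ck1_deriv_obtain[OF \<psi>(1)] by metis
  obtain \<psi>'' where d2: "\<And>y. (\<psi>' has_vector_derivative \<psi>'' y) (at y)" "\<And>k. Ck1 k \<psi>''" "continuous_on UNIV \<psi>''"
    using Ck1_deriv_obtain[OF d1(2)] by metis
  have below1: "\<psi>' y = 0" if "y \<le> a" for y by (rule derivative_vanishes_below[OF d1(1,3) \<psi>(2) that])
  have below2: "\<psi>'' y = 0" if "y \<le> a" for y by (rule derivative_vanishes_below[OF d2(1,3) below1 that])
  have const: "f' y = 0" if "\<And>y. (f has_vector_derivative f' y) (at y)" "\<And>y. b < y \<Longrightarrow> f y = c" "b < y" for f f' y and c :: complex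
  proof -
    have "((\<lambda>_. c) has_vector_derivative f' y) (at y)"
      by (rule has_vector_derivative_transform_within_open[OF that(1), of "{b<..}"]) (use that(2,3) in auto)
    then show ?thesis using vector_derivative_unique_at[OF _ has_vector_derivative_const] by blast
  qed
  have above1: "\<psi>' y = 0" if "b < y" for y by (rule const[OF d1(1) _ that]) (use \<psi>(3) in auto)
  have above2: "\<psi>'' y = 0" if "b < y" for y by (rule const[OF d2(1) above1 that])
  have bd: "\<exists>B>0. \<forall>y\<in>{a..b}. norm (f y) \<le> B" if "continuous_on UNIV f" for f :: "real \<Rightarrow> complex"
    using continuous_bounded_on[OF that, of "{a..b}"] by (metis bounded_closed_interval)
  obtain B0 B1 B2 where B: "B0 > 0" "\<forall>y\<in>{a..b}. norm (\<psi> y) \<le> B0" "B1 > 0" "\<forall>y\<in>{a..b}. norm (\<psi>' y) \<le> B1"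
      "B2 > 0" "\<forall>y\<in>{a..b}. norm (\<psi>'' y) \<le> B2"
    using bd[OF Ck1_continuous[OF \<psi>(1)]] bd[OF d1(3)] bd[OF d2(3)] by metis
  define K where "K = B0 + B1 + B2 + 1"
  have "norm (\<psi> y) \<le> K \<and> norm (\<psi>' y) \<le> K \<and> norm (\<psi>'' y) \<le> K" for y
  proof -
    consider "y \<le> a" | "y \<in> {a..b}" | "b < y" by fastforce
    then show ?thesis
    proof cases
      case 1 then show ?thesis using \<psi>(2) below1 below2 B by (simp add: K_def)
    next
      case 2 then show ?thesis using B by (fastforce simp: K_def)
    next
      case 3 then show ?thesis using \<psi>(3)[of y] above1 above2 B by (simp add: K_def)
    qed
  qed
  moreover have "0 < K" using B by (simp add: K_def)
  ultimately show thesis using that[OF \<psi>(1) d1(2) d2(2) d1(1) d2(1) \<psi>(2,3) above1 above2] by blast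
qed

locale elastic_cell = cell p a + elastic p for p a
begin

lemma mode_int_add:
  assumes "L2 (Omega p) f" "continuous_on UNIV \<eta>1" "continuous_on UNIV \<eta>2"
  shows "mode_int n f (\<lambda>y. \<eta>1 y + \<eta>2 y) = mode_int n f \<eta>1 + mode_int n f \<eta>2"
  using set_integral_add(2)[OF mode_int_integrable[OF assms(1,2)] mode_int_integrable[OF assms(1,3)]]
  by (simp add: mode_int_def distrib_left)

lemma mode_int_cmult: "mode_int n f (\<lambda>y. c * \<eta> y) = c * mode_int n f \<eta>"
  unfolding mode_int_def by (subst set_integral_mult_right[symmetric]) (simp add: mult_ac)

lemma norm_mode_int_le:
  assumes "L2 (Omega p) f" "continuous_on UNIV \<eta>" "\<And>y. y < height p \<Longrightarrow> norm (\<eta> y) \<le> B" "0 \<le> B"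
  shows "norm (mode_int n f \<eta>) \<le> B * (sqrt (measure lborel (Omega p)) * L2_norm (Omega p) f)"
  unfolding mode_int_def
proof (rule norm_L2_pairing_le[OF assms(1) bounded_Omega borel_Omega _ _ assms(4)])
  show "continuous_on UNIV (tensor (cwave p n) \<eta>)"
    by (intro continuous_on_mult continuous_on_compose2[OF cont_cwave] continuous_on_compose2[OF assms(2)] continuous_intros subset_UNIV)
  show "norm (tensor (cwave p n) \<eta> z) \<le> B" if "z \<in> Omega p" for z
    using that assms(3)[of "snd z"] by (auto simp: norm_mult norm_cwave Omega_def)
qed

end

section \<open>Exponential decay of the Fourier coefficients\<close>

text \<open>The cut-off increases from 0 to 1 between the levels \<open>a\<close> and \<open>b2\<close>. It is fixed once for all modes,
  so that its bound \<open>K\<close> enters the final constant.\<close>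

locale cutoff_cell = elastic_cell p a for p a +
  fixes b2 K :: real and \<psi> \<psi>' \<psi>'' :: "real \<Rightarrow> complex"
  assumes smooth_\<psi>: "\<And>k. Ck1 k \<psi>" "\<And>k. Ck1 k \<psi>'" "\<And>k. Ck1 k \<psi>''"
    and deriv_\<psi>: "\<And>y. (\<psi> has_vector_derivative \<psi>' y) (at y)" "\<And>y. (\<psi>' has_vector_derivative \<psi>'' y) (at y)"
    and \<psi>_below: "\<And>y. y \<le> a \<Longrightarrow> \<psi> y = 0" and \<psi>_above: "\<And>y. b2 \<le> y \<Longrightarrow> \<psi> y = 1"
    and \<psi>'_above: "\<And>y. b2 < y \<Longrightarrow> \<psi>' y = 0" "\<And>y. b2 < y \<Longrightarrow> \<psi>'' y = 0"
    and K_pos: "0 < K" and \<psi>_bound: "\<And>y. norm (\<psi> y) \<le> K" "\<And>y. norm (\<psi>' y) \<le> K" "\<And>y. norm (\<psi>'' y) \<le> K"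
    and b2: "b2 < height p"
begin

text \<open>Green's formula in \<open>y\<close> with the cut-off as weight is a trace inequality for single modes.\<close>

lemma trace_coeff_bound:
  assumes v: "v \<in> H1_qp p"
  shows "norm (fourier_coeff p v n) \<le> 2 * K * sqrt (measure lborel (Omega p)) / period p * H1_norm (Omega p) v"
proof -
  define R where "R = sqrt (measure lborel (Omega p))"
  have vH: "v \<in> H1 (Omega p)" using v by (simp add: H1_qp_def)
  have R0: "0 \<le> R" by (simp add: R_def)
  have c: "continuous_on UNIV \<psi>" "continuous_on UNIV \<psi>'"
    using smooth_\<psi> Ck1_continuous by blast+
  have "mode_int n (wderiv (Omega p) 2 v) \<psi> = \<psi> (height p) * (of_real (period p) * fourier_coeff p v n) - mode_int n v \<psi>'"
    by (rule mode_int_dy[OF v smooth_\<psi>(1) \<psi>_below deriv_\<psi>(1) c(2)])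
  then have "of_real (period p) * fourier_coeff p v n = mode_int n (wderiv (Omega p) 2 v) \<psi> + mode_int n v \<psi>'"
    using \<psi>_above[of "height p"] b2 by simp
  then have "period p * norm (fourier_coeff p v n) = norm (mode_int n (wderiv (Omega p) 2 v) \<psi> + mode_int n v \<psi>')"
    using period_pos by (metis abs_of_pos norm_mult norm_of_real)
  also have "\<dots> \<le> K * (R * L2_norm (Omega p) (wderiv (Omega p) 2 v)) + K * (R * L2_norm (Omega p) v)"
    unfolding R_def using vH K_pos
    by (intro order_trans[OF norm_triangle_ineq] add_mono norm_mode_int_le wderiv_props(1) c \<psi>_bound)
      (auto simp: H1_def)
  also have "\<dots> \<le> K * (R * H1_norm (Omega p) v) + K * (R * H1_norm (Omega p) v)"
    using K_pos R0 by (intro add_mono mult_left_mono L2_norm_le_H1_norm L2_norm_wderiv_le_H1_norm) auto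
  finally have "period p * norm (fourier_coeff p v n) \<le> 2 * K * R * H1_norm (Omega p) v" by simp
  then show ?thesis using period_pos unfolding R_def[symmetric] by (simp add: field_simps)
qed

text \<open>The cut-off times the two modes is tested against the solution. Where the cut-off is constant the
  operator annihilates the test field; the remaining terms \<open>P\<close> are commutators with the cut-off,
  supported below the level \<open>b2\<close>.\<close>

lemma adjoint_pairing:
  fixes u :: "real \<times> real \<Rightarrow> complex^2" and n :: int and s t :: complex
  assumes ev: "kappa2 p < \<bar>alphan p n\<bar>"
    and u: "u \<in> H1_qp_vec p" and sol: "\<And>v. v \<in> H1_S_qp_vec p \<Longrightarrow> sesq_form p u v = 0"
  defines "al \<equiv> alphan p n" and "g1 \<equiv> decay1 p n" and "g2 \<equiv> decay2 p n"
    and "U \<equiv> (\<lambda>i. of_real (period p) * fourier_coeff p (\<lambda>z. u z $ i) n)"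
  shows "norm (2 * of_real ((freq p)\<^sup>2) * of_real (1 / chi_re p n) *
      (s * of_real g1 * (\<i> * of_real al * U 1 - of_real g2 * U 2) + t * of_real g2 * (of_real g1 * U 1 + \<i> * of_real al * U 2)))
    \<le> 2 * (K * (3 * lame_mu p + 4 * (lame_lambda p + lame_mu p)) * ((norm s + norm t) * (1 + \<bar>al\<bar>)\<^sup>2 * exp (- g2 * (height p - b2))))
        * (sqrt (measure lborel (Omega p)) * H1_norm_vec (Omega p) u)"
proof -
  define b where "b = height p"
  define c where "c = \<i> * complex_of_real al"
  define A where "A = (\<lambda>i::2. if i = 1 then s * c else - s * of_real g1)"
  define B where "B = (\<lambda>i::2. if i = 1 then t * of_real g2 else t * c)"
  define w where "w = (\<lambda>i. two_exp g1 g2 b (A i) (B i))"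
  define w' where "w' = (\<lambda>i. two_exp g1 g2 b (A i * of_real g1) (B i * of_real g2))"
  define w'' where "w'' = (\<lambda>i. two_exp g1 g2 b (A i * of_real g1 * of_real g1) (B i * of_real g2 * of_real g2))"
  define W where "W = (\<lambda>i y. \<psi> y * w i y)"
  define W' where "W' = (\<lambda>i y. \<psi> y * w' i y + \<psi>' y * w i y)"
  define W'' where "W'' = (\<lambda>i y. (\<psi> y * w'' i y + \<psi>' y * w' i y) + (\<psi>' y * w' i y + \<psi>'' y * w i y))"
  define J where "J = (\<lambda>i. mode_int n (\<lambda>z. u z $ i))"
  define m where "m = complex_of_real (lame_mu p)"
  define l where "l = complex_of_real (lame_lambda p + lame_mu p)"
  define om where "om = complex_of_real ((freq p)\<^sup>2)"
  define X where "X = complex_of_real (1 / chi_re p n)"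
  have g: "0 < g2" "g2 < g1" "g1 \<le> \<bar>al\<bar>" "g2 \<le> \<bar>al\<bar>"
    using decay_pos[OF ev] decay_le[OF ev] by (simp_all add: g1_def g2_def al_def)
  have dw: "(w i has_vector_derivative w' i y) (at y)" "(w' i has_vector_derivative w'' i y) (at y)" for i y
    unfolding w_def w'_def w''_def by (rule two_exp_deriv)+
  have Cw: "Ck1 k (w i)" "Ck1 k (w' i)" "Ck1 k (w'' i)" for i k
    unfolding w_def w'_def w''_def by (rule Ck1_two_exp)+
  have CW: "Ck1 k (W i)" "Ck1 k (W' i)" "Ck1 k (W'' i)" for i k
    unfolding W_def W'_def W''_def by (intro Ck1_add Ck1_mult Cw smooth_\<psi>)+
  have dW: "(W i has_vector_derivative W' i y) (at y)" for i y
    unfolding W_def W'_def by (rule has_vector_derivative_mult[OF deriv_\<psi>(1) dw(1)])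
  have dW': "(W' i has_vector_derivative W'' i y) (at y)" for i y
    unfolding W'_def W''_def
    by (rule has_vector_derivative_add[OF has_vector_derivative_mult[OF deriv_\<psi>(1) dw(2)]
          has_vector_derivative_mult[OF deriv_\<psi>(2) dw(1)]])
  have W0: "W i y = 0" if "y \<le> a" for i y using \<psi>_below[OF that] by (simp add: W_def)
  have cW: "continuous_on UNIV (W i)" "continuous_on UNIV (W' i)" "continuous_on UNIV (W'' i)" for i
    using CW Ck1_continuous by blast+
  have Wb: "W i b = A i + B i" "W' i b = A i * of_real g1 + B i * of_real g2" for i
    using \<psi>_above[of b] \<psi>'_above[of b] b2 by (simp_all add: W_def W'_def w_def w'_def b_def)
  have Lu: "L2 (Omega p) (\<lambda>z. u z $ i)" for i
    using u by (auto simp: H1_qp_vec_def H1_qp_def H1_def)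

  define P where "P = (\<lambda>i y. if i = (1::2)
      then (m * of_real (al\<^sup>2) + l * of_real (al\<^sup>2) - om) * W 1 y + ((- m) * W'' 1 y + (l * c) * W' 2 y)
      else (m * of_real (al\<^sup>2) - om) * W 2 y + ((- (m + l)) * W'' 2 y + (l * c) * W' 1 y))"
  have c2: "c\<^sup>2 = - of_real (al\<^sup>2)" by (simp add: c_def power_mult_distrib)
  have J_lin: "J i (\<lambda>y. x1 * f1 y + (x2 * f2 y + x3 * f3 y)) = x1 * J i f1 + (x2 * J i f2 + x3 * J i f3)"
    if "continuous_on UNIV f1" "continuous_on UNIV f2" "continuous_on UNIV f3" for i x1 x2 x3 f1 f2 f3
    unfolding J_def using that
    by (simp add: mode_int_add[OF Lu] mode_int_cmult continuous_intros)
  have J1: "J 1 (P 1) = (m * of_real (al\<^sup>2) + l * of_real (al\<^sup>2) - om) * J 1 (W 1) + ((- m) * J 1 (W'' 1) + (l * c) * J 1 (W' 2))"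
  proof -
    have "P 1 = (\<lambda>y. (m * of_real (al\<^sup>2) + l * of_real (al\<^sup>2) - om) * W 1 y + ((- m) * W'' 1 y + (l * c) * W' 2 y))"
      by (simp only: P_def if_True simp_thms)
    then show ?thesis by (simp only: J_lin[OF cW(1)[of 1] cW(3)[of 1] cW(2)[of 2], of 1])
  qed
  have J2: "J 2 (P 2) = (m * of_real (al\<^sup>2) - om) * J 2 (W 2) + ((- (m + l)) * J 2 (W'' 2) + (l * c) * J 2 (W' 1))"
  proof -
    have "(2::2) \<noteq> 1" by simp
    then have "P 2 = (\<lambda>y. (m * of_real (al\<^sup>2) - om) * W 2 y + ((- (m + l)) * W'' 2 y + (l * c) * W' 1 y))"
      by (simp only: P_def if_False)
    then show ?thesis by (simp only: J_lin[OF cW(1)[of 2] cW(3)[of 2] cW(2)[of 1], of 2])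
  qed

  have "test_field n W \<in> H1_S_qp_vec p"
    using test_H1_S_qp[OF CW(1) W0] by (simp add: H1_S_qp_vec_def test_field_def)
  from sol[OF this] sesq_form_test_field[OF u CW(1) W0 dW CW(2) dW' cW(3), of n]
  have eq0: "m * (\<Sum>i\<in>UNIV. - (c\<^sup>2) * J i (W i) + W' i b * U i - J i (W'' i))
    + l * (- (c\<^sup>2) * J 1 (W 1) - c * (W 1 b * U 2 - J 2 (W' 1)) + c * J 1 (W' 2) + W' 2 b * U 2 - J 2 (W'' 2))
    - om * (\<Sum>i\<in>UNIV. J i (W i))
    - (\<Sum>i\<in>UNIV. \<Sum>j\<in>UNIV. dtn_matrix p n $ i $ j * U j * W i b) = 0"
    unfolding m_def l_def om_def U_def J_def b_def c_def al_def by simp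
  have eq: "m * (W' 1 b * U 1 + W' 2 b * U 2) + l * (- c * W 1 b * U 2 + W' 2 b * U 2)
      - (dtn_matrix p n $ 1 $ 1 * U 1 * W 1 b + dtn_matrix p n $ 1 $ 2 * U 2 * W 1 b
         + dtn_matrix p n $ 2 $ 1 * U 1 * W 2 b + dtn_matrix p n $ 2 $ 2 * U 2 * W 2 b)
      = - (J 1 (P 1) + J 2 (P 2))"
    using eq0 unfolding J1 J2 sum_2 c2 by algebra

  define c1 where "c1 = complex_of_real al"
  have rel: "\<i> * \<i> = - 1" "of_real g1 * of_real g1 = c1 * c1 - of_real ((kappa1 p)\<^sup>2)"
    "of_real g2 * of_real g2 = c1 * c1 - of_real ((kappa2 p)\<^sup>2)"
    "(l + m) * of_real ((kappa1 p)\<^sup>2) = om" "m * of_real ((kappa2 p)\<^sup>2) = om"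
    "X * (c1 * c1 - of_real g1 * of_real g2) = 1"
  proof -
    have "g1 * g1 = al * al - (kappa1 p)\<^sup>2" "g2 * g2 = al * al - (kappa2 p)\<^sup>2"
      using decay_sq[OF ev] by (simp_all add: g1_def g2_def al_def power2_eq_square)
    then show "of_real g1 * of_real g1 = c1 * c1 - complex_of_real ((kappa1 p)\<^sup>2)"
      "of_real g2 * of_real g2 = c1 * c1 - complex_of_real ((kappa2 p)\<^sup>2)"
      unfolding c1_def by (metis of_real_diff of_real_mult)+
    have "((lame_lambda p + lame_mu p) + lame_mu p) * (kappa1 p)\<^sup>2 = (freq p)\<^sup>2" "lame_mu p * (kappa2 p)\<^sup>2 = (freq p)\<^sup>2"
      using kappa_sq by (simp_all add: algebra_simps)
    then show "(l + m) * of_real ((kappa1 p)\<^sup>2) = om" "m * of_real ((kappa2 p)\<^sup>2) = om"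
      unfolding l_def m_def om_def by (metis of_real_add of_real_mult)+
    have "1 / chi_re p n * (al * al - g1 * g2) = 1"
      using chi_pos[OF ev] by (simp add: chi_re_def al_def g1_def g2_def power2_eq_square)
    then show "X * (c1 * c1 - of_real g1 * of_real g2) = 1"
      unfolding X_def c1_def by (metis of_real_1 of_real_diff of_real_mult)
  qed simp
  have M: "dtn_matrix p n $ 1 $ 1 = - (om * of_real g1 * X)" "dtn_matrix p n $ 2 $ 2 = - (om * of_real g2 * X)"
    "dtn_matrix p n $ 1 $ 2 = \<i> * (m * c1 - om * c1 * X)" "dtn_matrix p n $ 2 $ 1 = - \<i> * (m * c1 - om * c1 * X)"
    by (simp_all add: dtn_entries[OF ev] om_def X_def m_def c1_def g1_def g2_def al_def)
  have ident: "2 * om * X * (s * of_real g1 * (\<i> * c1 * U 1 - of_real g2 * U 2) + t * of_real g2 * (of_real g1 * U 1 + \<i> * c1 * U 2))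
      = - (J 1 (P 1) + J 2 (P 2))"
    unfolding eq[symmetric] M
    by (subst adjoint_conormal_identity[OF rel refl refl, of s t "U 1" "U 2", symmetric])
      (simp add: Wb A_def B_def c_def c1_def)

  define q where "q = 1 + \<bar>al\<bar>"
  define S where "S = (norm s + norm t) * q"
  define e where "e = exp (- g2 * (b - b2))"
  define T where "T = S * q * e"
  have q1: "1 \<le> q" "\<bar>al\<bar> \<le> q" by (simp_all add: q_def)
  have S0: "0 \<le> S" using q1 by (simp add: S_def)
  have e0: "0 < e" by (simp add: e_def)
  have Se: "S * e \<le> T" unfolding T_def using S0 e0 q1
    by (metis mult.commute mult.left_commute mult_left_mono mult.right_neutral mult_nonneg_nonneg less_imp_le)
  have nc: "norm c = \<bar>al\<bar>" by (simp add: c_def norm_mult)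
  have AB: "norm (A i) + norm (B i) \<le> S" for i
  proof -
    have "norm (A i) \<le> norm s * q" "norm (B i) \<le> norm t * q"
      using g q1 by (auto simp: A_def B_def norm_mult nc intro!: mult_left_mono)
    then show ?thesis by (simp add: S_def distrib_right)
  qed
  have AB': "norm (A i * of_real g1) + norm (B i * of_real g2) \<le> S * q" for i
  proof -
    have "norm (A i * of_real g1) \<le> norm (A i) * q" "norm (B i * of_real g2) \<le> norm (B i) * q"
      using g q1 by (auto simp: norm_mult intro!: mult_left_mono)
    then have "norm (A i * of_real g1) + norm (B i * of_real g2) \<le> (norm (A i) + norm (B i)) * q"
      by (simp add: distrib_right)
    also have "\<dots> \<le> S * q" using AB[of i] q1 by (intro mult_right_mono) auto
    finally show ?thesis .
  qed
  have nw: "norm (w i y) \<le> S * e" "norm (w' i y) \<le> T" if "y \<le> b2" for i y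
    unfolding w_def w'_def T_def e_def using g b2
    by (intro norm_two_exp_le that AB AB'; simp add: b_def)+

  have cc1: "c = \<i> * c1" by (simp add: c_def c1_def)
  have AB12: "A 1 = s * (\<i> * c1)" "A 2 = - s * of_real g1" "B 1 = t * of_real g2" "B 2 = t * (\<i> * c1)"
    by (simp_all add: A_def B_def cc1)
  have Lw1: "(m * of_real (al\<^sup>2) + l * of_real (al\<^sup>2) - om) * w 1 y + ((- m) * w'' 1 y + (l * c) * w' 2 y) = 0" for y
  proof -
    define E1 where "E1 = exp (of_real g1 * complex_of_real (y - b))"
    define E2 where "E2 = exp (of_real g2 * complex_of_real (y - b))"
    have a2: "complex_of_real (al\<^sup>2) = c1 * c1" by (simp add: c1_def power2_eq_square)
    show ?thesis
      unfolding w_def w'_def w''_def two_exp_def E1_def[symmetric] E2_def[symmetric] AB12 a2 cc1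
      by (rule adjoint_modes_solve(1)[OF rel(1-5)])
  qed
  have Lw2: "(m * of_real (al\<^sup>2) - om) * w 2 y + ((- (m + l)) * w'' 2 y + (l * c) * w' 1 y) = 0" for y
  proof -
    define E1 where "E1 = exp (of_real g1 * complex_of_real (y - b))"
    define E2 where "E2 = exp (of_real g2 * complex_of_real (y - b))"
    have a2: "complex_of_real (al\<^sup>2) = c1 * c1" by (simp add: c1_def power2_eq_square)
    show ?thesis
      unfolding w_def w'_def w''_def two_exp_def E1_def[symmetric] E2_def[symmetric] AB12 a2 cc1
      by (rule adjoint_modes_solve(2)[OF rel(1-5)])
  qed
  \<comment> \<open>Only the terms in which the cut-off is differentiated survive.\<close>
  have P1: "P 1 y = - m * (2 * (\<psi>' y * w' 1 y) + \<psi>'' y * w 1 y) + l * (\<psi>' y * (c * w 2 y))" for y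
    unfolding P_def W_def W'_def W''_def using Lw1[of y] by simp algebra
  have P2: "P 2 y = - (m + l) * (2 * (\<psi>' y * w' 2 y) + \<psi>'' y * w 2 y) + l * (\<psi>' y * (c * w 1 y))" for y
    unfolding P_def W_def W'_def W''_def using Lw2[of y] by simp algebra

  define D where "D = K * (3 * lame_mu p + 4 * (lame_lambda p + lame_mu p)) * T"
  have T0: "0 \<le> T" using S0 q1 e0 by (simp add: T_def)
  have normcomb: "norm (- x * (2 * (\<psi>' y * f1) + \<psi>'' y * f2) + of_real l' * (\<psi>' y * f3)) \<le> K * (3 * norm x + l') * T"
    if "norm f1 \<le> T" "norm f2 \<le> T" "norm f3 \<le> T" "0 \<le> l'" for x f1 f2 f3 y l'
  proof -
    have p: "norm (\<psi>' y * f1) \<le> K * T" "norm (\<psi>'' y * f2) \<le> K * T" "norm (\<psi>' y * f3) \<le> K * T"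
      unfolding norm_mult using that \<psi>_bound K_pos T0 by (auto intro!: mult_mono)
    have "norm (- x * (2 * (\<psi>' y * f1) + \<psi>'' y * f2) + of_real l' * (\<psi>' y * f3))
        \<le> norm x * (2 * norm (\<psi>' y * f1) + norm (\<psi>'' y * f2)) + l' * norm (\<psi>' y * f3)"
    proof -
      have "norm (2 * (\<psi>' y * f1) + \<psi>'' y * f2) \<le> 2 * norm (\<psi>' y * f1) + norm (\<psi>'' y * f2)"
        using norm_triangle_ineq[of "2 * (\<psi>' y * f1)" "\<psi>'' y * f2"] by (simp add: norm_mult)
      then have "norm (- x * (2 * (\<psi>' y * f1) + \<psi>'' y * f2)) \<le> norm x * (2 * norm (\<psi>' y * f1) + norm (\<psi>'' y * f2))"
        unfolding norm_mult norm_minus_cancel by (intro mult_left_mono) auto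
      moreover have "norm (of_real l' * (\<psi>' y * f3)) = l' * norm (\<psi>' y * f3)"
        using that(4) by (simp add: norm_mult)
      ultimately show ?thesis using norm_triangle_ineq[of "- x * (2 * (\<psi>' y * f1) + \<psi>'' y * f2)" "of_real l' * (\<psi>' y * f3)"] by linarith
    qed
    also have "\<dots> \<le> norm x * (2 * (K * T) + K * T) + l' * (K * T)"
      using p that(4) by (intro add_mono mult_left_mono) auto
    also have "\<dots> = K * (3 * norm x + l') * T" by (simp add: algebra_simps)
    finally show ?thesis .
  qed
  have nm: "norm m = lame_mu p" "norm (m + l) = lame_mu p + (lame_lambda p + lame_mu p)"
    using mu0 lm0 by (simp_all add: m_def l_def flip: of_real_add)
  have cw: "norm (c * w i y) \<le> T" if "y \<le> b2" for i y
  proof -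
    have "norm (c * w i y) \<le> q * (S * e)"
      unfolding norm_mult nc using nw(1)[OF that] q1 by (intro mult_mono) auto
    then show ?thesis by (simp add: T_def mult_ac)
  qed
  have KT: "0 \<le> K * T" using K_pos T0 by simp
  have D0: "0 \<le> D" unfolding D_def using K_pos mu0 lm0 T0 by (intro mult_nonneg_nonneg) auto
  have nP: "norm (P i y) \<le> D" for i y
  proof (cases "y \<le> b2")
    case True
    have 1: "norm (P 1 y) \<le> K * (3 * lame_mu p + (lame_lambda p + lame_mu p)) * T"
      unfolding P1 l_def using lm0 nw(2)[OF True, of 1] order_trans[OF nw(1)[OF True, of 1] Se] cw[OF True, of 2]
      by (intro normcomb[where x = m, unfolded nm]) auto
    have 2: "norm (P 2 y) \<le> K * (3 * (lame_mu p + (lame_lambda p + lame_mu p)) + (lame_lambda p + lame_mu p)) * T"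
      unfolding P2 l_def[symmetric] nm(2)[symmetric]
      unfolding l_def using lm0 nw(2)[OF True, of 2] order_trans[OF nw(1)[OF True, of 2] Se] cw[OF True, of 1]
      by (intro normcomb) auto
    have "K * (3 * lame_mu p + (lame_lambda p + lame_mu p)) * T \<le> D"
      unfolding D_def using KT lm0 K_pos T0 by (intro mult_right_mono mult_left_mono) auto
    moreover have "K * (3 * (lame_mu p + (lame_lambda p + lame_mu p)) + (lame_lambda p + lame_mu p)) * T = D"
      unfolding D_def by (simp add: algebra_simps)
    ultimately have "norm (P 1 y) \<le> D" "norm (P 2 y) \<le> D" using 1 2 by auto
    then show ?thesis using exhaust_2[of i] by metis
  next
    case False
    then have "\<psi>' y = 0" "\<psi>'' y = 0" using \<psi>'_above by auto
    then have "P 1 y = 0" "P 2 y = 0" by (simp_all add: P1 P2)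
    then have "norm (P 1 y) \<le> D" "norm (P 2 y) \<le> D" using D0 by auto
    then show ?thesis using exhaust_2[of i] by metis
  qed
  have cP: "continuous_on UNIV (P i)" for i
    unfolding P_def using exhaust_2[of i] by (auto intro!: continuous_intros cW)
  define R where "R = sqrt (measure lborel (Omega p)) * H1_norm_vec (Omega p) u"
  have nJ: "norm (J i (P i)) \<le> D * R" for i
  proof -
    have "norm (J i (P i)) \<le> D * (sqrt (measure lborel (Omega p)) * L2_norm (Omega p) (\<lambda>z. u z $ i))"
      unfolding J_def by (rule norm_mode_int_le[OF Lu cP nP D0])
    also have "\<dots> \<le> D * R" unfolding R_def
      using order_trans[OF L2_norm_le_H1_norm[of "Omega p" "\<lambda>z. u z $ i"] H1_norm_component_le[of "Omega p" u i]] D0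
      by (intro mult_left_mono) auto
    finally show ?thesis .
  qed
  have "norm (- (J 1 (P 1) + J 2 (P 2))) \<le> 2 * D * R"
    using norm_triangle_ineq[of "J 1 (P 1)" "J 2 (P 2)"] nJ[of 1] nJ[of 2] unfolding norm_minus_cancel by linarith
  moreover have "T = (norm s + norm t) * (1 + \<bar>al\<bar>)\<^sup>2 * exp (- g2 * (height p - b2))"
    by (simp add: T_def S_def q_def e_def b_def power2_eq_square mult_ac)
  ultimately show ?thesis
    using ident unfolding om_def[symmetric] X_def[symmetric] c1_def[symmetric] R_def D_def by simp
qed

text \<open>The amplitudes \<open>s, t\<close> are the solution of the linear system that makes the boundary form equal to
  a single component. The factor \<open>1/\<chi>\<close> of the inverse matrix cancels, and only
  \<open>1/\<gamma>\<^sub>1\<close> and \<open>1/\<gamma>\<^sub>2\<close> have to be bounded, by \<open>1/g0\<close>.\<close>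

lemma fourier_coeff_decay:
  fixes u :: "real \<times> real \<Rightarrow> complex^2"
  assumes ev: "kappa2 p < \<bar>alphan p n\<bar>"
    and u: "u \<in> H1_qp_vec p" and sol: "\<And>v. v \<in> H1_S_qp_vec p \<Longrightarrow> sesq_form p u v = 0"
    and g0: "0 < g0" "g0 \<le> decay2 p n"
  shows "norm (fourier_coeff p (\<lambda>z. u z $ i) n) \<le>
    (2 * K * (3 * lame_mu p + 4 * (lame_lambda p + lame_mu p)) * ((1 / g0 + 1) / (2 * (freq p)\<^sup>2))
       * sqrt (measure lborel (Omega p)) / period p)
    * (1 + \<bar>alphan p n\<bar>) ^ 3 * exp (- decay2 p n * (height p - b2)) * H1_norm_vec (Omega p) u"
proof -
  define al where "al = alphan p n"
  define g1 where "g1 = decay1 p n"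
  define g2 where "g2 = decay2 p n"
  define U where "U = (\<lambda>i. of_real (period p) * fourier_coeff p (\<lambda>z. u z $ i) n)"
  define q where "q = 1 + \<bar>al\<bar>"
  define e where "e = exp (- g2 * (height p - b2))"
  define m4 where "m4 = 3 * lame_mu p + 4 * (lame_lambda p + lame_mu p)"
  define R where "R = sqrt (measure lborel (Omega p)) * H1_norm_vec (Omega p) u"
  define om where "om = complex_of_real ((freq p)\<^sup>2)"
  define X where "X = complex_of_real (1 / chi_re p n)"
  define L where "L = (\<lambda>s t. 2 * om * X *
      (s * of_real g1 * (\<i> * of_real al * U 1 - of_real g2 * U 2) + t * of_real g2 * (of_real g1 * U 1 + \<i> * of_real al * U 2)))"
  have pair: "norm (L s t) \<le> 2 * (K * m4 * ((norm s + norm t) * q\<^sup>2 * e)) * R" for s t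
    using adjoint_pairing[OF ev u sol, of s t]
    unfolding L_def om_def X_def m4_def q_def e_def R_def al_def g1_def g2_def U_def .
  have g: "0 < g2" "g2 < g1" "0 < g1"
    using decay_pos[OF ev] by (simp_all add: g1_def g2_def)
  have om0: "om \<noteq> 0" using freq0 by (simp add: om_def)
  have Xchi: "X * (of_real al * of_real al - of_real g1 * of_real g2) = 1"
  proof -
    have "1 / chi_re p n * (al * al - g1 * g2) = 1"
      using chi_pos[OF ev] by (simp add: chi_re_def al_def g1_def g2_def power2_eq_square)
    then show ?thesis unfolding X_def by (metis of_real_1 of_real_diff of_real_mult)
  qed
  have gc: "complex_of_real g1 \<noteq> 0" "complex_of_real g2 \<noteq> 0" using g by auto
  have U1: "U 1 = L (- \<i> * of_real al / (2 * om * of_real g1)) (- 1 / (2 * om))"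
  proof -
    have "L (- \<i> * of_real al / (2 * om * of_real g1)) (- 1 / (2 * om))
        = X * (- \<i> * of_real al * (\<i> * of_real al * U 1 - of_real g2 * U 2) - of_real g2 * (of_real g1 * U 1 + \<i> * of_real al * U 2))"
      unfolding L_def using om0 gc by (simp add: field_simps)
    also have "\<dots> = X * (of_real al * of_real al - of_real g1 * of_real g2) * U 1"
      using i_squared by algebra
    finally show ?thesis using Xchi by simp
  qed
  have U2: "U 2 = L (1 / (2 * om)) (- \<i> * of_real al / (2 * om * of_real g2))"
  proof -
    have "L (1 / (2 * om)) (- \<i> * of_real al / (2 * om * of_real g2))
        = X * (of_real g1 * (\<i> * of_real al * U 1 - of_real g2 * U 2) - \<i> * of_real al * (of_real g1 * U 1 + \<i> * of_real al * U 2))"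
      unfolding L_def using om0 gc by (simp add: field_simps)
    also have "\<dots> = X * (of_real al * of_real al - of_real g1 * of_real g2) * U 2"
      using i_squared by algebra
    finally show ?thesis using Xchi by simp
  qed
  define G where "G = (1 / g0 + 1) / (2 * (freq p)\<^sup>2)"
  have q1: "1 \<le> q" "\<bar>al\<bar> \<le> q" by (simp_all add: q_def)
  have R0: "0 \<le> R" by (simp add: R_def H1_norm_vec_nonneg)
  have e0: "0 \<le> e" by (simp add: e_def)
  have m40: "0 \<le> m4" using mu0 lm0 by (simp add: m4_def)
  have nom: "norm (2 * om) = 2 * (freq p)\<^sup>2" by (simp add: om_def norm_mult norm_power)
  have small: "norm (1 / (2 * om)) + norm (- \<i> * of_real al / (2 * om * of_real g)) \<le> G * q" if "g0 \<le> g" for g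
  proof -
    have g_pos: "0 < g" using that g0 by simp
    have "norm (1 / (2 * om)) + norm (- \<i> * of_real al / (2 * om * of_real g))
        = (1 + \<bar>al\<bar> / g) / (2 * (freq p)\<^sup>2)"
      using g_pos freq0 unfolding norm_divide norm_mult[of "2 * om"] nom
      by (simp add: norm_mult add_divide_distrib)
    also have "\<dots> \<le> (q + q / g0) / (2 * (freq p)\<^sup>2)"
      using q1 that g0 g_pos by (intro divide_right_mono add_mono frac_le) auto
    also have "\<dots> = G * q" by (simp add: G_def algebra_simps)
    finally show ?thesis .
  qed
  have gg: "g0 \<le> g1" "g0 \<le> g2" using g0 g by (simp_all add: g2_def)
  have bound: "norm (L s t) \<le> 2 * (K * m4 * (G * q * q\<^sup>2 * e)) * R" if "norm s + norm t \<le> G * q" for s t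
    by (rule order_trans[OF pair])
      (use that R0 e0 m40 K_pos in \<open>intro mult_right_mono mult_left_mono; simp\<close>)
  have "norm (U 1) \<le> 2 * (K * m4 * (G * q * q\<^sup>2 * e)) * R"
    by (subst U1, rule bound) (use small[OF gg(1)] in \<open>simp add: add.commute\<close>)
  moreover have "norm (U 2) \<le> 2 * (K * m4 * (G * q * q\<^sup>2 * e)) * R"
    by (subst U2, rule bound) (use small[OF gg(2)] in simp)
  ultimately have "norm (U i) \<le> 2 * (K * m4 * (G * q * q\<^sup>2 * e)) * R"
    using exhaust_2[of i] by metis
  then have "period p * norm (fourier_coeff p (\<lambda>z. u z $ i) n) \<le> 2 * (K * m4 * (G * q * q\<^sup>2 * e)) * R"
    using period_pos by (simp add: U_def norm_mult)
  then have "norm (fourier_coeff p (\<lambda>z. u z $ i) n) \<le> 2 * (K * m4 * (G * q * q\<^sup>2 * e)) * R / period p"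
    using period_pos by (simp add: field_simps)
  also have "\<dots> = (2 * K * m4 * G * sqrt (measure lborel (Omega p)) / period p) * q ^ 3 * e * H1_norm_vec (Omega p) u"
    by (simp add: R_def power2_eq_square power3_eq_cube)
  finally show ?thesis
    unfolding m4_def G_def q_def e_def al_def g2_def .
qed

end

section \<open>Summation over the modes\<close>

text \<open>The \<open>k\<close>-th power of the inequality \<open>dx/k \<le> exp (dx/k)\<close>.\<close>

lemma power_times_exp_le:
  fixes x d :: real assumes "0 \<le> x" "0 < d" "0 < k"
  shows "x ^ k * exp (- d * x) \<le> (real k / d) ^ k"
proof -
  have "d * x / real k \<le> exp (d * x / real k)"
    using exp_ge_add_one_self[of "d * x / real k"] by linarith
  then have "(d * x / real k) ^ k \<le> exp (d * x / real k) ^ k"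
    using assms by (intro power_mono) auto
  also have "\<dots> = exp (d * x)"
    using assms(3) by (simp flip: exp_of_nat_mult)
  finally have "(d * x / real k) ^ k \<le> exp (d * x)" .
  then have "(d * x / real k) ^ k * (real k / d) ^ k \<le> exp (d * x) * (real k / d) ^ k"
    using assms by (intro mult_right_mono) auto
  moreover have "(d * x / real k) ^ k * (real k / d) ^ k = x ^ k"
    using assms by (simp flip: power_mult_distrib)
  ultimately have "x ^ k \<le> exp (d * x) * (real k / d) ^ k" by simp
  then have "x ^ k * exp (- d * x) \<le> exp (d * x) * (real k / d) ^ k * exp (- d * x)"
    by (intro mult_right_mono) auto
  also have "\<dots> = (real k / d) ^ k" by (simp add: exp_minus)
  finally show ?thesis .
qed

lemma summable_on_inverse_square_int: "(\<lambda>n::int. 1 / (1 + \<bar>of_int n\<bar>)\<^sup>2 :: real) summable_on UNIV"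
proof -
  have nat: "(\<lambda>k::nat. 1 / (1 + real k)\<^sup>2) summable_on UNIV"
  proof (rule norm_summable_imp_summable_on)
    have "summable (\<lambda>k. inverse (real (Suc k) ^ 2))"
      using inverse_power_summable[of 2, where 'a = real] by (subst summable_Suc_iff) auto
    then show "summable (\<lambda>k. norm (1 / (1 + real k)\<^sup>2))" by (simp add: divide_inverse)
  qed
  have "(\<lambda>n::int. 1 / (1 + \<bar>of_int n\<bar>)\<^sup>2 :: real) summable_on (int ` UNIV)"
    by (subst summable_on_reindex) (use nat in \<open>auto simp: o_def inj_on_def\<close>)
  moreover have "(\<lambda>n::int. 1 / (1 + \<bar>of_int n\<bar>)\<^sup>2 :: real) summable_on ((\<lambda>k. - int k) ` UNIV)"
    by (subst summable_on_reindex) (use nat in \<open>auto simp: o_def inj_on_def\<close>)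
  ultimately have "(\<lambda>n::int. 1 / (1 + \<bar>of_int n\<bar>)\<^sup>2 :: real) summable_on (int ` UNIV \<union> (\<lambda>k. - int k) ` UNIV)"
    by (rule summable_on_union)
  moreover have "(int ` UNIV \<union> (\<lambda>k. - int k) ` UNIV) = UNIV"
  proof -
    have "n \<in> int ` UNIV \<union> (\<lambda>k. - int k) ` UNIV" for n
      by (cases n rule: int_cases2) auto
    then show ?thesis by auto
  qed
  ultimately show ?thesis by simp
qed

context elastic
begin

text \<open>The factor lost when \<open>n\<close> is recovered from \<open>\<alpha>\<^sub>n = \<alpha> + 2\<pi>n/\<Lambda>\<close> (\<open>index_le_alphan\<close>).\<close>

definition growth :: real where
  "growth = 1 + period p / (2 * pi) * (1 + \<bar>alpha p\<bar>)"

lemma growth_pos: "0 < growth"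
  using period0 by (auto simp: growth_def intro!: add_pos_nonneg)

lemma index_le_alphan: "1 + \<bar>of_int n\<bar> \<le> growth * (1 + \<bar>alphan p n\<bar>)"
proof -
  define r where "r = period p / (2 * pi)"
  have r: "0 < r" using period0 by (simp add: r_def)
  have "of_int n = r * (alphan p n - alpha p)"
    using period0 by (simp add: r_def alphan_def)
  then have "\<bar>of_int n\<bar> = r * \<bar>alphan p n - alpha p\<bar>" using r by (simp add: abs_mult)
  also have "\<dots> \<le> r * (\<bar>alphan p n\<bar> + \<bar>alpha p\<bar>)" using r by (intro mult_left_mono abs_triangle_ineq4) auto
  also have "\<dots> \<le> r * ((1 + \<bar>alphan p n\<bar>) * (1 + \<bar>alpha p\<bar>))"
    using r by (intro mult_left_mono) (auto simp: algebra_simps)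
  finally have "1 + \<bar>of_int n\<bar> \<le> (1 + \<bar>alphan p n\<bar>) + r * ((1 + \<bar>alphan p n\<bar>) * (1 + \<bar>alpha p\<bar>))" by simp
  also have "\<dots> = growth * (1 + \<bar>alphan p n\<bar>)"
    unfolding growth_def r_def[symmetric] by (simp add: algebra_simps)
  finally show ?thesis .
qed

lemma decay2_ge: assumes "kappa2 p < \<bar>alphan p n\<bar>" shows "\<bar>alphan p n\<bar> - kappa2 p \<le> decay2 p n"
  unfolding decay2_def
proof (rule real_le_rsqrt)
  have "(\<bar>alphan p n\<bar> - kappa2 p)\<^sup>2 \<le> (\<bar>alphan p n\<bar> - kappa2 p) * (\<bar>alphan p n\<bar> + kappa2 p)"
    unfolding power2_eq_square using assms kappa_pos by (intro mult_left_mono) auto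
  also have "\<dots> = (alphan p n)\<^sup>2 - (kappa2 p)\<^sup>2"
    by (simp add: algebra_simps power2_eq_square)
  finally show "(\<bar>alphan p n\<bar> - kappa2 p)\<^sup>2 \<le> (alphan p n)\<^sup>2 - (kappa2 p)\<^sup>2" .
qed

lemma exp_decay2_le:
  assumes "kappa2 p < \<bar>alphan p n\<bar>" "0 < d"
  shows "exp (- decay2 p n * d) \<le> exp (d * (1 + kappa2 p)) * exp (- d * (1 + \<bar>alphan p n\<bar>))"
proof -
  have "- decay2 p n * d \<le> - (\<bar>alphan p n\<bar> - kappa2 p) * d"
    using decay2_ge[OF assms(1)] assms(2) by (intro mult_right_mono) auto
  also have "\<dots> = d * (1 + kappa2 p) + - d * (1 + \<bar>alphan p n\<bar>)" by (simp add: algebra_simps)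
  finally show ?thesis by (simp flip: exp_add)
qed

text \<open>Two of the six powers that the exponential dominates are spent on summability.\<close>

lemma poly_exp_decay2_le:
  assumes ev: "kappa2 p < \<bar>alphan p n\<bar>" and d: "0 < d"
  shows "(1 + \<bar>alphan p n\<bar>) ^ 4 * exp (- decay2 p n * d)
      \<le> exp (d * (1 + kappa2 p)) * (6 / d) ^ 6 * growth\<^sup>2 * (1 / (1 + \<bar>of_int n\<bar>)\<^sup>2)"
proof -
  define q where "q = 1 + \<bar>alphan p n\<bar>"
  define E where "E = exp (d * (1 + kappa2 p))"
  define N where "N = 1 + \<bar>of_int n :: real\<bar>"
  have q: "0 < q" by (simp add: q_def add_pos_nonneg)
  have N: "0 < N" by (simp add: N_def add_pos_nonneg)
  have E: "0 < E" by (simp add: E_def)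
  have "N\<^sup>2 * (q ^ 4 * exp (- decay2 p n * d)) \<le> (growth * q)\<^sup>2 * (q ^ 4 * (E * exp (- d * q)))"
    using index_le_alphan[of n] exp_decay2_le[OF assms] q N
    unfolding N_def[symmetric] q_def[symmetric] E_def[symmetric]
    by (intro mult_mono power_mono) auto
  also have "\<dots> = E * growth\<^sup>2 * (q ^ 6 * exp (- d * q))"
    by (simp add: power_mult_distrib power2_eq_square numeral_eq_Suc mult_ac)
  also have "\<dots> \<le> E * growth\<^sup>2 * (real 6 / d) ^ 6"
    using E q d by (intro mult_left_mono power_times_exp_le) auto
  finally have "N\<^sup>2 * (q ^ 4 * exp (- decay2 p n * d)) \<le> E * (6 / d) ^ 6 * growth\<^sup>2" by (simp add: mult_ac)
  then have "q ^ 4 * exp (- decay2 p n * d) \<le> E * (6 / d) ^ 6 * growth\<^sup>2 / N\<^sup>2"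
    by (subst pos_le_divide_eq[OF zero_less_power[OF N]]) (simp only: mult.commute[of _ "N\<^sup>2"])
  then show ?thesis unfolding N_def q_def E_def by simp
qed

lemma index_exp_decay2_le:
  assumes ev: "kappa2 p < \<bar>alphan p n\<bar>" and d: "0 < d"
  shows "\<bar>of_int n\<bar> * exp (- decay2 p n * d) \<le> growth * exp (d * (1 + kappa2 p)) * (1 / d)"
proof -
  define q where "q = 1 + \<bar>alphan p n\<bar>"
  have q: "0 < q" by (simp add: q_def add_pos_nonneg)
  have "\<bar>of_int n\<bar> * exp (- decay2 p n * d) \<le> (growth * q) * (exp (d * (1 + kappa2 p)) * exp (- d * q))"
    using index_le_alphan[of n] exp_decay2_le[OF assms] growth_pos q unfolding q_def[symmetric]
    by (intro mult_mono) auto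
  also have "\<dots> = growth * exp (d * (1 + kappa2 p)) * (q ^ 1 * exp (- d * q))" by simp
  also have "\<dots> \<le> growth * exp (d * (1 + kappa2 p)) * (real 1 / d) ^ 1"
    using growth_pos q d by (intro mult_left_mono power_times_exp_le) auto
  finally show ?thesis by simp
qed

text \<open>All but finitely many modes have \<open>\<gamma>\<^sub>2 \<ge> 1\<close>.\<close>

lemma decay2_uniform_lower_bound:
  obtains g0 where "0 < g0" "\<And>n. kappa2 p < \<bar>alphan p n\<bar> \<Longrightarrow> g0 \<le> decay2 p n"
proof -
  define A where "A = {n. kappa2 p < \<bar>alphan p n\<bar> \<and> \<bar>alphan p n\<bar> < kappa2 p + 1}"
  define r where "r = growth * (2 + kappa2 p)"
  have "A \<subseteq> {- \<lceil>r\<rceil>..\<lceil>r\<rceil>}"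
  proof
    fix n assume "n \<in> A"
    then have "growth * (1 + \<bar>alphan p n\<bar>) \<le> r"
      unfolding r_def using growth_pos by (intro mult_left_mono) (auto simp: A_def)
    then have "\<bar>of_int n\<bar> \<le> r" using index_le_alphan[of n] by linarith
    then show "n \<in> {- \<lceil>r\<rceil>..\<lceil>r\<rceil>}" by (simp add: abs_le_iff) linarith
  qed
  then have fin: "finite A" by (rule finite_subset) simp
  define g0 where "g0 = Min (insert 1 (decay2 p ` A))"
  have "0 < g0" unfolding g0_def using fin decay_pos(1) by (auto simp: A_def)
  moreover have "g0 \<le> decay2 p n" if "kappa2 p < \<bar>alphan p n\<bar>" for n
  proof (cases "n \<in> A")
    case True
    then show ?thesis unfolding g0_def using fin by (intro Min_le) auto
  next
    case False
    then have "1 \<le> decay2 p n" using decay2_ge[OF that] that by (simp add: A_def)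
    moreover have "g0 \<le> 1" unfolding g0_def using fin by (intro Min_le) auto
    ultimately show ?thesis by simp
  qed
  ultimately show thesis by (rule that)
qed

end

context cutoff_cell
begin

lemma top_integral_dtn_mode_le:
  assumes ev: "kappa2 p < \<bar>alphan p n\<bar>" and v: "v \<in> H1_qp_vec p"
    and F: "\<And>j. norm (fourier_coeff p (\<lambda>z. u z $ j) n) \<le> F"
    and G: "\<And>i. norm (fourier_coeff p (\<lambda>z. v z $ i) n) \<le> G"
  shows "norm (top_integral p (dtn_mode p u n) v)
    \<le> 4 * period p * ((lame_mu p + (freq p)\<^sup>2 / ((kappa2 p)\<^sup>2 / 2)) * \<bar>alphan p n\<bar>) * F * G"
proof -
  define M where "M = (lame_mu p + (freq p)\<^sup>2 / ((kappa2 p)\<^sup>2 / 2)) * \<bar>alphan p n\<bar>"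
  have F0: "0 \<le> F" using order_trans[OF norm_ge_zero F] .
  have G0: "0 \<le> G" using order_trans[OF norm_ge_zero G] .
  have M0: "0 \<le> M" using order_trans[OF norm_ge_zero norm_dtn_entry[OF ev]] by (simp add: M_def)
  have X: "norm ((dtn_matrix p n *v fourier_coeff_vec p u n) $ i) \<le> 2 * (M * F)" for i
  proof -
    have "norm (dtn_matrix p n $ i $ j * fourier_coeff p (\<lambda>z. u z $ j) n) \<le> M * F" for j
      unfolding norm_mult M_def[symmetric] using norm_dtn_entry[OF ev, of i j] F[of j] M0
      by (intro mult_mono) (auto simp: M_def)
    from norm_triangle_le[OF add_mono[OF this[of 1] this[of 2]]] show ?thesis
      by (simp add: matrix_vector_mult_def sum_2 fourier_coeff_vec_def mult_ac)
  qed
  have "norm ((dtn_matrix p n *v fourier_coeff_vec p u n) $ i * cnj (fourier_coeff p (\<lambda>z. v z $ i) n)) \<le> 2 * (M * F) * G" for i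
    unfolding norm_mult complex_mod_cnj using X[of i] G[of i] M0 F0 by (intro mult_mono) auto
  from norm_triangle_le[OF add_mono[OF this[of 1] this[of 2]]]
  have "norm (\<Sum>i\<in>UNIV. (dtn_matrix p n *v fourier_coeff_vec p u n) $ i * cnj (fourier_coeff p (\<lambda>z. v z $ i) n)) \<le> 4 * M * F * G"
    by (simp add: sum_2 mult_ac)
  then have "period p * norm (\<Sum>i\<in>UNIV. (dtn_matrix p n *v fourier_coeff_vec p u n) $ i * cnj (fourier_coeff p (\<lambda>z. v z $ i) n))
      \<le> period p * (4 * M * F * G)"
    using period_pos by (intro mult_left_mono) auto
  then show ?thesis
    unfolding top_integral_dtn_mode(1)[OF v] norm_mult M_def[symmetric] using period_pos by (simp add: mult_ac)
qed

lemma top_integral_dtn_trunc: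
  assumes v: "v \<in> H1_qp_vec p"
  shows "top_integral p (dtn_trunc p N u) v = (\<Sum>n\<in>{n. \<bar>n\<bar> \<le> int N}. top_integral p (dtn_mode p u n) v)"
proof -
  have eq: "cdot (dtn_trunc p N u x) y = (\<Sum>n\<in>{n. \<bar>n\<bar> \<le> int N}. cdot (dtn_mode p u n x) y)" for x y
    by (simp add: cdot_def dtn_trunc_def sum_2 sum.distrib sum_distrib_right)
  show ?thesis
    unfolding top_integral_def eq set_lebesgue_integral_def scaleR_sum_right
    by (rule Bochner_Integration.integral_sum)
      (rule top_integral_dtn_mode(2)[OF v, unfolded set_integrable_def])
qed

text \<open>The exponential over the distance \<open>b - b2\<close> splits into the factor over \<open>b - b'\<close>, which is at most
  the supremum because \<open>\<bar>n\<bar> \<ge> 1\<close>, and the factor over \<open>d = b' - b2\<close>, which controls the polynomial growth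
  and the sum.\<close>

lemma truncation_estimate:
  assumes b': "b2 < b'" "b' < height p"
  shows "\<exists>C>0. \<forall>u\<in>H1_qp_vec p. (\<forall>v\<in>H1_S_qp_vec p. sesq_form p u v = 0) \<longrightarrow>
    (\<forall>N::nat. (\<forall>n. int N < \<bar>n\<bar> \<longrightarrow> kappa2 p < \<bar>alphan p n\<bar>) \<longrightarrow>
      (\<forall>v\<in>H1_qp_vec p.
        cmod (dtn_pairing p u v - top_integral p (dtn_trunc p N u) v)
        \<le> C * (SUP n\<in>{n. int N < \<bar>n\<bar>}. of_int \<bar>n\<bar> * exp (- decay2 p n * (height p - b')))
            * H1_norm_vec (Omega p) u * H1_norm_vec (Omega p) v))"
proof -
  obtain g0 where g0: "0 < g0" "\<And>n. kappa2 p < \<bar>alphan p n\<bar> \<Longrightarrow> g0 \<le> decay2 p n"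
    using decay2_uniform_lower_bound by metis
  define R where "R = sqrt (measure lborel (Omega p))"
  define CF where "CF = 2 * K * (3 * lame_mu p + 4 * (lame_lambda p + lame_mu p)) * ((1 / g0 + 1) / (2 * (freq p)\<^sup>2)) * R / period p"
  define CV where "CV = 2 * K * R / period p"
  define CM where "CM = lame_mu p + (freq p)\<^sup>2 / ((kappa2 p)\<^sup>2 / 2)"
  define d where "d = b' - b2"
  define CE where "CE = exp (d * (1 + kappa2 p)) * (6 / d) ^ 6 * growth\<^sup>2"
  define Z where "Z = (\<Sum>\<^sub>\<infinity>n::int. 1 / (1 + \<bar>of_int n\<bar>)\<^sup>2 :: real)"
  define C0 where "C0 = 4 * period p * CM * CF * CV * CE"
  have d: "0 < d" using b' by (simp add: d_def)
  have R0: "0 \<le> R" by (simp add: R_def)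
  have CF0: "0 \<le> CF"
  proof -
    have "0 \<le> 3 * lame_mu p + 4 * (lame_lambda p + lame_mu p)" "0 \<le> 1 / g0 + 1" "0 < 2 * (freq p)\<^sup>2"
      using mu0 lm0 g0(1) freq0 by simp_all
    then show ?thesis unfolding CF_def using K_pos R0 period_pos
      by (intro divide_nonneg_pos mult_nonneg_nonneg) linarith+
  qed
  have CV0: "0 \<le> CV" unfolding CV_def using K_pos R0 period_pos by simp
  have CM0: "0 \<le> CM" unfolding CM_def using mu0 by simp
  have CE0: "0 \<le> CE" unfolding CE_def using d by simp
  have C00: "0 \<le> C0" unfolding C0_def using CF0 CV0 CM0 CE0 period_pos by simp
  have Z0: "0 \<le> Z" unfolding Z_def by (rule infsum_nonneg) simp
  show ?thesis
  proof (intro exI[of _ "C0 * Z + 1"] conjI ballI impI allI)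
    \<comment> \<open>The summand 1 only ensures that the constant is positive.\<close>
    show "0 < C0 * Z + 1" using C00 Z0 by (simp add: add_nonneg_pos)
    fix u N v
    assume u: "u \<in> H1_qp_vec p" and sol: "\<forall>v\<in>H1_S_qp_vec p. sesq_form p u v = 0"
      and ev: "\<forall>n. int N < \<bar>n\<bar> \<longrightarrow> kappa2 p < \<bar>alphan p n\<bar>" and v: "v \<in> H1_qp_vec p"
    define Hu where "Hu = H1_norm_vec (Omega p) u"
    define Hv where "Hv = H1_norm_vec (Omega p) v"
    define f where "f = (\<lambda>n::int. real_of_int \<bar>n\<bar> * exp (- decay2 p n * (height p - b')))"
    define S where "S = (SUP n\<in>{n. int N < \<bar>n\<bar>}. f n)"
    define A where "A = {n::int. \<bar>n\<bar> \<le> int N}"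
    define B where "B = {n::int. int N < \<bar>n\<bar>}"
    define T where "T = (\<lambda>n. top_integral p (dtn_mode p u n) v)"
    have H0: "0 \<le> Hu" "0 \<le> Hv" by (simp_all add: Hu_def Hv_def H1_norm_vec_nonneg)
    have "f n \<le> growth * exp ((height p - b') * (1 + kappa2 p)) * (1 / (height p - b'))" if "n \<in> B" for n
      unfolding f_def of_int_abs using ev that b' by (intro index_exp_decay2_le) (auto simp: B_def)
    then have bdd: "bdd_above (f ` B)" by (intro bdd_aboveI2)
    have fS: "exp (- decay2 p n * (height p - b')) \<le> S" if "n \<in> B" for n
    proof -
      have "1 \<le> real_of_int \<bar>n\<bar>" using that by (simp add: B_def)
      then have "1 * exp (- decay2 p n * (height p - b')) \<le> f n"
        unfolding f_def by (intro mult_right_mono) auto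
      also have "\<dots> \<le> S" unfolding S_def B_def[symmetric] by (rule cSUP_upper[OF that bdd])
      finally show ?thesis by simp
    qed
    have S0: "0 \<le> S"
    proof -
      have "int N + 1 \<in> B" by (simp add: B_def)
      from fS[OF this] show ?thesis by (meson exp_ge_zero order_trans)
    qed
    have T: "norm (T n) \<le> C0 * S * Hu * Hv * (1 / (1 + \<bar>of_int n\<bar>)\<^sup>2)" if n: "n \<in> B" for n
    proof -
      have evn: "kappa2 p < \<bar>alphan p n\<bar>" using ev n by (simp add: B_def)
      define q where "q = 1 + \<bar>alphan p n\<bar>"
      define e1 where "e1 = exp (- decay2 p n * (height p - b'))"
      define e2 where "e2 = exp (- decay2 p n * d)"
      have q: "0 \<le> q" "\<bar>alphan p n\<bar> \<le> q" by (simp_all add: q_def)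
      have e: "exp (- decay2 p n * (height p - b2)) = e1 * e2"
        by (simp add: e1_def e2_def d_def algebra_simps flip: exp_add)
      have F: "norm (fourier_coeff p (\<lambda>z. u z $ j) n) \<le> CF * q ^ 3 * (e1 * e2) * Hu" for j
        using fourier_coeff_decay[OF evn u _ g0(1) g0(2)[OF evn], of j] sol
        unfolding e CF_def R_def q_def Hu_def by blast
      have G: "norm (fourier_coeff p (\<lambda>z. v z $ i) n) \<le> CV * Hv" for i
      proof -
        have "(\<lambda>z. v z $ i) \<in> H1_qp p" using v by (simp add: H1_qp_vec_def)
        from trace_coeff_bound[OF this, of n]
        have "norm (fourier_coeff p (\<lambda>z. v z $ i) n) \<le> CV * H1_norm (Omega p) (\<lambda>z. v z $ i)"
          unfolding CV_def R_def .
        also have "\<dots> \<le> CV * Hv" unfolding Hv_def by (rule mult_left_mono[OF H1_norm_component_le CV0])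
        finally show ?thesis .
      qed
      have "norm (T n) \<le> 4 * period p * (CM * \<bar>alphan p n\<bar>) * (CF * q ^ 3 * (e1 * e2) * Hu) * (CV * Hv)"
        unfolding T_def CM_def by (rule top_integral_dtn_mode_le[OF evn v F G])
      also have "\<dots> \<le> 4 * period p * (CM * q) * (CF * q ^ 3 * (e1 * e2) * Hu) * (CV * Hv)"
        using q period_pos CM0 CF0 CV0 H0
        by (intro mult_right_mono mult_left_mono mult_nonneg_nonneg) (auto simp: e1_def e2_def)
      also have "\<dots> = 4 * period p * CM * CF * CV * Hu * Hv * (e1 * (q ^ 4 * e2))"
        by (simp add: numeral_eq_Suc mult_ac)
      also have "\<dots> \<le> 4 * period p * CM * CF * CV * Hu * Hv * (S * (CE * (1 / (1 + \<bar>of_int n\<bar>)\<^sup>2)))"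
      proof (rule mult_left_mono[OF mult_mono])
        show "e1 \<le> S" unfolding e1_def by (rule fS[OF n])
        show "q ^ 4 * e2 \<le> CE * (1 / (1 + \<bar>of_int n\<bar>)\<^sup>2)"
          unfolding q_def e2_def CE_def by (rule poly_exp_decay2_le[OF evn d])
        show "0 \<le> q ^ 4 * e2" using q by (simp add: e2_def)
        show "0 \<le> 4 * period p * CM * CF * CV * Hu * Hv"
          using period_pos CM0 CF0 CV0 H0 by simp
      qed (rule S0)
      also have "\<dots> = C0 * S * Hu * Hv * (1 / (1 + \<bar>of_int n\<bar>)\<^sup>2)"
        by (simp add: C0_def mult_ac)
      finally show ?thesis .
    qed
    define h where "h = (\<lambda>n::int. C0 * S * Hu * Hv * (1 / (1 + \<bar>of_int n\<bar>)\<^sup>2))"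
    have hsum: "h summable_on UNIV"
      unfolding h_def by (rule summable_on_cmult_right[OF summable_on_inverse_square_int])
    have h0: "0 \<le> h n" for n unfolding h_def using C00 S0 H0 by simp
    have hB: "h summable_on B" by (rule summable_on_subset_banach[OF hsum]) simp
    have "(\<lambda>n. norm (T n)) summable_on B"
      by (rule summable_on_comparison_test[OF hB]) (use T in \<open>auto simp: h_def\<close>)
    then have TB: "T summable_on B" by (rule abs_summable_summable)
    have finA: "finite A"
      by (rule finite_subset[of _ "{- int N..int N}"]) (auto simp: A_def)
    have "dtn_pairing p u v = infsum T (A \<union> B)"
    proof -
      have "A \<union> B = UNIV" by (auto simp: A_def B_def)
      then show ?thesis by (simp add: dtn_pairing_def T_def)
    qed
    also have "\<dots> = infsum T A + infsum T B"
      by (rule infsum_Un_disjoint[OF summable_on_finite[OF finA] TB]) (auto simp: A_def B_def)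
    also have "infsum T A = top_integral p (dtn_trunc p N u) v"
      using finA by (simp add: top_integral_dtn_trunc[OF v] T_def A_def)
    finally have "dtn_pairing p u v - top_integral p (dtn_trunc p N u) v = infsum T B" by simp
    also have "cmod \<dots> \<le> infsum h B"
      by (rule norm_infsum_le[OF has_sum_infsum[OF TB] has_sum_infsum[OF hB]]) (use T in \<open>simp add: h_def\<close>)
    also have "\<dots> \<le> infsum h UNIV"
      by (rule infsum_mono_neutral[OF hB hsum]) (use h0 in auto)
    also have "\<dots> = C0 * S * Hu * Hv * Z"
      unfolding h_def Z_def by (rule infsum_cmult_right[OF summable_on_inverse_square_int])
    also have "\<dots> \<le> (C0 * Z + 1) * S * Hu * Hv"
    proof -
      have "0 \<le> S * Hu * Hv" using S0 H0 by simp
      then show ?thesis by (simp add: algebra_simps)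
    qed
    finally show "cmod (dtn_pairing p u v - top_integral p (dtn_trunc p N u) v)
        \<le> (C0 * Z + 1) * (SUP n\<in>{n. int N < \<bar>n\<bar>}. of_int \<bar>n\<bar> * exp (- decay2 p n * (height p - b')))
            * H1_norm_vec (Omega p) u * H1_norm_vec (Omega p) v"
      unfolding S_def f_def Hu_def Hv_def .
  qed
qed

end

theorem lemma5p3:
  fixes p :: grating and b' :: real
  assumes "0 < period p"
    and "\<And>x. profile p (x + period p) = profile p x"
    and "\<exists>L. L-lipschitz_on UNIV (profile p)"
    and "(SUP x\<in>{0<..<period p}. profile p x) < b'" and "b' < height p"
    and "0 < freq p" and "0 < lame_mu p" and "0 < lame_lambda p + lame_mu p"
    and "- pi / 2 < incidence p" and "incidence p < pi / 2"
    and "\<And>n. kappa1 p \<noteq> \<bar>alphan p n\<bar>" and "\<And>n. kappa2 p \<noteq> \<bar>alphan p n\<bar>"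
    and "well_posed p"
  shows "\<exists>C>0. \<forall>u. is_solution p u \<longrightarrow>
    (\<forall>N::nat. (\<forall>n. int N < \<bar>n\<bar> \<longrightarrow> Re (beta2 p n) = 0) \<longrightarrow>
      (\<forall>v\<in>H1_qp_vec p.
        cmod (dtn_pairing p u v - top_integral p (dtn_trunc p N u) v)
        \<le> C * (SUP n\<in>{n. int N < \<bar>n\<bar>}.
                  of_int \<bar>n\<bar> * Re (exp (\<i> * beta2 p n * of_real (height p - b'))))
            * H1_norm_vec (Omega p) (u_inc p) * H1_norm_vec (Omega p) v))"
proof -
  have cont: "continuous_on UNIV (profile p)"
    using assms(3) lipschitz_on_continuous_on by blast
  define s where "s = (SUP x\<in>{0<..<period p}. profile p x)"
  \<comment> \<open>The supremum is over the open interval; continuity extends the bound to the end points.\<close>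
  have le: "profile p x \<le> s" if "0 \<le> x" "x \<le> period p" for x
  proof -
    have "bdd_above (profile p ` {0..period p})"
      by (intro bounded_imp_bdd_above compact_imp_bounded compact_continuous_image
          continuous_on_subset[OF cont]) auto
    then have bdd: "bdd_above (profile p ` {0<..<period p})"
      by (rule bdd_above_mono) auto
    have "closure {0<..<period p} \<subseteq> {x. profile p x \<le> s}"
    proof (rule closure_minimal)
      show "{0<..<period p} \<subseteq> {x. profile p x \<le> s}"
        unfolding s_def using cSUP_upper[OF _ bdd] by auto
      show "closed {x. profile p x \<le> s}"
        by (intro closed_Collect_le cont continuous_on_const)
    qed
    moreover have "x \<in> closure {0<..<period p}"
      using that assms(1) by (simp add: closure_greaterThanLessThan)
    ultimately show ?thesis by auto
  qed
  \<comment> \<open>Two levels between the maximum of the profile and \<open>b'\<close>, so that the transition layer of the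
    cut-off is strictly below \<open>b'\<close>.\<close>
  define a where "a = (2 * s + b') / 3"
  define b2 where "b2 = (s + 2 * b') / 3"
  have ord: "s < a" "a < b2" "b2 < b'" using assms(4) by (simp_all add: a_def b2_def s_def)
  obtain \<psi> \<psi>' \<psi>'' K where cut: "\<And>k. Ck1 k \<psi>" "\<And>k. Ck1 k \<psi>'" "\<And>k. Ck1 k \<psi>''"
    "\<And>y. (\<psi> has_vector_derivative \<psi>' y) (at y)" "\<And>y. (\<psi>' has_vector_derivative \<psi>'' y) (at y)"
    "\<And>y. y \<le> a \<Longrightarrow> \<psi> y = 0" "\<And>y. b2 \<le> y \<Longrightarrow> \<psi> y = 1" "\<And>y. b2 < y \<Longrightarrow> \<psi>' y = 0" "\<And>y. b2 < y \<Longrightarrow> \<psi>'' y = 0"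
    "0 < K" "\<And>y. norm (\<psi> y) \<le> K" "\<And>y. norm (\<psi>' y) \<le> K" "\<And>y. norm (\<psi>'' y) \<le> K"
    using smooth_cutoff_bounded[OF ord(2)] by blast
  interpret cutoff_cell p a b2 K \<psi> \<psi>' \<psi>''
  proof
    show "profile p (period p) = profile p 0" using assms(2)[of 0] by simp
    show "profile p x < a" if "0 \<le> x" "x \<le> period p" for x using le[OF that] ord by simp
    show "a < height p" "b2 < height p" using ord assms(5) by simp_all
  qed (use assms cont cut in auto)
  obtain C1 where C1: "C1 > 0" and est: "\<And>u N v. u \<in> H1_qp_vec p \<Longrightarrow> (\<And>v. v \<in> H1_S_qp_vec p \<Longrightarrow> sesq_form p u v = 0) \<Longrightarrow>
      (\<And>n. int N < \<bar>n\<bar> \<Longrightarrow> kappa2 p < \<bar>alphan p n\<bar>) \<Longrightarrow> v \<in> H1_qp_vec p \<Longrightarrow>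
        cmod (dtn_pairing p u v - top_integral p (dtn_trunc p N u) v)
        \<le> C1 * (SUP n\<in>{n. int N < \<bar>n\<bar>}. of_int \<bar>n\<bar> * exp (- decay2 p n * (height p - b')))
            * H1_norm_vec (Omega p) u * H1_norm_vec (Omega p) v"
    using truncation_estimate[OF ord(3) assms(5)] by blast
  obtain C2 where C2: "C2 > 0" and wp: "\<And>u. is_solution p u \<Longrightarrow>
      H1_norm_vec (Omega p) u \<le> C2 * H1_norm_vec (Omega p) (u_inc p)"
    using assms(13) unfolding well_posed_def by blast
  show ?thesis
  proof (intro exI[of _ "C1 * C2"] conjI allI impI ballI)
    show "0 < C1 * C2" using C1 C2 by simp
    fix u N v
    assume u: "is_solution p u" and N: "\<forall>n. int N < \<bar>n\<bar> \<longrightarrow> Re (beta2 p n) = 0" and v: "v \<in> H1_qp_vec p"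
    have ev: "kappa2 p < \<bar>alphan p n\<bar>" if "int N < \<bar>n\<bar>" for n
    proof (rule ccontr)
      assume "\<not> kappa2 p < \<bar>alphan p n\<bar>"
      then have less: "\<bar>alphan p n\<bar> < kappa2 p" using assms(12)[of n] by simp
      then have "(alphan p n)\<^sup>2 < (kappa2 p)\<^sup>2" using power_strict_mono[OF less, of 2] by simp
      then have "Re (beta2 p n) > 0" using less by (simp add: beta2_def vertical_wavenumber_def)
      then show False using N that by simp
    qed
    define S where "S = (SUP n\<in>{n. int N < \<bar>n\<bar>}. of_int \<bar>n\<bar> * exp (- decay2 p n * (height p - b')))"
    have S: "(SUP n\<in>{n. int N < \<bar>n\<bar>}. of_int \<bar>n\<bar> * Re (exp (\<i> * beta2 p n * of_real (height p - b')))) = S"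
      unfolding S_def
    proof (rule SUP_cong[OF refl])
      fix n assume "n \<in> {n. int N < \<bar>n\<bar>}"
      then have "\<i> * beta2 p n * of_real (height p - b') = of_real (- decay2 p n * (height p - b'))"
        using beta_decay(2)[OF ev] by (simp add: mult.assoc[symmetric])
      then show "of_int \<bar>n\<bar> * Re (exp (\<i> * beta2 p n * of_real (height p - b')))
          = of_int \<bar>n\<bar> * exp (- decay2 p n * (height p - b'))"
        by (simp only: exp_of_real Re_complex_of_real)
    qed
    have "cmod (dtn_pairing p u v - top_integral p (dtn_trunc p N u) v)
        \<le> C1 * S * H1_norm_vec (Omega p) u * H1_norm_vec (Omega p) v"
      unfolding S_def using u ev v by (intro est) (auto simp: is_solution_def)
    also have "\<dots> \<le> C1 * S * (C2 * H1_norm_vec (Omega p) (u_inc p)) * H1_norm_vec (Omega p) v"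
    proof (intro mult_right_mono mult_left_mono wp[OF u] H1_norm_vec_nonneg)
      have "bdd_above ((\<lambda>n. of_int \<bar>n\<bar> * exp (- decay2 p n * (height p - b'))) ` {n. int N < \<bar>n\<bar>})"
        using index_exp_decay2_le[OF ev, of _ "height p - b'"] assms(5)
        by (intro bdd_aboveI2[where M = "growth * exp ((height p - b') * (1 + kappa2 p)) * (1 / (height p - b'))"]) auto
      then have "of_int \<bar>int N + 1\<bar> * exp (- decay2 p (int N + 1) * (height p - b')) \<le> S"
        unfolding S_def by (intro cSUP_upper) auto
      moreover have "0 \<le> real_of_int \<bar>int N + 1\<bar> * exp (- decay2 p (int N + 1) * (height p - b'))" by simp
      ultimately have "0 \<le> S" by linarith
      then show "0 \<le> C1 * S" using C1 by simp
    qed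
    finally show "cmod (dtn_pairing p u v - top_integral p (dtn_trunc p N u) v)
        \<le> C1 * C2 * (SUP n\<in>{n. int N < \<bar>n\<bar>}.
                  of_int \<bar>n\<bar> * Re (exp (\<i> * beta2 p n * of_real (height p - b'))))
            * H1_norm_vec (Omega p) (u_inc p) * H1_norm_vec (Omega p) v"
      unfolding S by (simp add: mult_ac)
  qed
qed

end
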